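(* Let $F$ be the free pro-$p$-group on $x_1,\ldots,x_d$. (i) Let $1\neq r\in F_{(2)}$ such that for some $\tau=(\tau_1,\ldots,\tau_d)$ the initial form $\rho$ of $r$ in $\mathrm{gr}^\tau F$ is a Lie polynomial, i.e. $\rho\in L(X)\subset L_{res}(X)\cong\mathrm{gr}^\tau F$, $X=\{X_1,\ldots,X_d\}$. Then $G=F/(r)$ is mild with respect to the Zassenhaus $(x,\tau)$-filtration. (ii) Let $r\in F_{(2)}$ such that for some $\tau=(\tau_1,\ldots,\tau_d)$ and some $n\in\mathbb{N}$ with $(n,p)=1$ we have $r\in F_{(\tau,n)}\setminus F_{(\tau,n+1)}$. Then $G=F/(r)$ is mild with respect to the Zassenhaus $(x,\tau)$-filtration.
   Context: Let $p$ be a prime. Identify the complete group algebra of $F$ over $\mathbb{F}_p$ with the algebra $\mathbb{F}_p\langle\langle X_1,\ldots,X_d\rangle\rangle$ of formal power series in non-commuting indeterminates via $x_i\mapsto1+X_i$. For integers $\tau_i>0$, the Zassenhaus $(x,\tau)$-filtration is $F_{(\tau,n)}=\{f\in F\mid f-1$ has only monomials $X_{i_1}\cdots X_{i_k}$ with $\tau_{i_1}+\ldots+\tau_{i_k}\ge n\}$; $F_{(2)}$ is the second step of the usual Zassenhaus filtration ($\tau=(1,\ldots,1)$). The graded restricted Lie algebra $\mathrm{gr}^\tau F=\bigoplus F_{(\tau,n)}/F_{(\tau,n+1)}$ identifies with the free restricted Lie algebra $L_{res}(X)$ inside $\mathbb{F}_p\langle X_1,\ldots,X_d\rangle$ (graded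 by $\deg X_i=\tau_i$), which contains the free Lie algebra $L(X)$ generated by $X$. A one-relator quotient $G=F/(r)$ is mild with respect to the $(x,\tau)$-filtration if the initial form $\rho$ of $r$ is strongly free, i.e. $\mathbb{F}_p\langle X\rangle/(\rho)$ has Poincaré series $1/(1-(t^{\tau_1}+\ldots+t^{\tau_d})+t^{\deg\rho})$; mild groups have cohomological dimension 2. *)

theory Defs
  imports
    "HOL-Analysis.Analysis"
    "HOL-Algebra.Algebra"
    "HOL-Computational_Algebra.Formal_Power_Series"
    "Berlekamp_Zassenhaus.Finite_Field"
begin

section \<open>Pro-\<open>p\<close> groups\<close>

definition topological_group :: "('a, 'b) monoid_scheme \<Rightarrow> 'a topology \<Rightarrow> bool" where
  "topological_group G T \<longleftrightarrow>
     group G \<and> topspace T = carrier G \<and>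
     continuous_map (prod_topology T T) T (\<lambda>(g, h). g \<otimes>\<^bsub>G\<^esub> h) \<and>
     continuous_map T T (\<lambda>g. inv\<^bsub>G\<^esub> g)"

definition profinite_group :: "('a, 'b) monoid_scheme \<Rightarrow> 'a topology \<Rightarrow> bool" where
  "profinite_group G T \<longleftrightarrow>
     topological_group G T \<and> compact_space T \<and> Hausdorff_space T \<and>
     (\<forall>U. openin T U \<and> \<one>\<^bsub>G\<^esub> \<in> U \<longrightarrow> (\<exists>H. subgroup H G \<and> openin T H \<and> H \<subseteq> U))"

definition pro_p_group :: "nat \<Rightarrow> ('a, 'b) monoid_scheme \<Rightarrow> 'a topology \<Rightarrow> bool" where
  "pro_p_group p G T \<longleftrightarrow>
     profinite_group G T \<and>
     (\<forall>N. N \<lhd> G \<and> openin T N \<longrightarrow> (\<exists>k. order (G Mod N) = p ^ k))"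

text \<open>
  \<open>F\<close> is the free pro-\<open>p\<close> group on the finite family \<open>x\<close>: it is topologically generated by
  \<open>x\<close>, and every family \<open>y\<close> in a pro-\<open>p\<close> group \<open>H\<close> is the image of \<open>x\<close> under a continuous
  homomorphism, which is then unique.  A formula cannot quantify over all types, so \<open>H\<close> ranges
  over the pro-\<open>p\<close> groups carried by sets of elements of type \<^typ>\<open>nat set\<close>.  This is no
  restriction: \<open>H\<close> may be replaced by the closed subgroup topologically generated by \<open>y\<close>,
  and a topologically finitely generated profinite group has at most the cardinality of the
  continuum.
\<close>
definition free_pro_p_group ::
    "nat \<Rightarrow> ('a, 'b) monoid_scheme \<Rightarrow> 'a topology \<Rightarrow> ('i::finite \<Rightarrow> 'a) \<Rightarrow> bool" where
  "free_pro_p_group p F T x \<longleftrightarrow>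
     pro_p_group p F T \<and> range x \<subseteq> carrier F \<and>
     T closure_of (generate F (range x)) = carrier F \<and>
     (\<forall>(H :: nat set monoid) TH y. pro_p_group p H TH \<and> range y \<subseteq> carrier H \<longrightarrow>
        (\<exists>\<phi>. \<phi> \<in> hom F H \<and> continuous_map T TH \<phi> \<and> (\<forall>i. \<phi> (x i) = y i)))"

definition closed_normal_closure :: "('a, 'b) monoid_scheme \<Rightarrow> 'a topology \<Rightarrow> 'a set \<Rightarrow> 'a set" where
  "closed_normal_closure F T S = \<Inter>{N. N \<lhd> F \<and> closedin T N \<and> S \<subseteq> N}"


section \<open>Formal power series in non-commuting indeterminates\<close>

text \<open>The word \<open>[i\<^sub>1, \<dots>, i\<^sub>k]\<close> stands for the monomial \<open>X\<^bsub>i\<^sub>1\<^esub> \<cdots> X\<^bsub>i\<^sub>k\<^esub>\<close>.\<close>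

typedef ('i, 'k) ncps = "UNIV :: ('i list \<Rightarrow> 'k) set"
  morphisms ncps_nth Abs_ncps ..

lemma ncps_nth_Abs [simp]: "ncps_nth (Abs_ncps f) = f"
  by (simp add: Abs_ncps_inverse)

lemma ncps_eq_iff: "f = g \<longleftrightarrow> (\<forall>w. ncps_nth f w = ncps_nth g w)"
  by (metis ext ncps_nth_inject)

lemma ncps_eqI: "(\<And>w. ncps_nth f w = ncps_nth g w) \<Longrightarrow> f = g"
  by (simp add: ncps_eq_iff)

instantiation ncps :: (type, ab_group_add) ab_group_add
begin

definition zero_ncps :: "('a, 'b) ncps" where
  "0 = Abs_ncps (\<lambda>_. 0)"

definition plus_ncps :: "('a, 'b) ncps \<Rightarrow> ('a, 'b) ncps \<Rightarrow> ('a, 'b) ncps" where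
  "f + g = Abs_ncps (\<lambda>w. ncps_nth f w + ncps_nth g w)"

definition uminus_ncps :: "('a, 'b) ncps \<Rightarrow> ('a, 'b) ncps" where
  "- f = Abs_ncps (\<lambda>w. - ncps_nth f w)"

definition minus_ncps :: "('a, 'b) ncps \<Rightarrow> ('a, 'b) ncps \<Rightarrow> ('a, 'b) ncps" where
  "f - g = Abs_ncps (\<lambda>w. ncps_nth f w - ncps_nth g w)"

instance
  by standard (simp_all add: zero_ncps_def plus_ncps_def uminus_ncps_def minus_ncps_def
      ncps_eq_iff algebra_simps)

end

lemma ncps_nth_add [simp]: "ncps_nth (f + g) w = ncps_nth f w + ncps_nth g w"
  and ncps_nth_diff [simp]: "ncps_nth (f - g) w = ncps_nth f w - ncps_nth g w"
  and ncps_nth_uminus [simp]: "ncps_nth (- f) w = - ncps_nth f w"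
  and ncps_nth_zero [simp]: "ncps_nth 0 w = 0"
  by (simp_all add: zero_ncps_def plus_ncps_def uminus_ncps_def minus_ncps_def)

instantiation ncps :: (type, ring_1) ring_1
begin

definition one_ncps :: "('a, 'b) ncps" where
  "1 = Abs_ncps (\<lambda>w. if w = [] then 1 else 0)"

definition times_ncps :: "('a, 'b) ncps \<Rightarrow> ('a, 'b) ncps \<Rightarrow> ('a, 'b) ncps" where
  "f * g = Abs_ncps (\<lambda>w. \<Sum>k\<le>length w. ncps_nth f (take k w) * ncps_nth g (drop k w))"

lemma ncps_nth_mult:
  "ncps_nth (f * g) w = (\<Sum>k\<le>length w. ncps_nth f (take k w) * ncps_nth g (drop k w))"
  for f g :: "('a, 'b) ncps"
  by (simp add: times_ncps_def)

lemma ncps_nth_one: "ncps_nth (1 :: ('a, 'b) ncps) w = (if w = [] then 1 else 0)"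
  by (simp add: one_ncps_def)

instance
proof
  fix f g h :: "('a, 'b) ncps"
  show "f * g * h = f * (g * h)"
  proof (rule ncps_eqI)
    fix w :: "'a list"
    let ?n = "length w"
    let ?t = "\<lambda>j k. ncps_nth f (take j w) * ncps_nth g (take (k - j) (drop j w)) *
                      ncps_nth h (drop k w)"
    have "ncps_nth (f * g * h) w = (\<Sum>k\<le>?n. \<Sum>j\<le>k. ?t j k)"
      unfolding ncps_nth_mult
      by (intro sum.cong refl)
        (auto simp: sum_distrib_right min_def drop_take intro!: sum.cong)
    also have "\<dots> = (\<Sum>j\<le>?n. \<Sum>k=j..?n. ?t j k)"
      unfolding sum.Sigma[OF finite_atMost ballI[OF finite_atMost]]
        sum.Sigma[OF finite_atMost ballI[OF finite_atLeastAtMost]]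
      by (rule sum.reindex_bij_witness
          [where i = "\<lambda>(j, k). (k, j)" and j = "\<lambda>(k, j). (j, k)"]) auto
    also have "\<dots> = (\<Sum>j\<le>?n. \<Sum>k\<le>?n - j. ?t j (j + k))"
    proof (rule sum.cong[OF refl])
      fix j assume "j \<in> {..?n}"
      then show "(\<Sum>k=j..?n. ?t j k) = (\<Sum>k\<le>?n - j. ?t j (j + k))"
        by (intro sum.reindex_bij_witness[where i = "\<lambda>k. j + k" and j = "\<lambda>k. k - j"]) auto
    qed
    also have "\<dots> = ncps_nth (f * (g * h)) w"
      unfolding ncps_nth_mult
      by (intro sum.cong refl) (simp add: sum_distrib_left mult.assoc add.commute)
    finally show "ncps_nth (f * g * h) w = ncps_nth (f * (g * h)) w" .
  qed
  show "(f + g) * h = f * h + g * h" "f * (g + h) = f * g + f * h"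
    by (auto simp: ncps_eq_iff ncps_nth_mult distrib_left distrib_right sum.distrib)
  show "1 * f = f"
  proof (rule ncps_eqI)
    fix w :: "'a list"
    have "ncps_nth (1 * f) w = (\<Sum>k\<le>length w. if k = 0 then ncps_nth f w else 0)"
      unfolding ncps_nth_mult by (rule sum.cong) (auto simp: ncps_nth_one)
    then show "ncps_nth (1 * f) w = ncps_nth f w" by simp
  qed
  show "f * 1 = f"
  proof (rule ncps_eqI)
    fix w :: "'a list"
    have "ncps_nth (f * 1) w = (\<Sum>k\<le>length w. if k = length w then ncps_nth f w else 0)"
      unfolding ncps_nth_mult by (rule sum.cong) (auto simp: ncps_nth_one)
    then show "ncps_nth (f * 1) w = ncps_nth f w" by simp
  qed
  show "(0 :: ('a, 'b) ncps) \<noteq> 1"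
    by (auto simp: ncps_eq_iff ncps_nth_one)
qed

end

definition ncps_X :: "'i \<Rightarrow> ('i, 'k::ring_1) ncps" where
  "ncps_X i = Abs_ncps (\<lambda>w. if w = [i] then 1 else 0)"

definition ncps_const :: "'k \<Rightarrow> ('i, 'k::ring_1) ncps" where
  "ncps_const c = Abs_ncps (\<lambda>w. if w = [] then c else 0)"

definition ncps_ring :: "('i, 'k::ring_1) ncps ring" where
  "ncps_ring = \<lparr>carrier = UNIV, mult = (*), one = 1, ring.zero = 0, ring.add = (+)\<rparr>"

definition ncps_topology :: "('i, 'k) ncps topology" where
  "ncps_topology =
     pullback_topology UNIV ncps_nth (product_topology (\<lambda>_. discrete_topology UNIV) UNIV)"

definition nc_poly_ring :: "('i, 'k::ring_1) ncps ring" where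
  "nc_poly_ring = ncps_ring\<lparr>carrier := {f. finite {w. ncps_nth f w \<noteq> 0}}\<rparr>"

definition weight :: "('i \<Rightarrow> nat) \<Rightarrow> 'i list \<Rightarrow> nat" where
  "weight \<tau> w = sum_list (map \<tau> w)"

definition homogeneous_part :: "('i \<Rightarrow> nat) \<Rightarrow> nat \<Rightarrow> ('i, 'k::zero) ncps \<Rightarrow> ('i, 'k) ncps" where
  "homogeneous_part \<tau> n f = Abs_ncps (\<lambda>w. if weight \<tau> w = n then ncps_nth f w else 0)"

definition nc_poly_homogeneous :: "('i \<Rightarrow> nat) \<Rightarrow> nat \<Rightarrow> ('i, 'k::ring_1) ncps set" where
  "nc_poly_homogeneous \<tau> n =
     {f \<in> carrier nc_poly_ring. \<forall>w. ncps_nth f w \<noteq> 0 \<longrightarrow> weight \<tau> w = n}"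

inductive_set free_lie_algebra :: "('i, 'k::ring_1) ncps set" where
  zero: "0 \<in> free_lie_algebra"
| gen: "ncps_X i \<in> free_lie_algebra"
| add: "f \<in> free_lie_algebra \<Longrightarrow> g \<in> free_lie_algebra \<Longrightarrow> f + g \<in> free_lie_algebra"
| scale: "f \<in> free_lie_algebra \<Longrightarrow> ncps_const c * f \<in> free_lie_algebra"
| bracket: "f \<in> free_lie_algebra \<Longrightarrow> g \<in> free_lie_algebra \<Longrightarrow> f * g - g * f \<in> free_lie_algebra"


section \<open>Strongly free elements\<close>

definition one_relator_algebra :: "('i, 'k::ring_1) ncps \<Rightarrow> ('i, 'k) ncps set ring" where
  "one_relator_algebra \<rho> = nc_poly_ring Quot (Idl\<^bsub>nc_poly_ring\<^esub> {\<rho>})"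

definition relator_proj ::
    "('i, 'k::ring_1) ncps \<Rightarrow> ('i, 'k) ncps \<Rightarrow> ('i, 'k) ncps set" where
  "relator_proj \<rho> f = Idl\<^bsub>nc_poly_ring\<^esub> {\<rho>} +>\<^bsub>nc_poly_ring\<^esub> f"

text \<open>
  The grading of the quotient algebra is by the images of the homogeneous components of the
  free algebra, and its scalars are the images of the constants.
\<close>
definition poincare_series ::
    "('i \<Rightarrow> nat) \<Rightarrow> ('i, 'k::ring_1) ncps \<Rightarrow> rat fps" where
  "poincare_series \<tau> \<rho> = Abs_fps (\<lambda>n. of_nat
     (ring.dim (one_relator_algebra \<rho>)
        (relator_proj \<rho> ` range ncps_const)
        (relator_proj \<rho> ` nc_poly_homogeneous \<tau> n)))"

definition strongly_free :: "('i::finite \<Rightarrow> nat) \<Rightarrow> ('i, 'k::ring_1) ncps \<Rightarrow> bool" where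
  "strongly_free \<tau> \<rho> \<longleftrightarrow>
     (\<exists>n. \<rho> \<in> nc_poly_homogeneous \<tau> n \<and> \<rho> \<noteq> 0 \<and>
        poincare_series \<tau> \<rho> = 1 / (1 - (\<Sum>i\<in>UNIV. fps_X ^ \<tau> i) + fps_X ^ n))"


section \<open>Zassenhaus filtrations and mildness\<close>

text \<open>
  The identification \<open>x\<^sub>i \<mapsto> 1 + X\<^sub>i\<close> enters through its restriction to \<open>F\<close>, which is the
  unique continuous homomorphism into the unit group with these values.
\<close>
definition magnus_map ::
    "('a, 'b) monoid_scheme \<Rightarrow> 'a topology \<Rightarrow> ('i \<Rightarrow> 'a) \<Rightarrow> ('a \<Rightarrow> ('i, 'k::ring_1) ncps) \<Rightarrow> bool" where
  "magnus_map F T x \<psi> \<longleftrightarrow>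
     \<psi> \<in> hom F (units_of ncps_ring) \<and> continuous_map T ncps_topology \<psi> \<and>
     (\<forall>i. \<psi> (x i) = 1 + ncps_X i)"

definition zassenhaus ::
    "('a, 'b) monoid_scheme \<Rightarrow> ('a \<Rightarrow> ('i, 'k::ring_1) ncps) \<Rightarrow> ('i \<Rightarrow> nat) \<Rightarrow> nat \<Rightarrow> 'a set" where
  "zassenhaus F \<psi> \<tau> n =
     {f \<in> carrier F. \<forall>w. ncps_nth (\<psi> f - 1) w \<noteq> 0 \<longrightarrow> n \<le> weight \<tau> w}"

definition initial_degree ::
    "('a, 'b) monoid_scheme \<Rightarrow> ('a \<Rightarrow> ('i, 'k::ring_1) ncps) \<Rightarrow> ('i \<Rightarrow> nat) \<Rightarrow> 'a \<Rightarrow> nat" where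
  "initial_degree F \<psi> \<tau> r = (GREATEST n. r \<in> zassenhaus F \<psi> \<tau> n)"

text \<open>
  Under the identification of \<open>gr\<^sup>\<tau> F\<close> with \<open>L\<^sub>r\<^sub>e\<^sub>s(X)\<close>, the class of \<open>r\<close> modulo the next
  step of the filtration is the lowest-degree homogeneous part of \<open>\<psi> r - 1\<close>.
\<close>
definition initial_form ::
    "('a, 'b) monoid_scheme \<Rightarrow> ('a \<Rightarrow> ('i, 'k::ring_1) ncps) \<Rightarrow> ('i \<Rightarrow> nat) \<Rightarrow> 'a \<Rightarrow> ('i, 'k) ncps" where
  "initial_form F \<psi> \<tau> r = homogeneous_part \<tau> (initial_degree F \<psi> \<tau> r) (\<psi> r - 1)"

text \<open>
  Mildness refers to the presentation \<open>G = F/(r)\<close>, so the relator \<open>r\<close> is an argument beside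
  the quotient group \<open>G\<close>.
\<close>
definition mild ::
    "('a, 'b) monoid_scheme \<Rightarrow> 'a topology \<Rightarrow> ('a \<Rightarrow> ('i::finite, 'k::ring_1) ncps) \<Rightarrow>
     ('i \<Rightarrow> nat) \<Rightarrow> 'a \<Rightarrow> 'a set monoid \<Rightarrow> bool" where
  "mild F T \<psi> \<tau> r G \<longleftrightarrow>
     G = F Mod closed_normal_closure F T {r} \<and> strongly_free \<tau> (initial_form F \<psi> \<tau> r)"

end

theory Submission
  imports Defs "HOL-Library.List_Lexorder" "HOL-Library.Function_Algebras"
begin

text \<open>
  The initial form \<open>\<rho>\<close> is strongly free as soon as some leading word \<open>w\<close> of it does not overlap
  itself: then rewriting \<open>w\<close> is confluent, the words avoiding \<open>w\<close> form a basis of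
  \<open>\<F>\<^sub>p\<langle>X\<rangle>/(\<rho>)\<close>, and counting them gives the Poincare series.  The leading word of a Lie
  polynomial is a Lyndon word, hence unbordered.  Over the integers this holds because Lie
  polynomials are orthogonal to proper shuffles, while a word that is not Lyndon is the largest
  term of a proper shuffle; the integral statement descends to \<open>\<F>\<^sub>p\<close> by lifting a Lie polynomial
  and removing the terms divisible by \<open>p\<close> with bracketed Lyndon words.  Part (ii) reduces to
  part (i): elements of \<open>F\<close> are group-like, so \<open>\<rho>\<close> is primitive, and Dynkin's identity writes
  \<open>n \<rho>\<close> as a Lie polynomial when \<open>\<rho>\<close> has degree \<open>n\<close>.  In part (i), \<open>\<rho> \<noteq> 0\<close> because the Magnus
  map is injective: finite \<open>p\<close>-groups act unipotently in characteristic \<open>p\<close>.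
\<close>

section \<open>Shuffles and Lyndon words\<close>

text \<open>The detour through the integers is forced. In characteristic \<open>p\<close> the
  multiplicity of a word in a shuffle may vanish: X^p is primitive modulo \<open>p\<close>, its only
  word is bordered, and it is not strongly free. Hence primitivity over the prime field cannot yield
  a Lyndon leading word, whereas being a Lie polynomial lifts to characteristic 0. In (ii)
  coprimality of \<open>n\<close> and \<open>p\<close> excludes such powers by making division by
  \<open>n\<close> in Dynkin's identity possible.

  \<open>\<rho>\<close> is homogeneous only for the weights \<open>\<tau>\<close>, so its words may
  differ in length. "Leading" means least, by length first and then lexicographically. Rewriting
  thus moves words upwards, and it stops because only finitely many words have a given weight. For
  the same reason Dynkin's identity has to produce the weight in place of the length.

  The series 1 + X_i is not group-like for the coproduct with primitive X_i, and modulo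
  \<open>p\<close> no exponential repairs this. A deformed coproduct does, at the price of replacing
  shuffles by infiltrations; in the lowest degree of an element of \<open>F\<close> the two
  agree.\<close>

lemma list_less_cases:
  fixes x y :: "'a::linorder list"
  assumes "x < y"
  obtains (prefix) s where "s \<noteq> []" "y = x @ s"
    | (differ) p a b x' y' where "a < b" "x = p @ a # x'" "y = p @ b # y'"
  using assms unfolding list_less_def lexord_def by (auto simp: neq_Nil_conv)

lemma append_less_append:
  fixes p :: "'a::linorder list"
  shows "p @ x < p @ y \<longleftrightarrow> x < y"
  by (induction p) auto

lemma append_le_append:
  fixes p :: "'a::linorder list"
  shows "p @ x \<le> p @ y \<longleftrightarrow> x \<le> y"
  by (induction p) auto

lemma append_differ_less:
  fixes p :: "'a::linorder list"
  assumes "a < b"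
  shows "p @ a # x < p @ b # y"
  using assms by (induction p) auto

lemma le_append_right:
  fixes p :: "'a::linorder list"
  shows "p \<le> p @ x"
  by (induction p) auto

lemma append_mono_eq_length:
  fixes x y :: "'a::linorder list"
  assumes "x \<le> x'" "y \<le> y'" "length x = length x'"
  shows "x @ y \<le> x' @ y'"
  using assms
proof (induction x arbitrary: x')
  case (Cons a x)
  then show ?case by (cases x') auto
qed simp

lemma append_less_eq_length:
  fixes x y :: "'a::linorder list"
  assumes "x < x'" "length x = length x'"
  shows "x @ y < x' @ y'"
  using assms
proof (induction x arbitrary: x')
  case (Cons a x)
  then show ?case by (cases x') auto
qed simp

section \<open>Cutting shuffles and exchanging their letters\<close>

lemma append_in_shuffles:
  assumes "z1 \<in> shuffles a b" "z2 \<in> shuffles c d"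
  shows "z1 @ z2 \<in> shuffles (a @ c) (b @ d)"
  using assms
proof (induction z1 arbitrary: a b)
  case (Cons x z1)
  then show ?case
    by (auto simp: Cons_in_shuffles_iff neq_Nil_conv)
qed auto

lemma append_self_in_shuffles: "u @ v \<in> shuffles u v"
  using append_in_shuffles[of u u "[]" v "[]" v] by simp

text \<open>Cut \<open>z\<close> right behind the last letter that comes from \<open>u\<close>;
  \<open>v1\<close> collects the letters of \<open>v\<close> placed before the cut.\<close>

lemma shuffles_append_split:
  assumes "z \<in> shuffles (u @ u') v"
  obtains z1 z2 v1 v2 where "z = z1 @ z2" "v = v1 @ v2" "z1 \<in> shuffles u v1" "z2 \<in> shuffles u' v2"
proof -
  have "\<exists>z1 z2 v1 v2. z = z1 @ z2 \<and> v = v1 @ v2 \<and> z1 \<in> shuffles u v1 \<and> z2 \<in> shuffles u' v2"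
    using assms
  proof (induction z arbitrary: u v)
    case (Cons x z)
    show ?case
    proof (cases "u = []")
      case True
      then show ?thesis using Cons.prems by (metis append_Nil shuffles.simps(1) singletonI)
    next
      case False
      then obtain a u0 where u: "u = a # u0" by (cases u) auto
      from Cons.prems[unfolded u Cons_in_shuffles_iff]
      show ?thesis
      proof (elim disjE)
        assume "(a # u0) @ u' \<noteq> [] \<and> hd ((a # u0) @ u') = x \<and> z \<in> shuffles (tl ((a # u0) @ u')) v"
        then have "x = a" "z \<in> shuffles (u0 @ u') v" by auto
        with Cons.IH obtain z1 z2 v1 v2 where
          "z = z1 @ z2" "v = v1 @ v2" "z1 \<in> shuffles u0 v1" "z2 \<in> shuffles u' v2" by blast
        then have "x # z = (x # z1) @ z2" "v = v1 @ v2" "x # z1 \<in> shuffles u v1" "z2 \<in> shuffles u' v2"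
          using u \<open>x = a\<close> by (auto simp: Cons_in_shuffles_iff)
        then show ?thesis by blast
      next
        assume "v \<noteq> [] \<and> hd v = x \<and> z \<in> shuffles ((a # u0) @ u') (tl v)"
        then have v: "v = x # tl v" "z \<in> shuffles (u @ u') (tl v)" using u by auto
        with Cons.IH obtain z1 z2 v1 v2 where
          "z = z1 @ z2" "tl v = v1 @ v2" "z1 \<in> shuffles u v1" "z2 \<in> shuffles u' v2" by blast
        then have "x # z = (x # z1) @ z2" "v = (x # v1) @ v2" "x # z1 \<in> shuffles u (x # v1)" "z2 \<in> shuffles u' v2"
          using v by (auto simp: Cons_in_shuffles_iff)
        then show ?thesis by blast
      qed
    qed
  qed auto
  with that show thesis by blast
qed

text \<open>Isolates one letter \<open>a\<close> of the second factor, so that it can later be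
  replaced by a larger letter while everything in front of it is kept.\<close>

lemma shuffles_letter_split:
  assumes "z \<in> shuffles u (p @ a # x)"
  obtains y z' u1 u2 where "z = y @ a # z'" "u = u1 @ u2" "y \<in> shuffles u1 p" "z' \<in> shuffles u2 x"
proof -
  have "z \<in> shuffles ((p @ [a]) @ x) u" using assms by (simp add: shuffles_commutes)
  then obtain z1 z2 u1 u2 where 1: "z = z1 @ z2" "u = u1 @ u2" "z1 \<in> shuffles (p @ [a]) u1" "z2 \<in> shuffles x u2"
    by (rule shuffles_append_split)
  from 1(3) obtain y1 y2 w1 w2 where 2: "z1 = y1 @ y2" "u1 = w1 @ w2" "y1 \<in> shuffles p w1" "y2 \<in> shuffles [a] w2"
    by (rule shuffles_append_split)
  have "\<exists>c d. y2 = c @ a # d \<and> w2 = c @ d" using 2(4)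
  proof (induction y2 arbitrary: w2)
    case (Cons e y2)
    from Cons.prems consider "e = a" "y2 = w2" | "w2 \<noteq> []" "hd w2 = e" "y2 \<in> shuffles [a] (tl w2)"
      by (auto simp: Cons_in_shuffles_iff)
    then show ?case
    proof cases
      case 1 then show ?thesis by (metis append_Nil)
    next
      case 2
      with Cons.IH obtain c d where "y2 = c @ a # d" "tl w2 = c @ d" by blast
      with 2 show ?thesis by (metis append_Cons list.collapse)
    qed
  qed simp
  then obtain c d where cd: "y2 = c @ a # d" "w2 = c @ d" by blast
  show thesis
  proof (rule that)
    show "z = (y1 @ c) @ a # (d @ z2)" using 1 2 cd by simp
    show "u = (w1 @ c) @ (d @ u2)" using 1 2 cd by simp
    show "y1 @ c \<in> shuffles (w1 @ c) p"
      using append_in_shuffles[OF 2(3), of c "[]" c] by (simp add: shuffles_commutes)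
    show "d @ z2 \<in> shuffles (d @ u2) x"
      using append_in_shuffles[of d "[]" d, OF _ 1(4)] by (simp add: shuffles_commutes)
  qed
qed

text \<open>The largest word in a shuffle is obtained by always taking the next letter from the
  lexicographically larger remaining word; this is the exchange step behind that.\<close>

lemma shuffle_exchange:
  fixes s t :: "'a::linorder list"
  assumes "t \<le> s" "z \<in> shuffles (u @ s) t"
  shows "\<exists>z'\<in>shuffles s (u @ t). z \<le> z'"
  using assms
proof (induction "length s" arbitrary: s t u z rule: less_induct)
  case less
  from less.prems(2) obtain z1 z2 t1 t2 where
    z: "z = z1 @ z2" and t: "t = t1 @ t2" and z1: "z1 \<in> shuffles u t1" and z2: "z2 \<in> shuffles s t2"
    by (rule shuffles_append_split)
  show ?case
  proof (cases "t1 = []")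
    case True
    then have "z1 = u" "t = t2" using z1 t by auto
    then have "z \<in> shuffles s (u @ t)"
      using append_in_shuffles[of u "[]" u, OF _ z2] z by simp
    then show ?thesis by blast
  next
    case False
    have "t1 \<le> s" using less.prems(1) le_append_right[of t1 t2] t by auto
    then consider (pre) s2 where "s = t1 @ s2"
      | (differ) p a b x' y' where "a < b" "t1 = p @ a # x'" "s = p @ b # y'"
      by (metis append_Nil2 le_less list_less_cases)
    then show ?thesis
    proof cases
      \<comment> \<open>The copy of \<open>t1\<close> used in \<open>z1\<close> is now credited to
        \<open>s = t1 @ s2\<close>. What remains is the same exchange problem for \<open>s2\<close>
        and \<open>t2\<close>, with \<open>t1\<close> in the role of \<open>u\<close>.\<close>
      case pre
      then have le: "t2 \<le> s2" using less.prems(1) t by (simp add: append_le_append)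
      have "length s2 < length s" using pre False by simp
      from less.hyps[OF this le, of z2 t1] z2 pre obtain z2' where
        z2': "z2' \<in> shuffles s2 (t1 @ t2)" "z2 \<le> z2'" by auto
      have "z1 @ z2' \<in> shuffles (t1 @ s2) (u @ t)"
        using append_in_shuffles[OF z1 z2'(1)[unfolded shuffles_commutes[of s2]]] 
          append_in_shuffles[OF z1[unfolded shuffles_commutes[of u]] z2'(1)] t by simp
      moreover have "z \<le> z1 @ z2'" using z z2'(2) by (simp add: append_le_append)
      ultimately show ?thesis using pre by auto
    next
      \<comment> \<open>Up to the letter \<open>a\<close> the prefix \<open>p\<close> of
        \<open>t1\<close> is read as the prefix of \<open>s\<close>. There \<open>s\<close> offers
        the larger letter \<open>b\<close>, so the new word already wins and its remainder is
        arbitrary.\<close>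
      case differ
      from z1[unfolded differ(2)] obtain y z' u1 u2 where
        y: "z1 = y @ a # z'" "u = u1 @ u2" "y \<in> shuffles u1 p" "z' \<in> shuffles u2 x'"
        by (rule shuffles_letter_split)
      let ?z = "y @ b # (y' @ (u2 @ t))"
      have "y @ (b # (y' @ (u2 @ t))) \<in> shuffles (p @ (b # y')) (u1 @ (u2 @ t))"
        by (rule append_in_shuffles)
          (use y append_self_in_shuffles[of "b # y'"] in \<open>auto simp: shuffles_commutes\<close>)
      then have "?z \<in> shuffles s (u @ t)" using differ y by simp
      moreover have "z \<le> ?z"
        using append_differ_less[OF differ(1), of y] z y by (simp add: less_imp_le)
      ultimately show ?thesis by blast
    qed
  qed
qed

text \<open>Greedy argument: every remaining suffix of \<open>u\<close> is at least
  \<open>v\<close>, so taking the next letter from \<open>u\<close> never loses.\<close>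

lemma shuffles_le_append:
  fixes u v :: "'a::linorder list"
  assumes "\<And>p s. u = p @ s \<Longrightarrow> s \<noteq> [] \<Longrightarrow> v \<le> s" "z \<in> shuffles u v"
  shows "z \<le> u @ v"
  using assms
proof (induction u arbitrary: z)
  case (Cons a s)
  have IH: "z' \<le> s @ v" if "z' \<in> shuffles s v" for z'
    using Cons.IH[OF _ that] Cons.prems(1) by (metis append_Cons)
  show ?case
  proof (cases v)
    case Nil
    then show ?thesis using Cons.prems(2) by simp
  next
    case (Cons c t)
    have "v \<le> a # s" using Cons.prems(1)[of "[]" "a # s"] by simp
    then have ca: "c < a \<or> c = a \<and> t \<le> s" using Cons by simp
    obtain e z' where z: "z = e # z'" using Cons.prems(2) by (cases z) auto
    from Cons.prems(2) Cons z consider "e = a" "z' \<in> shuffles s v" | "e = c" "z' \<in> shuffles (a # s) t"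
      by (auto simp: Cons_in_shuffles_iff)
    then show ?thesis
    proof cases
      case 1
      then show ?thesis using IH z by simp
    next
      case 2
      show ?thesis
      proof (cases "c = a")
        case True
        then have ts: "t \<le> s" using ca by auto
        \<comment> \<open>On a tie the letter was taken from \<open>v\<close>. The exchange pretends
          that it came from \<open>u\<close> and hands an \<open>a\<close> back to the second
          factor, which turns \<open>t\<close> into \<open>v\<close> again.\<close>
        from shuffle_exchange[OF ts, of z' "[a]"] 2 obtain z'' where
          "z'' \<in> shuffles s (a # t)" "z' \<le> z''" by auto
        then have "z' \<le> s @ v" using IH[of z''] Cons True by auto
        then show ?thesis using z 2 True by simp
      next
        case False
        then show ?thesis using ca z 2 by simp
      qed
    qed
  qed
qed simp

section \<open>Lyndon words, least suffixes and borders\<close>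

definition lyndon :: "'a::linorder list \<Rightarrow> bool" where
  "lyndon w \<longleftrightarrow> w \<noteq> [] \<and> (\<forall>p s. w = p @ s \<and> p \<noteq> [] \<and> s \<noteq> [] \<longrightarrow> w < s)"

text \<open>The same cut serves twice: it exhibits a word that is not Lyndon as a maximal shuffle,
  and it is the standard factorization of a Lyndon word.\<close>

lemma minimal_proper_suffix:
  fixes w :: "'a::linorder list"
  assumes "2 \<le> length w"
  obtains u v where "w = u @ v" "u \<noteq> []" "v \<noteq> []"
    "\<And>p s. w = p @ s \<Longrightarrow> p \<noteq> [] \<Longrightarrow> s \<noteq> [] \<Longrightarrow> v \<le> s"
proof -
  let ?S = "(\<lambda>k. drop k w) ` {1..<length w}"
  have "finite ?S" "?S \<noteq> {}" using assms by auto
  then have "Min ?S \<in> ?S" by (rule Min_in)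
  then obtain k where k: "Min ?S = drop k w" "1 \<le> k" "k < length w" by auto
  show thesis
  proof (rule that)
    show "w = take k w @ drop k w" by simp
    show "take k w \<noteq> []" "drop k w \<noteq> []" using k by auto
    show "drop k w \<le> s" if "w = p @ s" "p \<noteq> []" "s \<noteq> []" for p s
    proof -
      have "s = drop (length p) w" "1 \<le> length p" "length p < length w"
        using that by (auto simp: Suc_le_eq)
      then have "s \<in> ?S" by auto
      then show ?thesis using Min_le[OF \<open>finite ?S\<close>] k(1) by metis
    qed
  qed
qed

text \<open>Suppose \<open>s < v\<close>. If \<open>v = s @ q\<close>, minimality gives
  \<open>v \<le> q\<close> while \<open>v \<le> s @ v\<close> gives \<open>q \<le> v\<close>, so
  \<open>q = v\<close> with \<open>s\<close> nonempty, which is absurd. If \<open>s\<close> and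
  \<open>v\<close> differ at a letter, then \<open>s @ v < v\<close>.\<close>

lemma minimal_suffix_le_suffix_of_prefix:
  fixes u v :: "'a::linorder list"
  assumes min: "\<And>p s. u @ v = p @ s \<Longrightarrow> p \<noteq> [] \<Longrightarrow> s \<noteq> [] \<Longrightarrow> v \<le> s"
    and "u = p @ s" "s \<noteq> []" "v \<le> s @ v" "v \<noteq> []"
  shows "v \<le> s"
proof (rule ccontr)
  assume "\<not> v \<le> s"
  then have "s < v" by simp
  then show False
  proof (cases rule: list_less_cases)
    case (prefix q)
    have "q \<le> v" using assms(4) prefix by (metis append_le_append)
    moreover have "v \<le> q"
      using min[of "p @ s @ s" q] prefix assms by simp
    ultimately have "q = v" by simp
    then show False using prefix assms by simp
  next
    case (differ q a b x' y')
    have "s @ v < v" unfolding differ(2,3) using append_differ_less[OF differ(1), of q "x' @ q @ b # y'" y'] by simp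
    then show False using assms by simp
  qed
qed

text \<open>Leading words of primitive series are Lyndon, because any other word is the largest
  term of a proper shuffle.\<close>

lemma not_lyndon_max_shuffle:
  fixes w :: "'a::linorder list"
  assumes "w \<noteq> []" "\<not> lyndon w"
  obtains u v where "w = u @ v" "u \<noteq> []" "v \<noteq> []" "\<And>z. z \<in> shuffles u v \<Longrightarrow> z \<le> w"
proof -
  obtain p s where ps: "w = p @ s" "p \<noteq> []" "s \<noteq> []" "\<not> w < s"
    using assms unfolding lyndon_def by blast
  then have "2 \<le> length w" by (cases p; cases s) auto
  then obtain u v where uv: "w = u @ v" "u \<noteq> []" "v \<noteq> []"
    "\<And>p s. w = p @ s \<Longrightarrow> p \<noteq> [] \<Longrightarrow> s \<noteq> [] \<Longrightarrow> v \<le> s" by (rule minimal_proper_suffix) blast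
  \<comment> \<open>Minimality speaks of proper suffixes only. This covers the case
    \<open>s = u\<close>, where \<open>s @ v\<close> is all of \<open>w\<close>; it is the one place
    where failure of the Lyndon property enters.\<close>
  have vw: "v \<le> w" using uv(4)[OF ps(1-3)] ps(4) by simp
  have "v \<le> s" if "u = p @ s" "s \<noteq> []" for p s
  proof (rule minimal_suffix_le_suffix_of_prefix[OF _ that _ uv(3)])
    show "v \<le> s @ v"
    proof (cases "p = []")
      case True then show ?thesis using vw uv that by simp
    next
      case False then show ?thesis using uv(4)[of p "s @ v"] uv that by simp
    qed
  qed (use uv in auto)
  then have "z \<le> w" if "z \<in> shuffles u v" for z
    using shuffles_le_append[of u v, OF _ that] uv(1) by blast
  with uv that show thesis by blast
qed

text \<open>The standard factorization, with \<open>m\<close> the least proper suffix. The final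
  inequality makes \<open>l @ m\<close> the least word of a commutator whose factors have least
  words \<open>l\<close> and \<open>m\<close>.\<close>

lemma lyndon_factorization:
  fixes w :: "'a::linorder list"
  assumes "lyndon w" "2 \<le> length w"
  obtains l m where "w = l @ m" "lyndon l" "lyndon m" "l @ m < m @ l"
proof -
  obtain l m where lm: "w = l @ m" "l \<noteq> []" "m \<noteq> []"
    "\<And>p s. w = p @ s \<Longrightarrow> p \<noteq> [] \<Longrightarrow> s \<noteq> [] \<Longrightarrow> m \<le> s" using minimal_proper_suffix[OF assms(2)] by blast
  have less: "w < s" if "w = p @ s" "p \<noteq> []" "s \<noteq> []" for p s
    using assms(1) that unfolding lyndon_def by blast
  have wm: "w < m" using less lm by blast
  have lw: "l \<le> w" using lm le_append_right by auto
  have "lyndon m" unfolding lyndon_def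
  proof (intro conjI allI impI)
    fix p s assume ps: "m = p @ s \<and> p \<noteq> [] \<and> s \<noteq> []"
    then have "m \<le> s" using lm(4)[of "l @ p" s] lm by simp
    moreover have "m \<noteq> s" using ps by auto
    ultimately show "m < s" by simp
  qed (use lm in simp)
  moreover have "lyndon l" unfolding lyndon_def
  proof (intro conjI allI impI)
    fix p s assume ps: "l = p @ s \<and> p \<noteq> [] \<and> s \<noteq> []"
    have "m \<le> s"
    proof (rule minimal_suffix_le_suffix_of_prefix[of l m p s])
      show "m \<le> s @ m" using lm(4)[of p "s @ m"] lm ps by simp
    qed (use lm ps in auto)
    then show "l < s" using lw wm by order
  qed (use lm in simp)
  moreover have "l @ m < m @ l"
    using lm wm le_append_right[of m l] by auto
  ultimately show thesis using that lm by blast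
qed

text \<open>A border different from \<open>w\<close> would be a proper suffix, hence larger than
  \<open>w\<close>, and a prefix, hence not larger.\<close>

lemma lyndon_unbordered:
  fixes w :: "'a::linorder list"
  assumes "lyndon w" "w = b @ x" "w = y @ b" "b \<noteq> []"
  shows "b = w"
proof (rule ccontr)
  assume "b \<noteq> w"
  then have "y \<noteq> []" using assms by auto
  then have "w < b" using assms unfolding lyndon_def by blast
  then show False using assms(2) le_append_right[of b x] by simp
qed

section \<open>Lie polynomials and shuffles\<close>

text \<open>The linear extension of \<open>f\<close> evaluated at the shuffle product of
  \<open>u\<close> and \<open>v\<close>. A recursion is used because the set
  \<open>shuffles u v\<close> forgets multiplicities.\<close>

fun shuffle_pairing :: "('a list \<Rightarrow> 'k::comm_monoid_add) \<Rightarrow> 'a list \<Rightarrow> 'a list \<Rightarrow> 'k" where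
  "shuffle_pairing f [] v = f v"
| "shuffle_pairing f (a # u) [] = f (a # u)"
| "shuffle_pairing f (a # u) (b # v) =
     shuffle_pairing (\<lambda>w. f (a # w)) u (b # v) + shuffle_pairing (\<lambda>w. f (b # w)) (a # u) v"

lemma shuffle_pairing_Nil2 [simp]: "shuffle_pairing f u [] = f u"
  by (cases u) auto

lemma shuffle_pairing_add:
  "shuffle_pairing (\<lambda>w. f w + g w) u v = shuffle_pairing f u v + shuffle_pairing g u v"
  by (induction u v arbitrary: f g rule: shuffles.induct) (auto simp: algebra_simps)

lemma shuffle_pairing_diff:
  fixes f g :: "'a list \<Rightarrow> 'k::ab_group_add"
  shows "shuffle_pairing (\<lambda>w. f w - g w) u v = shuffle_pairing f u v - shuffle_pairing g u v"
  by (induction u v arbitrary: f g rule: shuffles.induct) (auto simp: algebra_simps)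

lemma shuffle_pairing_scale:
  fixes f :: "'a list \<Rightarrow> 'k::comm_ring"
  shows "shuffle_pairing (\<lambda>w. c * f w) u v = c * shuffle_pairing f u v"
  by (induction f u v rule: shuffle_pairing.induct) (auto simp: algebra_simps)

lemma shuffle_pairing_scale_right:
  fixes f :: "'a list \<Rightarrow> 'k::comm_ring"
  shows "shuffle_pairing (\<lambda>w. f w * c) u v = shuffle_pairing f u v * c"
  by (induction f u v rule: shuffle_pairing.induct) (auto simp: algebra_simps)

lemma shuffle_pairing_zero [simp]: "shuffle_pairing (\<lambda>w. 0) u v = 0"
  by (induction u v rule: shuffles.induct) auto

lemma shuffle_pairing_cong:
  assumes "\<And>w. w \<in> shuffles u v \<Longrightarrow> f w = g w"
  shows "shuffle_pairing f u v = shuffle_pairing g u v"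
  using assms
proof (induction f u v arbitrary: g rule: shuffle_pairing.induct)
  case (3 f a u b v)
  show ?case
    using 3(1)[of "\<lambda>w. g (a # w)"] 3(2)[of "\<lambda>w. g (b # w)"] 3(3) by simp
qed auto

text \<open>Multiplicities in a shuffle product are positive integers. Modulo a prime they may
  vanish, so this is the step that needs integral coefficients.\<close>

lemma shuffle_pairing_pos:
  fixes f :: "'a list \<Rightarrow> int"
  assumes "\<And>w. 0 \<le> f w"
  shows "0 \<le> shuffle_pairing f u v" and "w \<in> shuffles u v \<Longrightarrow> 0 < f w \<Longrightarrow> 0 < shuffle_pairing f u v"
proof -
  have nonneg: "0 \<le> shuffle_pairing f u v" if "\<And>w. 0 \<le> f w" for f :: "'a list \<Rightarrow> int" and u v
    using that by (induction f u v rule: shuffle_pairing.induct) auto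
  show "0 \<le> shuffle_pairing f u v" by (rule nonneg) (rule assms)
  show "0 < shuffle_pairing f u v" if "w \<in> shuffles u v" "0 < f w"
    using that assms
  proof (induction f u v arbitrary: w rule: shuffle_pairing.induct)
    case (3 f a u b v)
    have 0: "0 \<le> shuffle_pairing (\<lambda>w. f (a # w)) u (b # v)" "0 \<le> shuffle_pairing (\<lambda>w. f (b # w)) (a # u) v"
      using 3(5) by (auto intro: nonneg)
    from 3(3) consider w' where "w = a # w'" "w' \<in> shuffles u (b # v)"
      | w' where "w = b # w'" "w' \<in> shuffles (a # u) v" by auto
    then show ?case
    proof cases
      case 1
      then show ?thesis using 3(1)[of w'] 3(4,5) 0 by simp
    next
      case 2
      then show ?thesis using 3(2)[of w'] 3(4,5) 0 by simp
    qed
  qed auto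
qed

text \<open>The defining recursion peels letters off the front. Dynkin's identity needs its mirror
  image, since the distinguished letter there stands last.\<close>

lemma shuffle_pairing_snoc:
  "shuffle_pairing f (u @ [a]) (v @ [b]) =
     shuffle_pairing (\<lambda>w. f (w @ [a])) u (v @ [b]) + shuffle_pairing (\<lambda>w. f (w @ [b])) (u @ [a]) v"
proof (induction "length u + length v" arbitrary: f u v rule: less_induct)
  case less
  show ?case
  proof (cases u; cases v)
    assume "u = []" "v = []" then show ?thesis by (simp add: add.commute)
  next
    fix d v' assume uv: "u = []" "v = d # v'"
    show ?thesis using less[of "[]" v' "\<lambda>w. f (d # w)"] uv by (simp add: ac_simps)
  next
    fix c u' assume uv: "u = c # u'" "v = []"
    show ?thesis using less[of u' "[]" "\<lambda>w. f (c # w)"] uv by (simp add: ac_simps)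
  next
    fix c u' d v' assume uv: "u = c # u'" "v = d # v'"
    show ?thesis using less[of u' v "\<lambda>w. f (c # w)"] less[of u v' "\<lambda>w. f (d # w)"] uv
      by (simp add: ac_simps)
  qed
qed

text \<open>The product of series stated for bare functions, because the recursion of
  \<open>shuffle_pairing\<close> passes to \<open>\<lambda>w. f (a # w)\<close>.\<close>

definition word_conv :: "('a list \<Rightarrow> 'k::ring) \<Rightarrow> ('a list \<Rightarrow> 'k) \<Rightarrow> 'a list \<Rightarrow> 'k" where
  "word_conv f g w = (\<Sum>k\<le>length w. f (take k w) * g (drop k w))"

lemma ncps_nth_mult_conv: "ncps_nth (f * g) = word_conv (ncps_nth f) (ncps_nth g)"
  by (rule ext) (simp add: word_conv_def ncps_nth_mult)

lemma word_conv_Cons: "word_conv f g (a # w) = f [] * g (a # w) + word_conv (\<lambda>x. f (a # x)) g w"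
  by (simp add: word_conv_def sum.atMost_Suc_shift del: sum.atMost_Suc)

text \<open>Cutting a shuffle of \<open>u\<close> and \<open>v\<close> in two cuts both words and
  leaves a shuffle of the prefixes and one of the suffixes: deconcatenation is multiplicative for
  the shuffle product.\<close>

lemma shuffle_pairing_conv:
  fixes f g :: "'a list \<Rightarrow> 'k::comm_ring"
  shows "shuffle_pairing (word_conv f g) u v = (\<Sum>i\<le>length u. \<Sum>j\<le>length v.
     shuffle_pairing f (take i u) (take j v) * shuffle_pairing g (drop i u) (drop j v))"
proof (induction u v arbitrary: f rule: shuffles.induct)
  case (1 v)
  then show ?case by (simp add: word_conv_def)
next
  case (2 a u)
  then show ?case by (simp add: word_conv_def)
next
  case (3 a u b v)
  let ?fa = "\<lambda>w. f (a # w)" and ?fb = "\<lambda>w. f (b # w)"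
  let ?G = "\<lambda>i j. shuffle_pairing g (drop i (a # u)) (drop j (b # v))"
  let ?T = "\<lambda>i j. shuffle_pairing f (take i (a # u)) (take j (b # v)) * ?G i j"
  let ?m = "length u" and ?n = "length v"
  have 1: "shuffle_pairing (word_conv ?fa g) u (b # v) =
      (\<Sum>i\<le>?m. ?T (Suc i) 0) + (\<Sum>i\<le>?m. \<Sum>j\<le>?n.
        shuffle_pairing ?fa (take i u) (b # take j v) * ?G (Suc i) (Suc j))"
    unfolding 3(1) by (simp add: sum.atMost_Suc_shift sum.distrib del: sum.atMost_Suc)
  have 2: "shuffle_pairing (word_conv ?fb g) (a # u) v =
      (\<Sum>j\<le>?n. ?T 0 (Suc j)) + (\<Sum>i\<le>?m. \<Sum>j\<le>?n.
        shuffle_pairing ?fb (a # take i u) (take j v) * ?G (Suc i) (Suc j))"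
    unfolding 3(2) by (simp add: sum.atMost_Suc_shift del: sum.atMost_Suc)
  have T: "(\<Sum>i\<le>length (a # u). \<Sum>j\<le>length (b # v). ?T i j) =
      ?T 0 0 + (\<Sum>j\<le>?n. ?T 0 (Suc j)) + (\<Sum>i\<le>?m. ?T (Suc i) 0) + (\<Sum>i\<le>?m. \<Sum>j\<le>?n. ?T (Suc i) (Suc j))"
    by (simp add: sum.atMost_Suc_shift sum.distrib algebra_simps del: sum.atMost_Suc)
  have 4: "(\<Sum>i\<le>?m. \<Sum>j\<le>?n. ?T (Suc i) (Suc j)) = 
     (\<Sum>i\<le>?m. \<Sum>j\<le>?n. shuffle_pairing ?fa (take i u) (b # take j v) * ?G (Suc i) (Suc j)) +
     (\<Sum>i\<le>?m. \<Sum>j\<le>?n. shuffle_pairing ?fb (a # take i u) (take j v) * ?G (Suc i) (Suc j))"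
    by (simp add: sum.distrib distrib_right)
  have "shuffle_pairing (word_conv f g) (a # u) (b # v) =
     shuffle_pairing (\<lambda>w. f [] * g (a # w) + word_conv ?fa g w) u (b # v) +
     shuffle_pairing (\<lambda>w. f [] * g (b # w) + word_conv ?fb g w) (a # u) v"
    by (simp add: word_conv_Cons)
  also have "\<dots> = ?T 0 0 + shuffle_pairing (word_conv ?fa g) u (b # v) + shuffle_pairing (word_conv ?fb g) (a # u) v"
    by (simp add: shuffle_pairing_add shuffle_pairing_scale algebra_simps)
  finally have main: "shuffle_pairing (word_conv f g) (a # u) (b # v) =
     ?T 0 0 + shuffle_pairing (word_conv ?fa g) u (b # v) + shuffle_pairing (word_conv ?fb g) (a # u) v" .
  show ?case unfolding main 1 2 T 4 by (simp only: ac_simps)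
qed

text \<open>Dual form of primitivity for the coproduct that sends each letter X to X (x) 1 + 1 (x)
  X: vanishing constant term and orthogonality to all proper shuffles.\<close>

definition primitive :: "('a list \<Rightarrow> 'k::comm_ring) \<Rightarrow> bool" where
  "primitive f \<longleftrightarrow> f [] = 0 \<and> (\<forall>u v. u \<noteq> [] \<longrightarrow> v \<noteq> [] \<longrightarrow> shuffle_pairing f u v = 0)"

text \<open>Every cut that splits \<open>u\<close> or \<open>v\<close> nontrivially, or leaves one
  side empty, contributes 0; only the two cuts that separate \<open>u\<close> from \<open>v\<close>
  survive. The value is symmetric in \<open>f\<close> and \<open>g\<close>, hence cancels in
  commutators.\<close>

lemma shuffle_pairing_conv_primitive:
  fixes f g :: "'a list \<Rightarrow> 'k::comm_ring"
  assumes "primitive f" "primitive g" "u \<noteq> []" "v \<noteq> []"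
  shows "shuffle_pairing (word_conv f g) u v = f u * g v + f v * g u"
proof -
  let ?t = "\<lambda>(i, j). shuffle_pairing f (take i u) (take j v) * shuffle_pairing g (drop i u) (drop j v)"
  have z: "?t p = 0" if "p \<in> {..length u} \<times> {..length v} - {(length u, 0), (0, length v)}" for p
  proof -
    obtain i j where p: "p = (i, j)" "i \<le> length u" "j \<le> length v" "(i, j) \<noteq> (length u, 0)" "(i, j) \<noteq> (0, length v)"
      using \<open>p \<in> _\<close> by (cases p) auto
    have f0: "shuffle_pairing f (take i u) (take j v) = 0" if "i \<noteq> 0" "j \<noteq> 0"
      using assms that unfolding primitive_def by auto
    have g0: "shuffle_pairing g (drop i u) (drop j v) = 0" if "i < length u" "j < length v"
      using assms that unfolding primitive_def by auto
    have "i = 0 \<and> j = 0 \<or> i \<noteq> 0 \<and> j \<noteq> 0 \<or> i < length u \<and> j < length v" using p assms(3,4) by auto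
    then show ?thesis
    proof (elim disjE conjE)
      assume "i = 0" "j = 0" then show ?thesis using p assms(1) by (simp add: primitive_def)
    qed (use p f0 g0 assms(3,4) in auto)
  qed
  have "shuffle_pairing (word_conv f g) u v = sum ?t ({..length u} \<times> {..length v})"
    unfolding shuffle_pairing_conv by (simp add: sum.cartesian_product)
  also have "\<dots> = sum ?t {(length u, 0), (0, length v)}"
    by (rule sum.mono_neutral_right) (use z in auto)
  also have "\<dots> = f u * g v + f v * g u" using assms by simp
  finally show ?thesis .
qed

lemma ncps_nth_const_mult [simp]: "ncps_nth (ncps_const c * f) w = c * ncps_nth f w"
proof -
  have "ncps_nth (ncps_const c * f) w = (\<Sum>k\<le>length w. if k = 0 then c * ncps_nth f w else 0)"
    unfolding ncps_nth_mult by (rule sum.cong) (auto simp: ncps_const_def)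
  then show ?thesis by simp
qed

lemma ncps_nth_X: "ncps_nth (ncps_X i) w = (if w = [i] then 1 else 0)"
  by (simp add: ncps_X_def)

lemma shuffle_pairing_length_eq_0:
  assumes "\<And>w. length w = length u + length v \<Longrightarrow> f w = 0"
  shows "shuffle_pairing f u v = 0"
  using shuffle_pairing_cong[of u v f "\<lambda>_. 0"] assms length_shuffles by force

text \<open>The easy half of Ree's theorem, valid over every commutative ring.\<close>

lemma free_lie_primitive:
  fixes f :: "('i, 'k::comm_ring_1) ncps"
  assumes "f \<in> free_lie_algebra"
  shows "primitive (ncps_nth f)"
  using assms
proof induction
  case zero
  then show ?case by (simp add: primitive_def)
next
  case (gen i)
  have "shuffle_pairing (ncps_nth (ncps_X i :: ('i, 'k) ncps)) u v = 0" if "u \<noteq> []" "v \<noteq> []" for u v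
    by (rule shuffle_pairing_length_eq_0)
      (use that in \<open>auto simp: ncps_nth_X neq_Nil_conv\<close>)
  moreover have "ncps_nth (ncps_X i :: ('i, 'k) ncps) [] = 0" by (simp add: ncps_nth_X)
  ultimately show ?case unfolding primitive_def by blast
next
  case (add f g)
  then show ?case by (simp add: primitive_def shuffle_pairing_add)
next
  case (scale f c)
  then show ?case by (simp add: primitive_def shuffle_pairing_scale)
next
  case (bracket f g)
  then show ?case
    using shuffle_pairing_conv_primitive[OF bracket.IH] shuffle_pairing_conv_primitive[OF bracket.IH(2,1)]
    by (simp add: primitive_def shuffle_pairing_diff ncps_nth_mult_conv algebra_simps)
      (simp add: word_conv_def)
qed

section \<open>Least words of primitive integral series and of Lie polynomials\<close>

lemma map_shuffles: "shuffles (map h u) (map h v) = map h ` shuffles u v"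
  by (induction u v rule: shuffles.induct) (simp_all add: image_Un image_image)

text \<open>If \<open>w\<close> were not Lyndon, it would be the largest term of a proper shuffle.
  All other terms are smaller words of the same length, where \<open>f\<close> vanishes, so the
  pairing would be \<open>f w\<close> times a positive multiplicity. The type of letters carries no
  order; \<open>key\<close> supplies one.\<close>

lemma primitive_int_least_word_lyndon:
  fixes f :: "'i list \<Rightarrow> int" and key :: "'i \<Rightarrow> 'o::linorder"
  assumes "inj key" "primitive f" "f w \<noteq> 0"
    and least: "\<And>y. length y = length w \<Longrightarrow> map key y < map key w \<Longrightarrow> f y = 0"
  shows "lyndon (map key w)"
proof (rule ccontr)
  assume not: "\<not> lyndon (map key w)"
  have "w \<noteq> []" using assms by (auto simp: primitive_def)
  then have "map key w \<noteq> []" by simp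
  from not_lyndon_max_shuffle[OF this not] obtain U V where UV: "map key w = U @ V" "U \<noteq> []" "V \<noteq> []"
    and le: "\<And>z. z \<in> shuffles U V \<Longrightarrow> z \<le> map key w" by blast
  from UV(1) obtain u v where uv: "w = u @ v" "U = map key u" "V = map key v"
    by (auto simp: map_eq_append_conv)
  have "shuffle_pairing f u v = shuffle_pairing (\<lambda>z. f w * (if z = w then 1 else 0)) u v"
  proof (rule shuffle_pairing_cong)
    fix z assume z: "z \<in> shuffles u v"
    have "map key z \<le> map key w" using le[of "map key z"] z uv by (simp add: map_shuffles)
    moreover have "map key z \<noteq> map key w" if "z \<noteq> w" using that assms(1) by (simp add: inj_map_eq_map)
    moreover have "length z = length w" using z uv length_shuffles by force
    ultimately show "f z = f w * (if z = w then 1 else 0)" using least[of z] by (cases "z = w") auto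
  qed
  also have "\<dots> = f w * shuffle_pairing (\<lambda>z. if z = w then 1 else 0) u v"
    by (rule shuffle_pairing_scale)
  also have "\<dots> \<noteq> 0"
  proof -
    have "0 < shuffle_pairing (\<lambda>z. if z = w then 1 else 0 :: int) u v"
      by (rule shuffle_pairing_pos(2)[of _ w]) (use uv append_self_in_shuffles in auto)
    then show ?thesis using assms(3) by simp
  qed
  finally show False using assms(2) UV uv unfolding primitive_def by auto
qed

lemma map_key_append_le:
  fixes key :: "'i \<Rightarrow> 'o::linorder"
  assumes "length (take k y) = length l" "map key l \<le> map key (take k y)" "map key m \<le> map key (drop k y)"
  shows "map key (l @ m) \<le> map key y"
proof -
  have "map key l @ map key m \<le> map key (take k y) @ map key (drop k y)"
    by (rule append_mono_eq_length) (use assms in auto)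
  also have "\<dots> = map key y" by (metis append_take_drop_id map_append)
  finally show ?thesis by simp
qed

lemma ncps_nth_mult_homogeneous:
  assumes "\<And>y. ncps_nth f y \<noteq> 0 \<Longrightarrow> length y = m"
  shows "ncps_nth (f * g) w = (if m \<le> length w then ncps_nth f (take m w) * ncps_nth g (drop m w) else 0)"
proof -
  have "ncps_nth (f * g) w = (\<Sum>k\<le>length w. if k = m then ncps_nth f (take k w) * ncps_nth g (drop k w) else 0)"
    unfolding ncps_nth_mult
  proof (rule sum.cong)
    fix k assume "k \<in> {..length w}"
    then have "ncps_nth f (take k w) = 0" if "k \<noteq> m" using assms[of "take k w"] that by auto
    then show "ncps_nth f (take k w) * ncps_nth g (drop k w) =
      (if k = m then ncps_nth f (take k w) * ncps_nth g (drop k w) else 0)" by auto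
  qed simp
  then show ?thesis by simp
qed

lemma free_lie_minus_scale: 
  fixes f g :: "('i, 'k::ring_1) ncps"
  assumes "f \<in> free_lie_algebra" "g \<in> free_lie_algebra"
  shows "f - ncps_const c * g \<in> free_lie_algebra"
proof -
  have "f - ncps_const c * g = f + ncps_const (- c) * g" by (rule ncps_eqI) simp
  then show ?thesis using assms by (metis free_lie_algebra.add free_lie_algebra.scale)
qed

text \<open>Bracket along the standard factorization: all words of \<open>f * g\<close> are at least
  \<open>l @ m\<close>, and all words of \<open>g * f\<close> are at least \<open>m @ l\<close>,
  which is strictly larger. The coefficient 1 makes elimination possible over the integers.\<close>

lemma lyndon_bracket:
  fixes key :: "'i \<Rightarrow> 'o::linorder"
  assumes "inj key" "lyndon (map key z)"
  obtains f :: "('i, 'k::ring_1) ncps" where "f \<in> free_lie_algebra" "ncps_nth f z = 1"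
    "\<And>y. ncps_nth f y \<noteq> 0 \<Longrightarrow> length y = length z \<and> map key z \<le> map key y"
proof -
  have "\<exists>f :: ('i, 'k) ncps. f \<in> free_lie_algebra \<and> ncps_nth f z = 1 \<and>
    (\<forall>y. ncps_nth f y \<noteq> 0 \<longrightarrow> length y = length z \<and> map key z \<le> map key y)"
    using assms(2)
  proof (induction "length z" arbitrary: z rule: less_induct)
    case less
    show ?case
    proof (cases "length z < 2")
      case True
      then have "length z = 1" using less.prems by (cases z) (auto simp: lyndon_def)
      then obtain i where "z = [i]" by (metis length_0_conv length_Suc_conv One_nat_def)
      then show ?thesis
        by (intro exI[of _ "ncps_X i"]) (auto simp: free_lie_algebra.intros ncps_nth_X split: if_splits)
    next
      case False
      then obtain L M where LM: "map key z = L @ M" "lyndon L" "lyndon M" "L @ M < M @ L"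
        using lyndon_factorization[OF less.prems] by auto
      then obtain l m where lm: "z = l @ m" "L = map key l" "M = map key m"
        by (auto simp: map_eq_append_conv)
      have ne: "l \<noteq> []" "m \<noteq> []" using LM lm by (auto simp: lyndon_def)
      obtain f :: "('i, 'k) ncps" where f: "f \<in> free_lie_algebra" "ncps_nth f l = 1"
        "\<And>y. ncps_nth f y \<noteq> 0 \<Longrightarrow> length y = length l \<and> map key l \<le> map key y"
        using less.hyps[of l] LM lm ne by auto
      obtain g :: "('i, 'k) ncps" where g: "g \<in> free_lie_algebra" "ncps_nth g m = 1"
        "\<And>y. ncps_nth g y \<noteq> 0 \<Longrightarrow> length y = length m \<and> map key m \<le> map key y"
        using less.hyps[of m] LM lm ne by auto
      have fg: "ncps_nth (f * g) y = (if length l \<le> length y then ncps_nth f (take (length l) y) * ncps_nth g (drop (length l) y) else 0)" for y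
        by (rule ncps_nth_mult_homogeneous) (use f in blast)
      have gf: "ncps_nth (g * f) y = (if length m \<le> length y then ncps_nth g (take (length m) y) * ncps_nth f (drop (length m) y) else 0)" for y
        by (rule ncps_nth_mult_homogeneous) (use g in blast)
      have fg_supp: "length y = length z \<and> map key z \<le> map key y" if "ncps_nth (f * g) y \<noteq> 0" for y
      proof -
        have 1: "length l \<le> length y" "ncps_nth f (take (length l) y) \<noteq> 0" "ncps_nth g (drop (length l) y) \<noteq> 0"
          using that unfolding fg by (auto split: if_splits)
        have "length y = length z" using f(3)[OF 1(2)] g(3)[OF 1(3)] 1(1) lm by auto
        moreover have "map key z \<le> map key y"
          unfolding lm(1) by (rule map_key_append_le[of "length l"]) (use f(3)[OF 1(2)] g(3)[OF 1(3)] 1(1) in auto)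
        ultimately show ?thesis by simp
      qed
      have gf_supp: "length y = length z \<and> map key z < map key y" if "ncps_nth (g * f) y \<noteq> 0" for y
      proof -
        have 1: "length m \<le> length y" "ncps_nth g (take (length m) y) \<noteq> 0" "ncps_nth f (drop (length m) y) \<noteq> 0"
          using that unfolding gf by (auto split: if_splits)
        have "length y = length z" using g(3)[OF 1(2)] f(3)[OF 1(3)] 1(1) lm by auto
        moreover have "map key (m @ l) \<le> map key y"
          by (rule map_key_append_le[of "length m"]) (use g(3)[OF 1(2)] f(3)[OF 1(3)] 1(1) in auto)
        ultimately show ?thesis using LM lm by auto
      qed
      have "ncps_nth (f * g - g * f) z = 1"
        using gf_supp[of z] f(2) g(2) fg[of z] lm by auto
      moreover have "length y = length z \<and> map key z \<le> map key y" if "ncps_nth (f * g - g * f) y \<noteq> 0" for y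
        using fg_supp[of y] gf_supp[of y] that by fastforce
      ultimately show ?thesis
        using free_lie_algebra.bracket[OF f(1) g(1)] by blast
    qed
  qed
  then show thesis using that by blast
qed

text \<open>Every constructor of the Lie algebra lifts; for scalars this is surjectivity of the
  reduction map. The lift may acquire extra words with coefficients divisible by the prime.\<close>

lemma free_lie_lift_int:
  fixes f :: "('i, 'p::prime_card mod_ring) ncps"
  assumes "f \<in> free_lie_algebra"
  obtains g :: "('i, int) ncps" where "g \<in> free_lie_algebra" "\<And>w. ncps_nth f w = of_int (ncps_nth g w)"
proof -
  have "\<exists>g :: ('i, int) ncps. g \<in> free_lie_algebra \<and> (\<forall>w. ncps_nth f w = of_int (ncps_nth g w))"
    using assms
  proof induction
    case zero
    then show ?case by (intro exI[of _ 0]) (simp add: free_lie_algebra.intros)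
  next
    case (gen i)
    then show ?case by (intro exI[of _ "ncps_X i"]) (simp add: free_lie_algebra.intros ncps_nth_X)
  next
    case (add f1 f2)
    then obtain g1 g2 :: "('i, int) ncps" where "g1 \<in> free_lie_algebra" "g2 \<in> free_lie_algebra"
      "\<And>w. ncps_nth f1 w = of_int (ncps_nth g1 w)" "\<And>w. ncps_nth f2 w = of_int (ncps_nth g2 w)" by blast
    then show ?case by (intro exI[of _ "g1 + g2"]) (simp add: free_lie_algebra.intros)
  next
    case (scale f c)
    then obtain g :: "('i, int) ncps" where g: "g \<in> free_lie_algebra" "\<And>w. ncps_nth f w = of_int (ncps_nth g w)"
      by blast
    obtain m where "c = of_nat m" using surj_of_nat_mod_ring by blast
    then have "c = of_int (int m)" by simp
    with g show ?case by (intro exI[of _ "ncps_const (int m) * g"]) (simp add: free_lie_algebra.intros)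
  next
    case (bracket f1 f2)
    then obtain g1 g2 :: "('i, int) ncps" where "g1 \<in> free_lie_algebra" "g2 \<in> free_lie_algebra"
      "\<And>w. ncps_nth f1 w = of_int (ncps_nth g1 w)" "\<And>w. ncps_nth f2 w = of_int (ncps_nth g2 w)" by blast
    then show ?case by (intro exI[of _ "g1 * g2 - g2 * g1"]) (simp add: free_lie_algebra.intros ncps_nth_mult)
  qed
  with that show thesis by blast
qed

text \<open>Here \<open>w\<close> is least only among the words that survive in \<open>'k\<close>.
  The least integral word \<open>z\<close> is Lyndon in any case; if it lies below \<open>w\<close>,
  subtracting a multiple of its bracketing removes it and leaves the image in \<open>'k\<close>
  alone.\<close>

lemma free_lie_int_least_word_lyndon:
  fixes f :: "('i::finite, int) ncps" and key :: "'i \<Rightarrow> 'o::linorder"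
  assumes "inj key" "f \<in> free_lie_algebra" "(of_int (ncps_nth f w) :: 'k::comm_ring_1) \<noteq> 0"
    and "\<And>y. length y = length w \<Longrightarrow> map key y < map key w \<Longrightarrow> (of_int (ncps_nth f y) :: 'k) = 0"
  shows "lyndon (map key w)"
proof -
  \<comment> \<open>Termination measure: the words below \<open>w\<close> that are at or above some
    word of the support. Counting the support alone would not do, because a subtraction can create
    new words; they all lie above the removed one.\<close>
  let ?B = "\<lambda>f. {y. length y = length w \<and> map key y < map key w \<and>
    (\<exists>x. length x = length w \<and> ncps_nth f x \<noteq> (0::int) \<and> map key x \<le> map key y)}"
  have fin_len: "finite {y::'i list. length y = n}" for n
    using finite_lists_length_eq[of "UNIV :: 'i set" n] by simp
  have fin: "finite (?B f)" for f by (rule finite_subset[OF _ fin_len[of "length w"]]) auto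
  show ?thesis using assms(2-4)
  proof (induction "card (?B f)" arbitrary: f rule: less_induct)
    case less
    let ?S = "{y. length y = length w \<and> ncps_nth f y \<noteq> 0}"
    have finS: "finite ?S" by (rule finite_subset[OF _ fin_len[of "length w"]]) auto
    have "w \<in> ?S" using less.prems(2) by auto
    then have "Min (map key ` ?S) \<in> map key ` ?S" using finS by (intro Min_in) auto
    then obtain z where z: "z \<in> ?S" "Min (map key ` ?S) = map key z" by auto
    have zmin: "map key z \<le> map key y" if "y \<in> ?S" for y
      using Min_le[of "map key ` ?S" "map key y"] finS that z(2) by auto
    have "lyndon (map key z)"
    proof (rule primitive_int_least_word_lyndon[OF assms(1) free_lie_primitive[OF less.prems(1)]])
      show "ncps_nth f z \<noteq> 0" using z by auto
      show "ncps_nth f y = 0" if "length y = length z" "map key y < map key z" for y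
        using zmin[of y] that z by force
    qed
    show ?case
    proof (cases "z = w")
      case True
      then show ?thesis using \<open>lyndon (map key z)\<close> by simp
    next
      case False
      then have "map key z \<noteq> map key w" using assms(1) by (simp add: inj_map_eq_map)
      then have zw: "map key z < map key w" using zmin[OF \<open>w \<in> ?S\<close>] by simp
      then have z0: "(of_int (ncps_nth f z) :: 'k) = 0" using less.prems(3) z by auto
      from lyndon_bracket[OF assms(1) \<open>lyndon (map key z)\<close>]
      obtain P :: "('i, int) ncps" where P: "P \<in> free_lie_algebra" "ncps_nth P z = 1"
        "\<And>y. ncps_nth P y \<noteq> 0 \<Longrightarrow> length y = length z \<and> map key z \<le> map key y" by blast
      let ?f = "f - ncps_const (ncps_nth f z) * P"
      have nth: "ncps_nth ?f y = ncps_nth f y - ncps_nth f z * ncps_nth P y" for y by simp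
      \<comment> \<open>The multiplier of \<open>P\<close> is the coefficient of \<open>z\<close>,
        whose image in \<open>'k\<close> is 0 because \<open>z\<close> lies below
        \<open>w\<close>.\<close>
      have red: "(of_int (ncps_nth ?f y) :: 'k) = of_int (ncps_nth f y)" for y
        unfolding nth using z0 by simp
      have supp: "map key z < map key y" if "length y = length w" "ncps_nth ?f y \<noteq> 0" for y
      proof -
        have "y \<noteq> z" using that P(2) by auto
        then have "map key z \<noteq> map key y" using assms(1) by (simp add: inj_map_eq_map)
        moreover have "map key z \<le> map key y"
        proof (cases "ncps_nth f y = 0")
          case True
          then have "ncps_nth P y \<noteq> 0" using that(2) by auto
          then show ?thesis using P(3) by auto
        next
          case False
          then show ?thesis using zmin that(1) by auto
        qed
        ultimately show ?thesis by simp
      qed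
      have "?B ?f \<subseteq> ?B f"
      proof safe
        fix y x assume "length x = length w" "map key y < map key w" "ncps_nth ?f x \<noteq> 0" "map key x \<le> map key y"
        then have "map key z \<le> map key y" using supp[of x] by simp
        then show "\<exists>x. length x = length w \<and> ncps_nth f x \<noteq> 0 \<and> map key x \<le> map key y" using z by auto
      qed
      moreover have "z \<in> ?B f" using z zw by auto
      moreover have "z \<notin> ?B ?f" using supp by force
      ultimately have "card (?B ?f) < card (?B f)" by (intro psubset_card_mono[OF fin]) auto
      then show ?thesis
        by (rule less.hyps) (use less.prems red free_lie_minus_scale[OF less.prems(1) P(1)] in auto)
    qed
  qed
qed

lemma free_lie_least_word_lyndon:
  fixes f :: "('i::finite, 'p::prime_card mod_ring) ncps" and key :: "'i \<Rightarrow> 'o::linorder"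
  assumes "inj key" "f \<in> free_lie_algebra" "ncps_nth f w \<noteq> 0"
    and "\<And>y. length y = length w \<Longrightarrow> map key y < map key w \<Longrightarrow> ncps_nth f y = 0"
  shows "lyndon (map key w)"
proof -
  obtain g :: "('i, int) ncps" where g: "g \<in> free_lie_algebra" "\<And>w. ncps_nth f w = of_int (ncps_nth g w)"
    using free_lie_lift_int[OF assms(2)] by blast
  show ?thesis
    by (rule free_lie_int_least_word_lyndon[OF assms(1) g(1), where 'k = "'p mod_ring"]) (use assms g(2) in auto)
qed

section \<open>Dynkin's identity\<close>

text \<open>Right-normed bracketing, whose innermost letter is the last one. The value at the empty
  word only serves to keep all values in the Lie algebra.\<close>

fun right_bracket :: "'i list \<Rightarrow> ('i, 'k::ring_1) ncps" where
  "right_bracket [] = 0"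
| "right_bracket [i] = ncps_X i"
| "right_bracket (i # j # w) = ncps_X i * right_bracket (j # w) - right_bracket (j # w) * ncps_X i"

lemma right_bracket_free_lie: "right_bracket w \<in> free_lie_algebra"
  by (induction w rule: right_bracket.induct) (auto intro: free_lie_algebra.intros)

lemma ncps_nth_X_mult:
  "ncps_nth (ncps_X i * f) w = (if w \<noteq> [] \<and> hd w = i then ncps_nth f (tl w) else 0)"
proof -
  have "ncps_nth (ncps_X i * f) w =
      (if 1 \<le> length w then ncps_nth (ncps_X i) (take 1 w) * ncps_nth f (drop 1 w) else 0)"
    by (rule ncps_nth_mult_homogeneous) (simp add: ncps_nth_X split: if_splits)
  then show ?thesis by (cases w) (auto simp: ncps_nth_X)
qed

lemma ncps_nth_mult_X:
  "ncps_nth (f * ncps_X i) w = (if w \<noteq> [] \<and> last w = i then ncps_nth f (butlast w) else 0)"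
proof -
  have "ncps_nth (f * ncps_X i) w =
      (\<Sum>k\<le>length w. if w \<noteq> [] \<and> last w = i \<and> k = length w - 1 then ncps_nth f (butlast w) else 0)"
    unfolding ncps_nth_mult
  proof (rule sum.cong)
    fix k assume "k \<in> {..length w}"
    have "drop k w = [i] \<longleftrightarrow> w \<noteq> [] \<and> last w = i \<and> k = length w - 1"
    proof
      assume d: "drop k w = [i]"
      then have "length w - k = 1" by (metis length_drop length_Cons list.size(3) One_nat_def)
      moreover have "w \<noteq> []" using d by auto
      moreover have "last w = i" using d by (metis last_ConsL last_drop drop_eq_Nil linorder_not_le list.distinct(1))
      ultimately show "w \<noteq> [] \<and> last w = i \<and> k = length w - 1" by simp
    next
      assume "w \<noteq> [] \<and> last w = i \<and> k = length w - 1"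
      then show "drop k w = [i]"
        by (cases w rule: rev_cases) auto
    qed
    moreover have "take k w = butlast w" if "k = length w - 1" using that by (simp add: butlast_conv_take)
    ultimately show "ncps_nth f (take k w) * ncps_nth (ncps_X i) (drop k w) =
      (if w \<noteq> [] \<and> last w = i \<and> k = length w - 1 then ncps_nth f (butlast w) else 0)"
      by (auto simp: ncps_nth_X)
  qed simp
  also have "\<dots> = (if w \<noteq> [] \<and> last w = i then ncps_nth f (butlast w) else 0)"
    by (cases "w \<noteq> [] \<and> last w = i") auto
  finally show ?thesis .
qed

lemma right_bracket_length:
  "ncps_nth (right_bracket w :: ('i, 'k::ring_1) ncps) z \<noteq> 0 \<Longrightarrow> length z = length w"
proof (induction w arbitrary: z rule: right_bracket.induct)
  case (3 i j w)
  then show ?case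
    by (auto simp: ncps_nth_X_mult ncps_nth_mult_X split: if_splits)
      (metis One_nat_def Suc_pred length_butlast length_greater_0_conv length_tl)+
qed (auto simp: ncps_nth_X split: if_splits)

text \<open>Collects \<open>f\<close> over the words whose bracketing puts its innermost letter at
  position \<open>j\<close> of \<open>z\<close>: such a word shuffles the part of \<open>z\<close>
  before \<open>j\<close> with the reversed part after it, and ends in \<open>z ! j\<close>.\<close>

definition bracket_term :: "('i list \<Rightarrow> 'k::comm_ring_1) \<Rightarrow> 'i list \<Rightarrow> nat \<Rightarrow> 'k" where
  "bracket_term f z j = shuffle_pairing (\<lambda>w. f (w @ [z ! j])) (take j z) (rev (drop (Suc j) z))"

text \<open>Expanding the bracketing of \<open>x\<^sub>1\<cdots>x\<^sub>k\<close> gives the words in which the letter \<open>x\<^sub>k\<close> is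
  preceded by a subword of \<open>x\<^sub>1\<cdots>x\<^bsub>k-1\<^esub>\<close> and followed by the reversed complementary subword.\<close>

lemma bracket_term_rec:
  assumes "z = a # z1" "z = z2 @ [b]" "length z = Suc (Suc k)" "j \<le> Suc k"
  shows "bracket_term f z j =
    (if j = 0 then 0 else bracket_term (\<lambda>w. f (a # w)) z1 (j - 1)) +
    (if j = Suc k then 0 else bracket_term (\<lambda>w. f (b # w)) z2 j)"
proof -
  \<comment> \<open>The outermost letter of the bracketed word is the first or the last letter of
    \<open>z\<close>. At \<open>j = 0\<close> and at \<open>j = Suc k\<close> one shuffle factor is
    empty and only one choice remains.\<close>
  have dr: "rev (drop (Suc j) z) = b # rev (drop (Suc j) z2)" "z ! j = z2 ! j" "take j z = take j z2" if "j \<noteq> Suc k"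
    using that assms(2-4) by (auto simp: nth_append)
  have tk: "take j z = a # take (j - 1) z1" "z ! j = z1 ! (j - 1)" "drop (Suc j) z = drop j z1" if "j \<noteq> 0"
    using that assms(1,3,4) by (cases j; auto)+
  show ?thesis
  proof (cases "j = 0"; cases "j = Suc k")
    assume "j \<noteq> 0" "j = Suc k"
    moreover have "drop j z1 = []" "drop (Suc j) z = []" using assms \<open>j = Suc k\<close> by auto
    ultimately show ?thesis using tk by (simp add: bracket_term_def)
  next
    assume "j = 0" "j \<noteq> Suc k"
    then show ?thesis using dr by (simp add: bracket_term_def)
  next
    assume j: "j \<noteq> 0" "j \<noteq> Suc k"
    have 1: "rev (drop j z1) = b # rev (drop (Suc j) z2)" using dr(1) tk(3) j by simp
    have 2: "take j z2 = a # take (j - 1) z1" using dr(3) tk(1) j by simp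
    have 3: "Suc (j - 1) = j" using j by simp
    show ?thesis unfolding bracket_term_def 3 using j dr(1,2) tk 1 2 by simp
  qed (use assms in auto)
qed

lemma words_Suc_sum:
  fixes g :: "'i::finite list \<Rightarrow> 'k::comm_monoid_add"
  shows "(\<Sum>w | length w = Suc k. g w) = (\<Sum>x\<in>UNIV. \<Sum>w | length w = k. g (x # w))"
proof -
  have "(\<Sum>x\<in>UNIV. \<Sum>w | length w = k. g (x # w)) = (\<Sum>(x, w)\<in>UNIV \<times> {w. length w = k}. g (x # w))"
    by (rule sum.cartesian_product)
  also have "\<dots> = (\<Sum>w | length w = Suc k. g w)"
    by (rule sum.reindex_bij_witness[of _ "\<lambda>w. (hd w, tl w)" "\<lambda>(x, w). x # w"])
      (auto simp: length_Suc_conv)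
  finally show ?thesis ..
qed

text \<open>Each of the \<open>k - j\<close> letters to the right of the innermost one comes from
  the subtracted half of a commutator, whence the sign.\<close>

lemma sum_right_bracket:
  fixes f :: "'i::finite list \<Rightarrow> 'k::comm_ring_1"
  assumes "length z = Suc k"
  shows "(\<Sum>w | length w = Suc k. f w * ncps_nth (right_bracket w) z) =
    (\<Sum>j\<le>k. (-1) ^ (k - j) * bracket_term f z j)"
  using assms
proof (induction k arbitrary: f z)
  case 0
  then obtain a where z: "z = [a]" by (auto simp: length_Suc_conv)
  have "(\<Sum>w | length w = Suc 0. f w * ncps_nth (right_bracket w) z) =
      (\<Sum>x\<in>UNIV. f [x] * ncps_nth (ncps_X x) z)"
    unfolding words_Suc_sum by simp
  also have "\<dots> = (\<Sum>x\<in>UNIV. if x = a then f [x] else 0)"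
    by (rule sum.cong) (auto simp: z ncps_nth_X)
  also have "\<dots> = f [a]" by simp
  finally show ?case by (simp add: z bracket_term_def)
next
  case (Suc k)
  obtain a z1 where a: "z = a # z1" "length z1 = Suc k" using Suc.prems by (auto simp: length_Suc_conv)
  obtain b z2 where b: "z = z2 @ [b]" "length z2 = Suc k" using Suc.prems by (cases z rule: rev_cases) auto
  let ?R = "\<lambda>w. right_bracket w :: ('i, 'k) ncps"
  have rb: "?R (x # w) = ncps_X x * ?R w - ?R w * ncps_X x" if "length w = Suc k" for x w
    using that by (cases w) auto
  have X1: "ncps_nth (ncps_X x * g) z = (if x = a then ncps_nth g z1 else 0)" for x and g :: "('i, 'k) ncps"
    by (auto simp: ncps_nth_X_mult a)
  have X2: "ncps_nth (g * ncps_X x) z = (if x = b then ncps_nth g z2 else 0)" for x and g :: "('i, 'k) ncps"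
    by (auto simp: ncps_nth_mult_X b)
  have "(\<Sum>w | length w = Suc (Suc k). f w * ncps_nth (?R w) z) =
     (\<Sum>x\<in>UNIV. \<Sum>w | length w = Suc k. f (x # w) * ncps_nth (?R (x # w)) z)"
    by (rule words_Suc_sum)
  also have "\<dots> = (\<Sum>x\<in>UNIV. \<Sum>w | length w = Suc k.
      (if x = a then f (a # w) * ncps_nth (?R w) z1 else 0) - (if x = b then f (b # w) * ncps_nth (?R w) z2 else 0))"
    by (intro sum.cong refl) (simp add: rb X1 X2 algebra_simps)
  also have "\<dots> = (\<Sum>x\<in>UNIV. (if x = a then \<Sum>w | length w = Suc k. f (a # w) * ncps_nth (?R w) z1 else 0)) -
      (\<Sum>x\<in>UNIV. (if x = b then \<Sum>w | length w = Suc k. f (b # w) * ncps_nth (?R w) z2 else 0))"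
    unfolding sum_subtractf [symmetric] by (intro sum.cong refl) (auto simp: sum_subtractf sum_negf)
  also have "\<dots> = (\<Sum>w | length w = Suc k. f (a # w) * ncps_nth (?R w) z1) -
      (\<Sum>w | length w = Suc k. f (b # w) * ncps_nth (?R w) z2)"
    by simp
  also have "\<dots> = (\<Sum>j\<le>k. (-1) ^ (k - j) * bracket_term (\<lambda>w. f (a # w)) z1 j) -
      (\<Sum>j\<le>k. (-1) ^ (k - j) * bracket_term (\<lambda>w. f (b # w)) z2 j)"
    using Suc.IH[of z1 "\<lambda>w. f (a # w)"] Suc.IH[of z2 "\<lambda>w. f (b # w)"] a b by simp
  also have "(\<Sum>j\<le>k. (-1) ^ (k - j) * bracket_term (\<lambda>w. f (a # w)) z1 j) =
      (\<Sum>j\<le>Suc k. (-1) ^ (Suc k - j) * (if j = 0 then 0 else bracket_term (\<lambda>w. f (a # w)) z1 (j - 1)))"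
    by (simp add: sum.atMost_Suc_shift del: sum.atMost_Suc)
  also have "(\<Sum>j\<le>k. (-1) ^ (k - j) * bracket_term (\<lambda>w. f (b # w)) z2 j) =
      - (\<Sum>j\<le>Suc k. (-1) ^ (Suc k - j) * (if j = Suc k then 0 else bracket_term (\<lambda>w. f (b # w)) z2 j))"
    unfolding sum_negf [symmetric] by (simp add: Suc_diff_le)
  also have "(\<Sum>j\<le>Suc k. (-1) ^ (Suc k - j) * (if j = 0 then 0 else bracket_term (\<lambda>w. f (a # w)) z1 (j - 1))) -
     - (\<Sum>j\<le>Suc k. (-1) ^ (Suc k - j) * (if j = Suc k then 0 else bracket_term (\<lambda>w. f (b # w)) z2 j)) =
     (\<Sum>j\<le>Suc k. (-1) ^ (Suc k - j) * bracket_term f z j)"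
    unfolding diff_minus_eq_add sum.distrib [symmetric] distrib_left [symmetric]
    by (intro sum.cong refl) (simp only: bracket_term_rec[OF a(1) b(1) Suc.prems, symmetric] atMost_iff)
  finally show ?case .
qed

text \<open>A shuffle of \<open>take (Suc j) z\<close> with the reversed rest ends in
  \<open>z ! j\<close> or in \<open>z ! Suc j\<close>, so orthogonality makes neighbouring terms
  opposite. The start is \<open>j = k\<close>, where the term is \<open>f z\<close>; the alternating
  signs then cancel those of \<open>sum_right_bracket\<close>.\<close>

lemma bracket_term_primitive:
  assumes "primitive f" "length z = Suc k" "i \<le> k"
  shows "bracket_term f z (k - i) = (-1) ^ i * f z"
  using assms(3)
proof (induction i)
  case 0
  have "take k z @ [z ! k] = z" using assms(2) by (metis lessI take_Suc_conv_app_nth take_all order_refl)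
  then show ?case using assms(2) by (simp add: bracket_term_def)
next
  case (Suc i)
  define j where "j = k - Suc i"
  have j: "Suc j = k - i" "Suc j < length z" using Suc.prems assms(2) by (auto simp: j_def)
  have tk: "take (Suc j) z = take j z @ [z ! j]" using j(2) by (intro take_Suc_conv_app_nth) simp
  have dr: "rev (drop (Suc j) z) = rev (drop (Suc (Suc j)) z) @ [z ! Suc j]"
    using j by (metis Cons_nth_drop_Suc rev.simps(2))
  have "0 = shuffle_pairing f (take (Suc j) z) (rev (drop (Suc j) z))"
    using assms(1) tk dr by (simp add: primitive_def)
  also have "\<dots> = bracket_term f z j + bracket_term f z (Suc j)"
    unfolding tk dr shuffle_pairing_snoc unfolding tk[symmetric] dr[symmetric] bracket_term_def by simp
  finally have "bracket_term f z j = - bracket_term f z (Suc j)" by (simp add: eq_neg_iff_add_eq_0)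
  then show ?case using Suc j by (simp add: j_def[symmetric])
qed

lemma ncps_nth_sum: "ncps_nth (\<Sum>w\<in>A. g w) z = (\<Sum>w\<in>A. ncps_nth (g w) z)"
  by (induction A rule: infinite_finite_induct) auto

lemma free_lie_sum:
  assumes "\<And>w. w \<in> A \<Longrightarrow> g w \<in> free_lie_algebra"
  shows "(\<Sum>w\<in>A. g w) \<in> free_lie_algebra"
  using assms by (induction A rule: infinite_finite_induct) (auto intro: free_lie_algebra.intros)

text \<open>Bracketing the words of a primitive series, weighted by the degree of the last letter,
  multiplies the component of degree \<open>n\<close> by \<open>n\<close>.\<close>

lemma primitive_homogeneous_free_lie:
  fixes f :: "('i::finite, 'k::field) ncps"
  assumes prim: "primitive (ncps_nth f)" and fin: "finite {w. ncps_nth f w \<noteq> 0}"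
    and hom: "\<And>w. ncps_nth f w \<noteq> 0 \<Longrightarrow> weight \<tau> w = n" and n: "(of_nat n :: 'k) \<noteq> 0"
  shows "f \<in> free_lie_algebra"
proof -
  let ?S = "{w. ncps_nth f w \<noteq> 0}"
  \<comment> \<open>The last letter is the innermost one, and it runs through all positions of
    \<open>z\<close> with total sign 1, so these factors add up to \<open>weight \<tau> z\<close>.
    Without them the length of \<open>z\<close> would appear, which may be 0 in
    \<open>'k\<close>.\<close>
  define g where "g w = ncps_nth f w * of_nat (\<tau> (last w))" for w
  have "f = ncps_const (inverse (of_nat n)) * (\<Sum>w\<in>?S. ncps_const (g w) * right_bracket w)"
  proof (rule ncps_eqI)
    fix z
    have "(\<Sum>w\<in>?S. g w * ncps_nth (right_bracket w) z) = of_nat n * ncps_nth f z"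
    proof (cases "z = []")
      case True
      have "g w * ncps_nth (right_bracket w) z = 0" for w :: "'i list"
        using right_bracket_length[of w z, where 'k = 'k] True by (cases w) auto
      then have "(\<Sum>w\<in>?S. g w * ncps_nth (right_bracket w) z) = 0" by (intro sum.neutral ballI)
      then show ?thesis using True prim by (simp add: primitive_def)
    next
      case False
      then obtain k where k: "length z = Suc k" by (cases z) auto
      have "(\<Sum>w\<in>?S. g w * ncps_nth (right_bracket w) z) = 
         (\<Sum>w\<in>?S \<inter> {w. length w = Suc k}. g w * ncps_nth (right_bracket w) z)"
        by (rule sum.mono_neutral_right) (use fin right_bracket_length[of _ z, where 'k = 'k] k in auto)
      also have "\<dots> = (\<Sum>w | length w = Suc k. g w * ncps_nth (right_bracket w) z)"
        by (rule sum.mono_neutral_left)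
          (use finite_lists_length_eq[of "UNIV :: 'i set" "Suc k"] in \<open>auto simp: g_def\<close>)
      also have "\<dots> = (\<Sum>j\<le>k. (-1) ^ (k - j) * bracket_term g z j)"
        by (rule sum_right_bracket[OF k])
      also have "\<dots> = (\<Sum>j\<le>k. of_nat (\<tau> (z ! j)) * ncps_nth f z)"
      proof (rule sum.cong)
        fix j assume "j \<in> {..k}"
        then have j: "j = k - (k - j)" by simp
        have "bracket_term g z j = bracket_term (ncps_nth f) z j * of_nat (\<tau> (z ! j))"
          by (simp add: bracket_term_def g_def shuffle_pairing_scale_right)
        also have "bracket_term (ncps_nth f) z j = (-1) ^ (k - j) * ncps_nth f z"
          by (subst j) (rule bracket_term_primitive[OF prim k], simp)
        finally show "(-1) ^ (k - j) * bracket_term g z j = of_nat (\<tau> (z ! j)) * ncps_nth f z"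
          by (simp add: power_mult_distrib[symmetric] mult.assoc[symmetric])
      qed simp
      also have "\<dots> = of_nat (weight \<tau> z) * ncps_nth f z"
      proof -
        have "weight \<tau> z = (\<Sum>j<Suc k. \<tau> (z ! j))"
          using k by (simp add: weight_def sum_list_sum_nth atLeast0LessThan)
        then show ?thesis by (simp add: sum_distrib_right lessThan_Suc_atMost)
      qed
      also have "\<dots> = of_nat n * ncps_nth f z"
        using hom[of z] by (cases "ncps_nth f z = 0") auto
      finally show ?thesis .
    qed
    then show "ncps_nth f z = ncps_nth (ncps_const (inverse (of_nat n)) * (\<Sum>w\<in>?S. ncps_const (g w) * right_bracket w)) z"
      using n by (simp add: ncps_nth_sum)
  qed
  also have "\<dots> \<in> free_lie_algebra"
    by (intro free_lie_algebra.scale free_lie_sum right_bracket_free_lie)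
  finally show ?thesis .
qed

section \<open>Unipotence of \<open>p\<close>-group actions\<close>

text \<open>The number of cosets of \<open>W\<close> in \<open>V\<close> is a power of
  \<open>p\<close> other than 1, hence divisible by \<open>p\<close>, and all orbits have
  \<open>p\<close>-power size. Since \<open>{W}\<close> is a singleton orbit there is another one,
  and \<open>v\<close> represents it.\<close>

lemma p_group_fixed_coset:
  fixes V W :: "'v::ab_group_add set" and Q :: "('q, 'c) monoid_scheme"
  assumes Q: "group Q" "order Q = p ^ k" and p: "Factorial_Ring.prime p"
    and V: "finite V" "card V = p ^ N" "\<And>u v. u \<in> V \<Longrightarrow> v \<in> V \<Longrightarrow> u - v \<in> V"
    and W: "W \<subseteq> V" "W \<noteq> V" "0 \<in> W" "\<And>u v. u \<in> W \<Longrightarrow> v \<in> W \<Longrightarrow> u - v \<in> W"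
    and act_V: "\<And>g v. g \<in> carrier Q \<Longrightarrow> v \<in> V \<Longrightarrow> act g v \<in> V"
    and act_W: "\<And>g v. g \<in> carrier Q \<Longrightarrow> v \<in> W \<Longrightarrow> act g v \<in> W"
    and act_one: "\<And>v. v \<in> V \<Longrightarrow> act \<one>\<^bsub>Q\<^esub> v = v"
    and act_mult: "\<And>g h v. g \<in> carrier Q \<Longrightarrow> h \<in> carrier Q \<Longrightarrow> v \<in> V \<Longrightarrow> act (g \<otimes>\<^bsub>Q\<^esub> h) v = act g (act h v)"
    and act_diff: "\<And>g u v. act g (u - v) = act g u - act g v"
  shows "\<exists>v\<in>V - W. \<forall>g\<in>carrier Q. act g v - v \<in> W"
proof -
  interpret Q: group Q by (rule Q(1))
  define coset where "coset v = (\<lambda>w. v + w) ` W" for v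
  define E where "E = coset ` V"
  have V0: "0 \<in> V" using W by auto
  have W_uminus: "- w \<in> W" if "w \<in> W" for w using W(4)[OF W(3) that] by simp
  have W_add: "u + w \<in> W" if "u \<in> W" "w \<in> W" for u w using W(4)[OF that(1) W_uminus[OF that(2)]] by simp
  have V_add: "u + w \<in> V" if "u \<in> V" "w \<in> V" for u w
    using V(3)[OF that(1), of "0 - w"] V(3)[OF V0 that(2)] by simp
  have act_0: "act g 0 = 0" for g using act_diff[of g 0 0] by simp
  have act_add: "act g (u + v) = act g u + act g v" for g u v
    using act_diff[of g u "- v"] act_diff[of g 0 v] act_0[of g] by simp
  have self: "v \<in> coset v" for v using W(3) by (force simp: coset_def)
  have coset_eq: "coset u = coset v \<longleftrightarrow> u - v \<in> W" for u v
  proof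
    assume "coset u = coset v"
    then have "u \<in> coset v" using self by blast
    then show "u - v \<in> W" by (auto simp: coset_def)
  next
    have sub: "coset u \<subseteq> coset v" if "u - v \<in> W" for u v
    proof
      fix y assume "y \<in> coset u"
      then obtain w where "y = u + w" "w \<in> W" by (auto simp: coset_def)
      then have "y = v + ((u - v) + w)" "(u - v) + w \<in> W" using W_add[OF that] by auto
      then show "y \<in> coset v" unfolding coset_def by blast
    qed
    assume "u - v \<in> W"
    moreover then have "v - u \<in> W" using W_uminus by fastforce
    ultimately show "coset u = coset v" using sub by blast
  qed
  have coset_act: "act g ` coset v = coset (act g v)" if g: "g \<in> carrier Q" and v: "v \<in> V" for g v
  proof (intro equalityI subsetI)
    fix y assume "y \<in> act g ` coset v"
    then obtain w where "w \<in> W" "y = act g v + act g w" by (auto simp: coset_def act_add)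
    then show "y \<in> coset (act g v)" using act_W[OF g] by (auto simp: coset_def)
  next
    fix y assume "y \<in> coset (act g v)"
    then obtain w where w: "w \<in> W" "y = act g v + w" by (auto simp: coset_def)
    have "act g (act (inv\<^bsub>Q\<^esub> g) w) = w"
      using act_mult[OF g, of "inv\<^bsub>Q\<^esub> g" w] act_one[of w] g w(1) W(1) by auto
    then have "y = act g (v + act (inv\<^bsub>Q\<^esub> g) w)" using w(2) by (simp add: act_add)
    then show "y \<in> act g ` coset v" using act_W[of "inv\<^bsub>Q\<^esub> g" w] g w(1) by (auto simp: coset_def)
  qed
  have finE: "finite E" using V(1) by (simp add: E_def)
  have "card V = card E * card W"
  proof -
    have "\<Union>E = V"
    proof (intro equalityI subsetI)
      fix y assume "y \<in> \<Union>E"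
      then show "y \<in> V" using V_add W(1) by (auto simp: E_def coset_def)
    next
      fix y assume "y \<in> V"
      then show "y \<in> \<Union>E" using self by (auto simp: E_def)
    qed
    moreover have "card C = card W" if "C \<in> E" for C
      using that by (auto simp: E_def coset_def card_image)
    moreover have "C \<inter> D = {}" if "C \<in> E" "D \<in> E" "C \<noteq> D" for C D
    proof (rule ccontr)
      assume "C \<inter> D \<noteq> {}"
      then obtain y where y: "y \<in> C" "y \<in> D" by auto
      from that obtain u v where uv: "C = coset u" "D = coset v" by (auto simp: E_def)
      have "y - u \<in> W" using y(1) unfolding uv(1) coset_def by auto
      moreover have "y - v \<in> W" using y(2) unfolding uv(2) coset_def by auto
      ultimately have "(y - v) - (y - u) \<in> W" using W(4)[of "y - v" "y - u"] by blast
      then have "u - v \<in> W" by simp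
      then show False using that(3) uv coset_eq by auto
    qed
    ultimately show ?thesis
      using card_partition[of E "card W"] finE V(1) by (simp add: mult.commute)
  qed
  moreover have "card W < card V" using W(1,2) V(1) by (intro psubset_card_mono) auto
  ultimately have "card E \<noteq> 1" by auto
  moreover have "card E dvd p ^ N" using \<open>card V = card E * card W\<close> V(2) by (metis dvd_triv_left)
  ultimately have p_E: "p dvd card E" using p
    by (metis divides_primepow_nat dvd_power not_gr_zero power_0)
  define \<phi> where "\<phi> g = (\<lambda>C\<in>E. act g ` C)" for g
  have in_E: "act g ` C \<in> E" if "g \<in> carrier Q" "C \<in> E" for g C
    using that coset_act act_V by (auto simp: E_def)
  have comp: "act g ` act h ` C = act (g \<otimes>\<^bsub>Q\<^esub> h) ` C" if "g \<in> carrier Q" "h \<in> carrier Q" "C \<in> E" for g h C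
  proof -
    obtain v where v: "v \<in> V" "C = coset v" using \<open>C \<in> E\<close> by (auto simp: E_def)
    have "g \<otimes>\<^bsub>Q\<^esub> h \<in> carrier Q" using that by simp
    then show ?thesis unfolding v(2)
      using coset_act[OF that(2) v(1)] coset_act[OF that(1) act_V[OF that(2) v(1)]]
        coset_act[OF _ v(1)] act_mult[OF that(1,2) v(1)] by metis
  qed
  have id: "act \<one>\<^bsub>Q\<^esub> ` C = C" if C: "C \<in> E" for C
  proof -
    obtain v where v: "v \<in> V" "C = coset v" using C by (auto simp: E_def)
    then show ?thesis using coset_act[of "\<one>\<^bsub>Q\<^esub>" v] act_one[of v] by simp
  qed
  have "group_action Q E \<phi>"
  proof (intro group_action.intro group_hom.intro group_hom_axioms.intro Q(1) group_BijGroup homI)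
    fix g assume g: "g \<in> carrier Q"
    have "bij_betw (\<phi> g) E E"
      by (rule bij_betwI[of _ _ _ "\<phi> (inv\<^bsub>Q\<^esub> g)"])
        (use g in_E comp id in \<open>auto simp: \<phi>_def\<close>)
    then show "\<phi> g \<in> carrier (BijGroup E)"
      by (simp add: BijGroup_def Bij_def \<phi>_def)
  next
    fix g h assume gh: "g \<in> carrier Q" "h \<in> carrier Q"
    have bij: "\<phi> g \<in> Bij E" if "g \<in> carrier Q" for g
    proof -
      have "bij_betw (\<phi> g) E E"
        by (rule bij_betwI[of _ _ _ "\<phi> (inv\<^bsub>Q\<^esub> g)"])
          (use that in_E comp id in \<open>auto simp: \<phi>_def\<close>)
      then show ?thesis by (simp add: Bij_def \<phi>_def)
    qed
    have "\<phi> (g \<otimes>\<^bsub>Q\<^esub> h) = compose E (\<phi> g) (\<phi> h)"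
      by (rule ext) (simp add: \<phi>_def compose_def restrict_def gh in_E comp)
    then show "\<phi> (g \<otimes>\<^bsub>Q\<^esub> h) = \<phi> g \<otimes>\<^bsub>BijGroup E\<^esub> \<phi> h"
      using bij gh by (simp add: BijGroup_def)
  qed
  then interpret A: group_action Q E \<phi> .
  have W_coset: "W = coset 0" by (simp add: coset_def)
  have W_E: "W \<in> E" using W_coset V0 by (auto simp: E_def)
  have orb_W: "orbit Q \<phi> W = {W}"
  proof -
    have "\<phi> g W = W" if "g \<in> carrier Q" for g
      using that W_E coset_act[OF that V0] act_0 W_coset by (simp add: \<phi>_def)
    moreover have "carrier Q \<noteq> {}" by auto
    ultimately show ?thesis unfolding orbit_def by auto
  qed
  have orbW_mem: "{W} \<in> orbits Q E \<phi>" unfolding orbits_def using W_E orb_W by auto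
  have fin_orbits: "finite (orbits Q E \<phi>)"
  proof -
    have "orbits Q E \<phi> = orbit Q \<phi> ` E" unfolding orbits_def by auto
    then show ?thesis using finE by simp
  qed
  have "\<exists>orb\<in>orbits Q E \<phi> - {{W}}. card orb = 1"
  proof (rule ccontr)
    assume no: "\<not> ?thesis"
    have "p dvd card orb" if orb: "orb \<in> orbits Q E \<phi> - {{W}}" for orb
    proof -
      obtain C where C: "C \<in> E" "orb = orbit Q \<phi> C" using orb unfolding orbits_def by blast
      then have "card orb dvd p ^ k"
        using A.orbit_stabilizer_theorem[OF C(1)] Q(2) by (metis dvd_triv_left)
      moreover have "card orb \<noteq> 1" using no orb by auto
      ultimately show ?thesis using p
        by (metis divides_primepow_nat dvd_power not_gr_zero power_0)
    qed
    then have "p dvd (\<Sum>orb\<in>orbits Q E \<phi> - {{W}}. card orb)" by (intro dvd_sum) auto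
    moreover have "card E = (\<Sum>orb\<in>orbits Q E \<phi>. card orb)"
      using A.disjoint_sum[OF finE, of "\<lambda>_. 1::nat"] by simp
    then have "card E = card {W} + (\<Sum>orb\<in>orbits Q E \<phi> - {{W}}. card orb)"
      using sum.remove[OF fin_orbits orbW_mem, of card] by simp
    ultimately have "p dvd 1" using p_E by (metis card_1_singleton_iff One_nat_def dvd_add_left_iff)
    then show False using p by (simp add: prime_nat_iff)
  qed
  then obtain orb where orb: "orb \<in> orbits Q E \<phi>" "orb \<noteq> {W}" "card orb = 1" by auto
  from orb(1) obtain C where C: "C \<in> E" "orb = orbit Q \<phi> C" unfolding orbits_def by blast
  obtain v where v: "v \<in> V" "C = coset v" using C(1) by (auto simp: E_def)
  have "C \<in> orb" using C A.orbit_refl by blast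
  then have orb_C: "orb = {C}" using orb(3) by (metis card_1_singletonE singletonD)
  have "v \<notin> W"
  proof
    assume "v \<in> W"
    then have "C = W" using v(2) W_coset coset_eq[of v 0] by simp
    then show False using orb(2) orb_C by simp
  qed
  moreover have "act g v - v \<in> W" if g: "g \<in> carrier Q" for g
  proof -
    have "\<phi> g C \<in> orb" unfolding C(2) orbit_def using g by auto
    then have "act g ` C = C" using orb_C C(1) by (simp add: \<phi>_def)
    then have "coset (act g v) = coset v" using coset_act[OF g v(1)] v(2) by simp
    then show ?thesis using coset_eq by blast
  qed
  ultimately show ?thesis using v(1) by blast
qed

text \<open>The product (g_1 - 1) ... (g_n - 1) applied to \<open>v\<close>: the image of a monomial
  when each variable acts as a group element minus 1.\<close>

fun difference_word :: "('g \<Rightarrow> 'v \<Rightarrow> 'v::ab_group_add) \<Rightarrow> 'g list \<Rightarrow> 'v \<Rightarrow> 'v" where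
  "difference_word act [] v = v"
| "difference_word act (g # gs) v = act g (difference_word act gs v) - difference_word act gs v"

text \<open>Build an ascending chain \<open>W\<close> from 0, each step being the preimage of the
  fixed points modulo the previous one. By \<open>p_group_fixed_coset\<close> it grows strictly
  until it reaches \<open>V\<close>; \<open>M\<close> is the index where this happens.\<close>

lemma p_group_unipotent:
  fixes V :: "'v::ab_group_add set" and Q :: "('q, 'c) monoid_scheme"
  assumes Q: "group Q" "order Q = p ^ k" and p: "Factorial_Ring.prime p"
    and V: "finite V" "card V = p ^ N" "0 \<in> V" "\<And>u v. u \<in> V \<Longrightarrow> v \<in> V \<Longrightarrow> u - v \<in> V"
    and act_V: "\<And>g v. g \<in> carrier Q \<Longrightarrow> v \<in> V \<Longrightarrow> act g v \<in> V"
    and act_one: "\<And>v. v \<in> V \<Longrightarrow> act \<one>\<^bsub>Q\<^esub> v = v"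
    and act_mult: "\<And>g h v. g \<in> carrier Q \<Longrightarrow> h \<in> carrier Q \<Longrightarrow> v \<in> V \<Longrightarrow> act (g \<otimes>\<^bsub>Q\<^esub> h) v = act g (act h v)"
    and act_diff: "\<And>g u v. act g (u - v) = act g u - act g v"
  obtains M where "\<And>gs v. set gs \<subseteq> carrier Q \<Longrightarrow> M \<le> length gs \<Longrightarrow> v \<in> V \<Longrightarrow> difference_word act gs v = 0"
proof -
  interpret Q: group Q by (rule Q(1))
  define W where "W = rec_nat {0} (\<lambda>_ S. {v \<in> V. \<forall>g\<in>carrier Q. act g v - v \<in> S})"
  have W_0: "W 0 = {0}" and W_Suc: "W (Suc j) = {v \<in> V. \<forall>g\<in>carrier Q. act g v - v \<in> W j}" for j
    by (simp_all add: W_def)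
  have act_0: "act g 0 = 0" for g using act_diff[of g 0 0] by simp
  have W_V: "W j \<subseteq> V" for j by (cases j) (use V in \<open>auto simp: W_0 W_Suc\<close>)
  have W_zero: "0 \<in> W j" for j by (induction j) (use V in \<open>auto simp: W_0 W_Suc act_0\<close>)
  have W_diff: "u \<in> W j \<Longrightarrow> v \<in> W j \<Longrightarrow> u - v \<in> W j" for u v j
  proof (induction j arbitrary: u v)
    case (Suc j)
    have "act g (u - v) - (u - v) \<in> W j" if "g \<in> carrier Q" for g
    proof -
      have "(act g u - u) - (act g v - v) \<in> W j" using Suc that by (auto simp: W_Suc)
      then show ?thesis by (simp add: act_diff algebra_simps)
    qed
    then show ?case using Suc.prems V(4) by (auto simp: W_Suc)
  qed (simp add: W_0)
  have W_act: "g \<in> carrier Q \<Longrightarrow> v \<in> W j \<Longrightarrow> act g v \<in> W j" for g v j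
  proof (induction j arbitrary: g v)
    case (Suc j)
    have v: "v \<in> V" using Suc.prems W_V by blast
    have "act h (act g v) - act g v \<in> W j" if h: "h \<in> carrier Q" for h
    proof -
      \<comment> \<open>Conjugating \<open>h\<close> by \<open>g\<close> moves \<open>g\<close> to
        the front, so (h - 1) g = g (c - 1), and the induction hypothesis applies to
        \<open>g\<close>.\<close>
      let ?c = "inv\<^bsub>Q\<^esub> g \<otimes>\<^bsub>Q\<^esub> (h \<otimes>\<^bsub>Q\<^esub> g)"
      have c: "?c \<in> carrier Q" using h Suc.prems by simp
      have "act g (act ?c v) = act (g \<otimes>\<^bsub>Q\<^esub> ?c) v" using act_mult[OF Suc.prems(1) c v] by simp
      also have "g \<otimes>\<^bsub>Q\<^esub> ?c = h \<otimes>\<^bsub>Q\<^esub> g" using h Suc.prems(1) by (simp add: Q.m_assoc[symmetric])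
      also have "act (h \<otimes>\<^bsub>Q\<^esub> g) v = act h (act g v)" by (rule act_mult[OF h Suc.prems(1) v])
      finally have "act h (act g v) - act g v = act g (act ?c v - v)" by (simp add: act_diff)
      moreover have "act ?c v - v \<in> W j" using Suc.prems c by (auto simp: W_Suc)
      ultimately show ?thesis using Suc.IH Suc.prems(1) by auto
    qed
    then show ?case using act_V[OF Suc.prems(1) v] by (simp add: W_Suc)
  qed (simp add: W_0 act_0)
  have W_mono: "W j \<subseteq> W (Suc j)" for j
    using W_V W_act W_diff by (auto simp: W_Suc)
  have W_grow: "W j \<noteq> V \<Longrightarrow> card (W j) < card (W (Suc j))" for j
  proof -
    assume "W j \<noteq> V"
    then have "\<exists>v\<in>V - W j. \<forall>g\<in>carrier Q. act g v - v \<in> W j"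
      by (intro p_group_fixed_coset[OF Q p V(1,2,4) W_V _ W_zero W_diff act_V W_act act_one act_mult act_diff])
    then have "W j \<subset> W (Suc j)" using W_mono by (auto simp: W_Suc)
    then show ?thesis using finite_subset[OF W_V V(1)] by (intro psubset_card_mono)
  qed
  have "\<exists>M. W M = V"
  proof (rule ccontr)
    assume no: "\<nexists>M. W M = V"
    have "j \<le> card (W j)" for j
    proof (induction j)
      case (Suc j)
      then show ?case using W_grow[of j] no by (metis Suc_leI le_less_trans)
    qed simp
    moreover have "card (W j) \<le> card V" for j by (rule card_mono[OF V(1) W_V])
    ultimately show False by (metis Suc_n_not_le_n le_trans)
  qed
  then obtain M where M: "W M = V" by blast
  \<comment> \<open>Each factor g - 1 descends one level. Truncated subtraction keeps long words at
    level 0, which is the zero group.\<close>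
  have step: "set gs \<subseteq> carrier Q \<Longrightarrow> v \<in> V \<Longrightarrow> difference_word act gs v \<in> W (M - length gs)" for gs v
  proof (induction gs)
    case (Cons g gs)
    let ?d = "difference_word act gs v"
    have IH: "?d \<in> W (M - length gs)" and g: "g \<in> carrier Q" using Cons by auto
    show ?case
    proof (cases "M - length gs")
      case 0
      then show ?thesis using IH by (simp add: W_0 act_0)
    next
      case (Suc j)
      then have "M - length (g # gs) = j" by simp
      then show ?thesis using IH g Suc by (simp add: W_Suc)
    qed
  qed (simp add: M)
  show thesis
  proof (rule that)
    fix gs v assume "set gs \<subseteq> carrier Q" "M \<le> length gs" "v \<in> V"
    then show "difference_word act gs v = 0" using step[of gs v] by (simp add: W_0)
  qed
qed

text \<open>The regular representation: right translation of the argument gives a left action on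
  functions. The value 0 off the carrier makes a function determined by its values on the group, so
  that the space of functions is finite.\<close>

definition translate :: "('q, 'c) monoid_scheme \<Rightarrow> 'q \<Rightarrow> ('q \<Rightarrow> 'k::zero) \<Rightarrow> 'q \<Rightarrow> 'k" where
  "translate Q g v = (\<lambda>y. if y \<in> carrier Q then v (y \<otimes>\<^bsub>Q\<^esub> g) else 0)"

lemma translate_unipotent:
  fixes Q :: "('q, 'c) monoid_scheme"
  assumes Q: "group Q" "order Q = CARD('p::prime_card) ^ k"
  obtains M where "\<And>gs (v :: 'q \<Rightarrow> 'p mod_ring). set gs \<subseteq> carrier Q \<Longrightarrow> M \<le> length gs \<Longrightarrow>
    (\<And>y. y \<notin> carrier Q \<Longrightarrow> v y = 0) \<Longrightarrow> difference_word (translate Q) gs v = 0"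
proof -
  interpret Q: group Q by (rule Q(1))
  define V where "V = {v :: 'q \<Rightarrow> 'p mod_ring. \<forall>y. y \<notin> carrier Q \<longrightarrow> v y = 0}"
  have "order Q \<noteq> 0" using Q(2) by simp
  then have finQ: "finite (carrier Q)" unfolding order_def by (meson card.infinite)
  have bij: "bij_betw (\<lambda>v. restrict v (carrier Q)) V (carrier Q \<rightarrow>\<^sub>E (UNIV :: 'p mod_ring set))"
    by (rule bij_betwI[of _ _ _ "\<lambda>v y. if y \<in> carrier Q then v y else 0"])
      (auto simp: V_def fun_eq_iff PiE_def extensional_def)
  have cardV: "card V = CARD('p) ^ card (carrier Q)"
    using bij_betw_same_card[OF bij] by (simp add: card_PiE[OF finQ])
  have finV: "finite V"
    using bij_betw_finite[OF bij] finite_PiE[OF finQ, of "\<lambda>_. UNIV :: 'p mod_ring set"] by simp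
  have "\<exists>M. \<forall>gs v. set gs \<subseteq> carrier Q \<longrightarrow> M \<le> length gs \<longrightarrow> v \<in> V \<longrightarrow>
      difference_word (translate Q) gs v = 0"
  proof (rule p_group_unipotent[OF Q prime_card finV cardV, of "translate Q"])
    fix g u v
    show "translate Q g (u - v) = (translate Q g u - translate Q g v :: 'q \<Rightarrow> 'p mod_ring)"
      by (auto simp: translate_def fun_eq_iff)
  next
    fix g h and v :: "'q \<Rightarrow> 'p mod_ring" assume "g \<in> carrier Q" "h \<in> carrier Q"
    then show "translate Q (g \<otimes>\<^bsub>Q\<^esub> h) v = translate Q g (translate Q h v)"
      by (auto simp: translate_def fun_eq_iff Q.m_assoc)
  next
    fix M assume "\<And>gs v. set gs \<subseteq> carrier Q \<Longrightarrow> M \<le> length gs \<Longrightarrow> v \<in> V \<Longrightarrow>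
      difference_word (translate Q) gs v = 0"
    then show ?thesis by blast
  qed (auto simp: V_def translate_def fun_eq_iff)
  then obtain M where "\<And>gs v. set gs \<subseteq> carrier Q \<Longrightarrow> M \<le> length gs \<Longrightarrow> v \<in> V \<Longrightarrow>
      difference_word (translate Q) gs v = 0" by blast
  then show thesis using that[of M] by (simp add: V_def)
qed

section \<open>Rewriting modulo a relator with unbordered leading word\<close>

definition monomial :: "'i list \<Rightarrow> ('i, 'k::ring_1) ncps" where
  "monomial w = Abs_ncps (\<lambda>z. if z = w then 1 else 0)"

lemma ncps_nth_monomial: "ncps_nth (monomial w) z = (if z = w then 1 else 0)"
  by (simp add: monomial_def)

lemma monomial_Nil: "monomial [] = 1"
  by (rule ncps_eqI) (simp add: ncps_nth_monomial ncps_nth_one)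

lemma ncps_nth_monomial_mult:
  "ncps_nth (monomial u * f) w =
    (if length u \<le> length w \<and> take (length u) w = u then ncps_nth f (drop (length u) w) else 0)"
proof -
  have "ncps_nth (monomial u * f) w = (if length u \<le> length w then
      ncps_nth (monomial u) (take (length u) w) * ncps_nth f (drop (length u) w) else 0)"
    by (rule ncps_nth_mult_homogeneous) (simp add: ncps_nth_monomial split: if_splits)
  then show ?thesis by (auto simp: ncps_nth_monomial)
qed

lemma monomial_mult: "monomial u * monomial v = monomial (u @ v)"
proof (rule ncps_eqI)
  fix w
  show "ncps_nth (monomial u * monomial v) w = ncps_nth (monomial (u @ v)) w"
    unfolding ncps_nth_monomial_mult ncps_nth_monomial
    by (auto, metis append_take_drop_id)
qed

lemma ncps_const_commute:
  fixes f :: "('i, 'k::comm_ring_1) ncps"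
  shows "f * ncps_const c = ncps_const c * f"
proof (rule ncps_eqI)
  fix w
  have "ncps_nth (f * ncps_const c) w = (\<Sum>k\<le>length w. if k = length w then ncps_nth f w * c else 0)"
    unfolding ncps_nth_mult by (rule sum.cong) (auto simp: ncps_const_def)
  then show "ncps_nth (f * ncps_const c) w = ncps_nth (ncps_const c * f) w" by (simp add: mult.commute)
qed

lemma ncps_nth_const: "ncps_nth (ncps_const c) w = (if w = [] then c else 0)"
  by (simp add: ncps_const_def)

lemma ncps_const_mult: "ncps_const a * ncps_const b = (ncps_const (a * b) :: ('i, 'k::ring_1) ncps)"
  by (rule ncps_eqI) (simp add: ncps_nth_const)

lemma ncps_const_add: "ncps_const a + ncps_const b = (ncps_const (a + b) :: ('i, 'k::ring_1) ncps)"
  by (rule ncps_eqI) (simp add: ncps_const_def)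

lemma ncps_const_minus: "- ncps_const a = (ncps_const (- a) :: ('i, 'k::ring_1) ncps)"
  by (rule ncps_eqI) (simp add: ncps_const_def)

lemma ncps_const_0 [simp]: "ncps_const 0 = 0"
  by (rule ncps_eqI) (simp add: ncps_const_def)

lemma ncps_const_1 [simp]: "ncps_const 1 = 1"
  by (rule ncps_eqI) (simp add: ncps_const_def ncps_nth_one)

definition support :: "('i, 'k::zero) ncps \<Rightarrow> 'i list set" where
  "support f = {w. ncps_nth f w \<noteq> 0}"

lemma ncps_eq_sum_monomial:
  assumes "finite A" "support f \<subseteq> A"
  shows "f = (\<Sum>w\<in>A. ncps_const (ncps_nth f w) * monomial w)"
proof (rule ncps_eqI)
  fix z
  have "(\<Sum>w\<in>A. ncps_nth f w * (if z = w then 1 else 0)) = (\<Sum>w\<in>A. if z = w then ncps_nth f w else 0)"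
    by (rule sum.cong) auto
  then show "ncps_nth f z = ncps_nth (\<Sum>w\<in>A. ncps_const (ncps_nth f w) * monomial w) z"
    using assms by (auto simp: ncps_nth_sum ncps_nth_monomial support_def)
qed

lemma nc_poly_carrier: "carrier nc_poly_ring = {f. finite (support f)}"
  by (simp add: nc_poly_ring_def ncps_ring_def support_def)

lemma nc_poly_ops [simp]:
  "monoid.mult nc_poly_ring = (*)" "monoid.one nc_poly_ring = 1" "ring.zero nc_poly_ring = 0" "ring.add nc_poly_ring = (+)"
  by (simp_all add: nc_poly_ring_def ncps_ring_def)

lemma support_add: "support (f + g) \<subseteq> support f \<union> support (g :: ('i, 'k::ring_1) ncps)"
  by (auto simp: support_def)

lemma support_mult: "support (f * g) \<subseteq> (\<lambda>(u, v). u @ v) ` (support f \<times> support (g :: ('i, 'k::ring_1) ncps))"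
proof
  fix w assume "w \<in> support (f * g)"
  then obtain k where "ncps_nth f (take k w) * ncps_nth g (drop k w) \<noteq> 0"
    unfolding support_def ncps_nth_mult by (metis (mono_tags, lifting) mem_Collect_eq sum.neutral)
  then have "take k w \<in> support f" "drop k w \<in> support g" by (auto simp: support_def)
  then show "w \<in> (\<lambda>(u, v). u @ v) ` (support f \<times> support g)"
    by (metis (mono_tags, lifting) SigmaI append_take_drop_id case_prod_conv image_eqI)
qed

lemma support_monomial [simp]: "support (monomial w :: ('i, 'k::ring_1) ncps) = {w}"
  by (auto simp: support_def ncps_nth_monomial)

lemma support_zero [simp]: "support (0 :: ('i, 'k::ring_1) ncps) = {}"
  by (auto simp: support_def)

lemma support_uminus [simp]: "support (- f :: ('i, 'k::ring_1) ncps) = support f"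
  by (auto simp: support_def)

lemma support_const: "support (ncps_const c :: ('i, 'k::ring_1) ncps) \<subseteq> {[]}"
  by (auto simp: support_def ncps_const_def split: if_splits)

lemma nc_poly_closed [simp, intro]:
  fixes f g :: "('i, 'k::ring_1) ncps"
  shows "f \<in> carrier nc_poly_ring \<Longrightarrow> g \<in> carrier nc_poly_ring \<Longrightarrow> f + g \<in> carrier nc_poly_ring"
    "f \<in> carrier nc_poly_ring \<Longrightarrow> g \<in> carrier nc_poly_ring \<Longrightarrow> f * g \<in> carrier nc_poly_ring"
    "f \<in> carrier nc_poly_ring \<Longrightarrow> - f \<in> carrier nc_poly_ring"
    "monomial w \<in> carrier (nc_poly_ring :: ('i, 'k) ncps ring)"
    "(0 :: ('i, 'k) ncps) \<in> carrier nc_poly_ring" "(1 :: ('i, 'k) ncps) \<in> carrier nc_poly_ring"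
    "(ncps_const c :: ('i, 'k) ncps) \<in> carrier nc_poly_ring"
  using finite_subset[OF support_add[of f g]] finite_subset[OF support_mult[of f g]]
    finite_subset[OF support_const[of c]]
  by (auto simp: nc_poly_carrier simp flip: monomial_Nil)

lemma nc_poly_closed_diff [simp, intro]:
  fixes f g :: "('i, 'k::ring_1) ncps"
  shows "f \<in> carrier nc_poly_ring \<Longrightarrow> g \<in> carrier nc_poly_ring \<Longrightarrow> f - g \<in> carrier nc_poly_ring"
  by (metis diff_conv_add_uminus nc_poly_closed(1,3))

lemma nc_poly_closed_sum [intro]:
  fixes g :: "'b \<Rightarrow> ('i, 'k::ring_1) ncps"
  assumes "\<And>a. a \<in> A \<Longrightarrow> g a \<in> carrier nc_poly_ring"
  shows "(\<Sum>a\<in>A. g a) \<in> carrier nc_poly_ring"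
  using assms by (induction A rule: infinite_finite_induct) auto

lemma nc_poly_ring: "ring (nc_poly_ring :: ('i, 'k::ring_1) ncps ring)"
proof (rule ringI)
  show "abelian_group (nc_poly_ring :: ('i, 'k) ncps ring)"
    by (rule abelian_groupI) (auto simp: algebra_simps intro: bexI[of _ "- _"])
  show "monoid (nc_poly_ring :: ('i, 'k) ncps ring)"
    by (rule monoidI) (auto simp: mult.assoc)
qed (auto simp: algebra_simps)

interpretation nc_poly: ring "nc_poly_ring :: ('i, 'k::ring_1) ncps ring"
  by (rule nc_poly_ring)

lemma nc_poly_a_inv:
  fixes f :: "('i, 'k::ring_1) ncps"
  shows "f \<in> carrier nc_poly_ring \<Longrightarrow> a_inv nc_poly_ring f = - f"
  by (rule nc_poly.minus_equality) auto

lemma nc_poly_a_minus: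
  fixes f g :: "('i, 'k::ring_1) ncps"
  shows "g \<in> carrier nc_poly_ring \<Longrightarrow> a_minus nc_poly_ring f g = f - g"
  by (simp add: a_minus_def nc_poly_a_inv)

lemma nc_poly_ideal_closed:
  fixes I :: "('i, 'k::ring_1) ncps set"
  assumes "ideal I nc_poly_ring"
  shows "0 \<in> I" "f \<in> I \<Longrightarrow> g \<in> I \<Longrightarrow> f + g \<in> I" "f \<in> I \<Longrightarrow> g \<in> I \<Longrightarrow> f - g \<in> I"
    "f \<in> I \<Longrightarrow> g \<in> carrier nc_poly_ring \<Longrightarrow> g * f \<in> I" "f \<in> I \<Longrightarrow> g \<in> carrier nc_poly_ring \<Longrightarrow> f * g \<in> I"
proof -
  interpret ideal I nc_poly_ring by fact
  show "0 \<in> I" using a_subset zero_closed by simp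
  show *: "f \<in> I \<Longrightarrow> g \<in> I \<Longrightarrow> f + g \<in> I" for f g using a_closed by simp
  show l: "f \<in> I \<Longrightarrow> g \<in> carrier nc_poly_ring \<Longrightarrow> g * f \<in> I" for f g using I_l_closed[of f g] by simp
  show "f \<in> I \<Longrightarrow> g \<in> carrier nc_poly_ring \<Longrightarrow> f * g \<in> I" using I_r_closed[of f g] by simp
  show "f \<in> I \<Longrightarrow> g \<in> I \<Longrightarrow> f - g \<in> I"
    using *[of f "- 1 * g"] l[of g "- 1"] by simp
qed

lemma nc_poly_ideal_closed_sum:
  fixes g :: "'b \<Rightarrow> ('i, 'k::ring_1) ncps"
  assumes "ideal I nc_poly_ring" "\<And>a. a \<in> A \<Longrightarrow> g a \<in> I"
  shows "(\<Sum>a\<in>A. g a) \<in> I"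
  using assms(2) by (induction A rule: infinite_finite_induct) (auto intro: nc_poly_ideal_closed[OF assms(1)])

lemma nc_poly_idealI:
  fixes I :: "('i, 'k::ring_1) ncps set"
  assumes "I \<subseteq> carrier nc_poly_ring" "0 \<in> I" "\<And>f g. f \<in> I \<Longrightarrow> g \<in> I \<Longrightarrow> f + g \<in> I"
    "\<And>f. f \<in> I \<Longrightarrow> - f \<in> I"
    "\<And>f g. f \<in> I \<Longrightarrow> g \<in> carrier nc_poly_ring \<Longrightarrow> g * f \<in> I"
    "\<And>f g. f \<in> I \<Longrightarrow> g \<in> carrier nc_poly_ring \<Longrightarrow> f * g \<in> I"
  shows "ideal I nc_poly_ring"
proof (rule idealI[OF nc_poly_ring])
  interpret G: abelian_group "nc_poly_ring :: ('i, 'k) ncps ring" by (rule nc_poly.is_abelian_group)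
  show "subgroup I (add_monoid nc_poly_ring)"
  proof
    fix f assume "f \<in> I"
    then have "f \<in> carrier nc_poly_ring" using assms by auto
    then have "inv\<^bsub>add_monoid nc_poly_ring\<^esub> f = - f"
      using nc_poly_a_inv[of f] by (simp add: a_inv_def)
    then show "inv\<^bsub>add_monoid nc_poly_ring\<^esub> f \<in> I" using assms \<open>f \<in> I\<close> by auto
  qed (use assms in auto)
qed (use assms in auto)

lemma constants_subfield: "subfield (range ncps_const) (nc_poly_ring :: ('i, 'k::field) ncps ring)"
proof (rule nc_poly.subfieldI)
  show "subcring (range ncps_const) (nc_poly_ring :: ('i, 'k) ncps ring)"
  proof (rule nc_poly.subcringI)
    show "subring (range ncps_const) (nc_poly_ring :: ('i, 'k) ncps ring)"
    proof (rule nc_poly.subringI)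
      show "\<one>\<^bsub>nc_poly_ring\<^esub> \<in> range (ncps_const :: 'k \<Rightarrow> ('i, 'k) ncps)"
        using ncps_const_1 by (metis nc_poly_ops(2) rangeI)
    qed (auto simp: ncps_const_mult ncps_const_add ncps_const_minus nc_poly_a_inv)
  qed (auto simp: ncps_const_mult mult.commute)
  have eq_0: "ncps_const c = (0 :: ('i, 'k) ncps) \<longleftrightarrow> c = 0" for c
    by (auto simp: ncps_eq_iff ncps_nth_const)
  have unit: "\<exists>y\<in>range ncps_const. y * ncps_const c = (1 :: ('i, 'k) ncps) \<and> ncps_const c * y = 1"
    if "c \<noteq> 0" for c
    using that by (intro bexI[of _ "ncps_const (inverse c)"]) (simp_all add: ncps_const_mult)
  show "Units (nc_poly_ring\<lparr>carrier := range ncps_const\<rparr>) = range ncps_const - {\<zero>\<^bsub>nc_poly_ring :: ('i, 'k) ncps ring\<^esub>}"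
  proof (intro equalityI subsetI)
    fix f :: "('i, 'k) ncps"
    assume "f \<in> Units (nc_poly_ring\<lparr>carrier := range ncps_const\<rparr>)"
    then obtain g where "f \<in> range ncps_const" "g * f = 1" by (auto simp: Units_def)
    moreover then have "f \<noteq> 0" by (metis mult_zero_right zero_neq_one)
    ultimately show "f \<in> range ncps_const - {\<zero>\<^bsub>nc_poly_ring\<^esub>}" by simp
  next
    fix f :: "('i, 'k) ncps"
    assume f: "f \<in> range ncps_const - {\<zero>\<^bsub>nc_poly_ring\<^esub>}"
    then obtain c where "f = ncps_const c" "c \<noteq> 0" by (auto simp: eq_0)
    with unit[of c] f show "f \<in> Units (nc_poly_ring\<lparr>carrier := range ncps_const\<rparr>)"
      unfolding Units_def by simp
  qed
qed

lemma monomial_sandwich: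
  fixes f :: "('i, 'k::comm_ring_1) ncps"
  shows "monomial a * (ncps_const c * monomial y * f) * monomial b =
      ncps_const c * (monomial (a @ y) * f * monomial b)"
    and "monomial a * (f * (ncps_const c * monomial y)) * monomial b =
      ncps_const c * (monomial a * f * monomial (y @ b))"
    and "monomial a * (ncps_const c * monomial s) * monomial b =
      (ncps_const c * monomial (a @ s @ b) :: ('i, 'k) ncps)"
  by (simp_all only: mult.assoc[symmetric] monomial_mult[symmetric] ncps_const_commute[of "monomial a"]
      ncps_const_commute[of "monomial a * f"])

text \<open>The leading word is the least one, to match the description of least words of Lie
  polynomials. Length is compared first because \<open>\<rho>\<close> is homogeneous for
  \<open>\<tau>\<close> but possibly not for length.\<close>

locale leading_word =
  fixes key :: "'i::finite \<Rightarrow> 'o::linorder" and \<tau> :: "'i \<Rightarrow> nat" and n :: nat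
    and \<rho> :: "('i, 'k::field) ncps" and w :: "'i list"
  assumes inj_key: "inj key" and \<tau>_pos: "\<And>i. 0 < \<tau> i"
    and weight_eq: "\<And>s. ncps_nth \<rho> s \<noteq> 0 \<Longrightarrow> weight \<tau> s = n"
    and lead_nonzero: "ncps_nth \<rho> w \<noteq> 0"
    and least: "\<And>s. ncps_nth \<rho> s \<noteq> 0 \<Longrightarrow> s \<noteq> w \<Longrightarrow>
      length w < length s \<or> length w = length s \<and> map key w < map key s"
    and unbordered: "\<And>b x y. w = b @ x \<Longrightarrow> w = y @ b \<Longrightarrow> b \<noteq> [] \<Longrightarrow> b = w"
    and w_nonempty: "w \<noteq> []"
begin

text \<open>The second argument is the larger one. Unlike the plain lexicographic order on words,
  where prefixes come first, this order is preserved by concatenation on both sides.\<close>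

definition larger :: "'i list \<Rightarrow> 'i list \<Rightarrow> bool" where
  "larger u v \<longleftrightarrow> length u < length v \<or> length u = length v \<and> map key u < map key v"

lemma larger_append: "larger u v \<Longrightarrow> larger (a @ u @ b) (a @ v @ b)"
  unfolding larger_def
  by (auto simp: append_less_append intro: append_less_eq_length)

lemma larger_trans: "larger u v \<Longrightarrow> larger v z \<Longrightarrow> larger u z"
  unfolding larger_def by auto

lemma larger_irrefl: "\<not> larger u u"
  unfolding larger_def by auto

lemma weight_append: "weight \<tau> (u @ v) = weight \<tau> u + weight \<tau> v"
  by (simp add: weight_def)

lemma length_le_weight: "length z \<le> weight \<tau> z"
proof (induction z)
  case (Cons i z)
  then show ?case using \<tau>_pos[of i] by (simp add: weight_def)
qed (simp add: weight_def)

lemma finite_weight: "finite {z. weight \<tau> z = m}"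
proof (rule finite_subset)
  show "{z. weight \<tau> z = m} \<subseteq> {z. set z \<subseteq> UNIV \<and> length z \<le> m}" using length_le_weight by auto
qed (rule finite_lists_length_le, simp)

lemma finite_support: "finite (support \<rho>)"
  by (rule finite_subset[OF _ finite_weight[of n]]) (use weight_eq in \<open>auto simp: support_def\<close>)

lemma rho_carrier: "\<rho> \<in> carrier nc_poly_ring"
  using finite_support by (simp add: nc_poly_carrier)

text \<open>Rewriting enlarges words at constant weight, so counting the words still above gives a
  termination measure; it is finite since all letters have positive weight.\<close>

definition rank :: "'i list \<Rightarrow> nat" where
  "rank z = card {y. weight \<tau> y = weight \<tau> z \<and> larger z y}"

lemma rank_less:
  assumes "larger z y" "weight \<tau> y = weight \<tau> z"
  shows "rank y < rank z"
  unfolding rank_def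
proof (rule psubset_card_mono)
  show "finite {y. weight \<tau> y = weight \<tau> z \<and> larger z y}"
    by (rule finite_subset[OF _ finite_weight]) auto
  have "{y'. weight \<tau> y' = weight \<tau> y \<and> larger y y'} \<subseteq> {y. weight \<tau> y = weight \<tau> z \<and> larger z y}"
    unfolding assms(2) using larger_trans[OF assms(1)] by blast
  moreover have "y \<in> {y. weight \<tau> y = weight \<tau> z \<and> larger z y}"
    "y \<notin> {y'. weight \<tau> y' = weight \<tau> y \<and> larger y y'}"
    using assms larger_irrefl by simp_all
  ultimately show "{y'. weight \<tau> y' = weight \<tau> y \<and> larger y y'} \<subset> {y. weight \<tau> y = weight \<tau> z \<and> larger z y}"
    by blast
qed

definition tail :: "'i list set" where
  "tail = support \<rho> - {w}"

text \<open>The relation \<open>\<rho> = 0\<close> solved for its leading word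
  \<open>w\<close>.\<close>

definition red_coeff :: "'i list \<Rightarrow> 'k" where
  "red_coeff s = - ncps_nth \<rho> s / ncps_nth \<rho> w"

lemma tail_larger:
  assumes "s \<in> tail"
  shows "larger w s" "weight \<tau> s = weight \<tau> w"
  using assms least[of s] weight_eq[of s] weight_eq[OF lead_nonzero]
  by (auto simp: tail_def support_def larger_def)

lemma finite_tail: "finite tail"
  using finite_support by (simp add: tail_def)

lemma rank_tail:
  assumes "s \<in> tail"
  shows "rank (a @ s @ b) < rank (a @ w @ b)"
  by (rule rank_less) (simp_all add: tail_larger[OF assms] larger_append weight_append)

text \<open>An overlap of two distinct occurrences would be a suffix of the first and a prefix of
  the second, hence a proper border of \<open>w\<close>.\<close>

lemma nonoverlap:
  assumes "a @ w @ b = a' @ w @ b'" "length a < length a'"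
  obtains c where "a' = a @ w @ c" "b = c @ w @ b'"
proof -
  have split: "\<exists>e. q = p @ e" if "p @ x = q @ y" "length p \<le> length q" for p q x y :: "'i list"
    using that by (metis append_eq_append_conv_if append_take_drop_id)
  obtain d where d: "a' = a @ d" using split[OF assms(1)] assms(2) by auto
  then have eq: "w @ b = d @ w @ b'" and "d \<noteq> []" using assms by auto
  show thesis
  proof (cases "length d < length w")
    case True
    then obtain e where e: "w = d @ e" using split[OF eq[symmetric]] by auto
    then have "e \<noteq> []" using True by auto
    have "d @ (e @ b) = d @ (w @ b')" using eq e by (metis append.assoc)
    then have "e @ b = w @ b'" by simp
    moreover have "length e \<le> length w" using e by simp
    ultimately obtain f where "w = e @ f" using split by blast
    from unbordered[OF this e \<open>e \<noteq> []\<close>] have "length e = length w" by simp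
    then show ?thesis using e \<open>d \<noteq> []\<close> by simp
  next
    case False
    then obtain c where c: "d = w @ c" using split[OF eq] by auto
    then have "b = c @ w @ b'" using eq by simp
    with c show ?thesis using that d by simp
  qed
qed

section \<open>Confluent rewriting and normal forms\<close>

definition normal_word :: "'i list \<Rightarrow> bool" where
  "normal_word z \<longleftrightarrow> \<not> (\<exists>a b. z = a @ w @ b)"

text \<open>An arbitrary choice, made only to define \<open>nf\<close>; \<open>nf_occurrence\<close>
  shows that the result is independent of it.\<close>

definition occurrence :: "'i list \<Rightarrow> 'i list \<times> 'i list" where
  "occurrence z = (SOME p. z = fst p @ w @ snd p)"

lemma occurrence:
  assumes "\<not> normal_word z"
  shows "z = fst (occurrence z) @ w @ snd (occurrence z)"
  unfolding occurrence_def
proof (rule someI_ex)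
  obtain a b where "z = a @ w @ b" using assms by (auto simp: normal_word_def)
  then show "\<exists>p. z = fst p @ w @ snd p" by (intro exI[of _ "(a, b)"]) simp
qed

function nf :: "'i list \<Rightarrow> ('i, 'k) ncps" where
  "nf z = (if normal_word z then monomial z
     else \<Sum>s\<in>tail. ncps_const (red_coeff s) * nf (fst (occurrence z) @ s @ snd (occurrence z)))"
  by auto
termination
proof (relation "Wellfounded.measure rank")
  fix z s assume "\<not> normal_word z" "s \<in> tail"
  then show "(fst (occurrence z) @ s @ snd (occurrence z), z) \<in> Wellfounded.measure rank"
    using rank_tail[of s "fst (occurrence z)" "snd (occurrence z)"] occurrence[of z] by simp
qed simp

declare nf.simps [simp del]

lemma nf_normal: "normal_word z \<Longrightarrow> nf z = monomial z"
  by (subst nf.simps) simp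

text \<open>Since \<open>w\<close> does not overlap itself, the reductions at two occurrences of \<open>w\<close> commute.\<close>

lemma nf_occurrence: "nf (a @ w @ b) = (\<Sum>s\<in>tail. ncps_const (red_coeff s) * nf (a @ s @ b))"
proof (induction "rank (a @ w @ b)" arbitrary: a b rule: less_induct)
  case less
  have comm: "(\<Sum>s\<in>tail. ncps_const (red_coeff s) * nf (a1 @ s @ b1)) =
      (\<Sum>s\<in>tail. ncps_const (red_coeff s) * nf (a2 @ s @ b2))"
    if eq: "a @ w @ b = a1 @ w @ b1" "a @ w @ b = a2 @ w @ b2" and len: "length a1 < length a2"
    for a1 b1 a2 b2
  proof -
    obtain c where c: "a2 = a1 @ w @ c" "b1 = c @ w @ b2"
      using nonoverlap[of a1 b1 a2 b2] eq len by metis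
    \<comment> \<open>The right occurrence survives when the left one is rewritten, and the new word
      has smaller rank, so the induction hypothesis rewrites it too. Fact \<open>2\<close> does this
      in the other order and reaches the same double sum.\<close>
    have 1: "nf (a1 @ s @ b1) = (\<Sum>t\<in>tail. ncps_const (red_coeff t) * nf (a1 @ s @ c @ t @ b2))"
      if "s \<in> tail" for s
      using less(1)[of "a1 @ s @ c" b2] rank_tail[OF that, of a1 b1] eq c by simp
    have 2: "nf (a2 @ t @ b2) = (\<Sum>s\<in>tail. ncps_const (red_coeff s) * nf (a1 @ s @ c @ t @ b2))"
      if "t \<in> tail" for t
      using less(1)[of a1 "c @ t @ b2"] rank_tail[OF that, of a2 b2] eq c by simp
    have "(\<Sum>s\<in>tail. ncps_const (red_coeff s) * nf (a1 @ s @ b1)) =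
       (\<Sum>s\<in>tail. \<Sum>t\<in>tail. ncps_const (red_coeff s) * (ncps_const (red_coeff t) * nf (a1 @ s @ c @ t @ b2)))"
      by (rule sum.cong) (simp_all add: 1 sum_distrib_left)
    also have "\<dots> = (\<Sum>t\<in>tail. \<Sum>s\<in>tail. ncps_const (red_coeff t) * (ncps_const (red_coeff s) * nf (a1 @ s @ c @ t @ b2)))"
      by (subst sum.swap) (simp add: mult.assoc[symmetric] ncps_const_mult mult.commute)
    also have "\<dots> = (\<Sum>t\<in>tail. ncps_const (red_coeff t) * nf (a2 @ t @ b2))"
      by (rule sum.cong) (simp_all add: 2 sum_distrib_left)
    finally show ?thesis .
  qed
  have nn: "\<not> normal_word (a @ w @ b)" by (auto simp: normal_word_def)
  define a' b' where "a' = fst (occurrence (a @ w @ b))" and "b' = snd (occurrence (a @ w @ b))"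
  have occ: "a @ w @ b = a' @ w @ b'" using occurrence[OF nn] by (simp add: a'_def b'_def)
  have "nf (a @ w @ b) = (\<Sum>s\<in>tail. ncps_const (red_coeff s) * nf (a' @ s @ b'))"
    using nn by (subst nf.simps) (simp add: a'_def b'_def)
  also have "\<dots> = (\<Sum>s\<in>tail. ncps_const (red_coeff s) * nf (a @ s @ b))"
    using comm[of a b a' b'] comm[of a' b' a b] occ by (cases "length a" "length a'" rule: linorder_cases) auto
  finally show ?case .
qed

lemma nf_support: "y \<in> support (nf z) \<Longrightarrow> normal_word y \<and> weight \<tau> y = weight \<tau> z"
proof (induction "rank z" arbitrary: z rule: less_induct)
  case less
  show ?case
  proof (cases "normal_word z")
    case True
    then show ?thesis using less.prems by (simp add: nf_normal)
  next
    case False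
    then obtain a b where z: "z = a @ w @ b" by (auto simp: normal_word_def)
    from less.prems obtain s where s: "s \<in> tail" "y \<in> support (nf (a @ s @ b))"
      unfolding z nf_occurrence support_def
      by (auto simp: ncps_nth_sum) (metis (mono_tags, lifting) mult_zero_right sum.neutral)
    show ?thesis
      using less.hyps[of "a @ s @ b"] rank_tail[OF s(1), of a b] s(2) z tail_larger(2)[OF s(1)]
      by (simp add: weight_append)
  qed
qed

abbreviation relator_ideal :: "('i, 'k) ncps set" where
  "relator_ideal \<equiv> Idl\<^bsub>nc_poly_ring\<^esub> {\<rho>}"

lemma relator_ideal: "ideal relator_ideal nc_poly_ring"
  by (rule nc_poly.genideal_ideal) (use rho_carrier in auto)

lemma rho_in_ideal: "\<rho> \<in> relator_ideal"
  by (rule nc_poly.genideal_self') (rule rho_carrier)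

lemma rho_sandwich:
  "monomial a * \<rho> * monomial b = ncps_const (ncps_nth \<rho> w) *
     (monomial (a @ w @ b) - (\<Sum>s\<in>tail. ncps_const (red_coeff s) * monomial (a @ s @ b)))"
proof -
  have "\<rho> = (\<Sum>s\<in>insert w tail. ncps_const (ncps_nth \<rho> s) * monomial s)"
    by (rule ncps_eq_sum_monomial) (auto simp: finite_tail, auto simp: tail_def)
  also have "\<dots> = ncps_const (ncps_nth \<rho> w) * monomial w + (\<Sum>s\<in>tail. ncps_const (ncps_nth \<rho> s) * monomial s)"
    by (subst sum.insert) (simp_all add: finite_tail, simp add: tail_def)
  finally have "monomial a * \<rho> * monomial b = 
     monomial a * (ncps_const (ncps_nth \<rho> w) * monomial w + (\<Sum>s\<in>tail. ncps_const (ncps_nth \<rho> s) * monomial s)) * monomial b"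
    by simp
  also have "\<dots> = ncps_const (ncps_nth \<rho> w) * monomial (a @ w @ b) +
      (\<Sum>s\<in>tail. ncps_const (ncps_nth \<rho> s) * monomial (a @ s @ b))"
  proof -
    show ?thesis by (simp add: distrib_left distrib_right sum_distrib_left sum_distrib_right monomial_sandwich)
  qed
  also have "\<dots> = ncps_const (ncps_nth \<rho> w) *
     (monomial (a @ w @ b) - (\<Sum>s\<in>tail. ncps_const (red_coeff s) * monomial (a @ s @ b)))"
  proof -
    have "ncps_const (ncps_nth \<rho> w) * (ncps_const (red_coeff s) * f) = - (ncps_const (ncps_nth \<rho> s) * f)"
      for s and f :: "('i, 'k) ncps"
      using lead_nonzero
      by (simp add: mult.assoc[symmetric] ncps_const_mult red_coeff_def ncps_const_minus[symmetric])
    then show ?thesis by (simp add: right_diff_distrib sum_distrib_left sum_negf)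
  qed
  finally show ?thesis .
qed

lemma monomial_minus_nf_in_ideal: "monomial z - nf z \<in> relator_ideal"
proof (induction "rank z" arbitrary: z rule: less_induct)
  case less
  note I = nc_poly_ideal_closed[OF relator_ideal]
  show ?case
  proof (cases "normal_word z")
    case True
    then show ?thesis using I(1) by (simp add: nf_normal)
  next
    case False
    then obtain a b where z: "z = a @ w @ b" by (auto simp: normal_word_def)
    let ?D = "monomial (a @ w @ b) - (\<Sum>s\<in>tail. ncps_const (red_coeff s) * monomial (a @ s @ b)) :: ('i, 'k) ncps"
    have "?D = ncps_const (inverse (ncps_nth \<rho> w)) * (ncps_const (ncps_nth \<rho> w) * ?D)"
      using lead_nonzero by (simp add: mult.assoc[symmetric] ncps_const_mult)
    also have "\<dots> = ncps_const (inverse (ncps_nth \<rho> w)) * (monomial a * \<rho> * monomial b)"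
      unfolding rho_sandwich ..
    also have "\<dots> \<in> relator_ideal"
      by (intro I rho_in_ideal) auto
    finally have D: "?D \<in> relator_ideal" .
    have "(\<Sum>s\<in>tail. ncps_const (red_coeff s) * (monomial (a @ s @ b) - nf (a @ s @ b))) \<in> relator_ideal"
      by (intro nc_poly_ideal_closed_sum[OF relator_ideal] I(4) less.hyps) (use rank_tail z in auto)
    with D have "?D + (\<Sum>s\<in>tail. ncps_const (red_coeff s) * (monomial (a @ s @ b) - nf (a @ s @ b))) \<in> relator_ideal"
      by (rule I(2))
    then show ?thesis unfolding z nf_occurrence
      by (simp add: right_diff_distrib sum_subtractf)
  qed
qed

definition nf_poly :: "('i, 'k) ncps \<Rightarrow> ('i, 'k) ncps" where
  "nf_poly f = (\<Sum>z\<in>support f. ncps_const (ncps_nth f z) * nf z)"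

lemma nf_poly_eq:
  assumes "finite A" "support f \<subseteq> A"
  shows "nf_poly f = (\<Sum>z\<in>A. ncps_const (ncps_nth f z) * nf z)"
  unfolding nf_poly_def by (rule sum.mono_neutral_left) (use assms in \<open>auto simp: support_def\<close>)

lemma nf_poly_add:
  assumes "f \<in> carrier nc_poly_ring" "g \<in> carrier nc_poly_ring"
  shows "nf_poly (f + g) = nf_poly f + nf_poly g"
proof -
  have "finite (support f \<union> support g)" using assms by (simp add: nc_poly_carrier)
  then show ?thesis
    using nf_poly_eq[of "support f \<union> support g"] support_add[of f g]
    by (simp add: ncps_const_add[symmetric] distrib_right sum.distrib)
qed

lemma nf_poly_scale:
  assumes "f \<in> carrier nc_poly_ring"
  shows "nf_poly (ncps_const c * f) = ncps_const c * nf_poly f"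
proof -
  have "finite (support f)" using assms by (simp add: nc_poly_carrier)
  moreover have "support (ncps_const c * f) \<subseteq> support f" by (auto simp: support_def)
  ultimately show ?thesis
    using nf_poly_eq[of "support f"]
    by (simp add: ncps_const_mult[symmetric] sum_distrib_left mult.assoc)
qed

lemma nf_poly_zero [simp]: "nf_poly 0 = 0"
  by (simp add: nf_poly_def)

lemma nf_poly_uminus:
  assumes "f \<in> carrier nc_poly_ring"
  shows "nf_poly (- f) = - nf_poly f"
proof -
  have "nf_poly (- f) + nf_poly f = nf_poly (- f + f)"
    by (rule nf_poly_add[symmetric]) (use assms in auto)
  then show ?thesis by (simp add: eq_neg_iff_add_eq_0)
qed

lemma nf_poly_sum:
  assumes "\<And>a. a \<in> A \<Longrightarrow> g a \<in> carrier nc_poly_ring"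
  shows "nf_poly (\<Sum>a\<in>A. g a) = (\<Sum>a\<in>A. nf_poly (g a))"
  using assms by (induction A rule: infinite_finite_induct) (auto simp: nf_poly_add nc_poly_closed_sum)

lemma nf_poly_monomial: "nf_poly (monomial z) = nf z"
  by (simp add: nf_poly_def ncps_nth_monomial)

lemma nf_poly_normal:
  assumes "f \<in> carrier nc_poly_ring" "\<And>z. z \<in> support f \<Longrightarrow> normal_word z"
  shows "nf_poly f = f"
proof -
  have "finite (support f)" using assms by (simp add: nc_poly_carrier)
  then have "f = (\<Sum>z\<in>support f. ncps_const (ncps_nth f z) * monomial z)" by (rule ncps_eq_sum_monomial) simp
  then show ?thesis unfolding nf_poly_def using assms(2) by (simp add: nf_normal)
qed

text \<open>The polynomials killed by \<open>nf_poly\<close> after multiplication by arbitrary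
  monomials on both sides form a two-sided ideal by construction. It contains \<open>\<rho>\<close>
  by \<open>nf_occurrence\<close>, hence the whole relator ideal.\<close>

lemma nf_poly_ideal:
  assumes "f \<in> relator_ideal"
  shows "nf_poly f = 0"
proof -
  let ?Z = "{f \<in> carrier nc_poly_ring. \<forall>a b. nf_poly (monomial a * f * monomial b) = 0}"
  have "ideal ?Z nc_poly_ring"
  proof (rule nc_poly_idealI)
    fix f g :: "('i, 'k) ncps" assume f: "f \<in> ?Z" and g: "g \<in> carrier nc_poly_ring"
    have fin: "finite (support g)" using g by (simp add: nc_poly_carrier)
    then have gs: "g = (\<Sum>y\<in>support g. ncps_const (ncps_nth g y) * monomial y)" by (rule ncps_eq_sum_monomial) simp
    have "nf_poly (monomial a * (g * f) * monomial b) = 0" for a b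
    proof -
      have "monomial a * (g * f) * monomial b =
        (\<Sum>y\<in>support g. ncps_const (ncps_nth g y) * (monomial (a @ y) * f * monomial b))"
        by (subst gs) (simp add: sum_distrib_left sum_distrib_right monomial_sandwich)
      then show ?thesis using f by (auto simp: nf_poly_sum nf_poly_scale)
    qed
    then show "g * f \<in> ?Z" using f g by auto
    have "nf_poly (monomial a * (f * g) * monomial b) = 0" for a b
    proof -
      have "monomial a * (f * g) * monomial b =
        (\<Sum>y\<in>support g. ncps_const (ncps_nth g y) * (monomial a * f * monomial (y @ b)))"
        by (subst gs) (simp add: sum_distrib_left sum_distrib_right monomial_sandwich)
      then show ?thesis using f by (auto simp: nf_poly_sum nf_poly_scale)
    qed
    then show "f * g \<in> ?Z" using f g by auto
  next
    fix f g assume "f \<in> ?Z" "g \<in> ?Z"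
    then show "f + g \<in> ?Z" by (auto simp: distrib_left distrib_right nf_poly_add)
  next
    fix f assume "f \<in> ?Z"
    then show "- f \<in> ?Z" by (auto simp: nf_poly_uminus)
  qed auto
  moreover have "\<rho> \<in> ?Z"
  proof -
    have "nf_poly (monomial a * \<rho> * monomial b) = 0" for a b
    proof -
      have s: "nf_poly (\<Sum>s\<in>tail. ncps_const (red_coeff s) * monomial (a @ s @ b)) = nf (a @ w @ b)"
        unfolding nf_occurrence by (subst nf_poly_sum) (auto simp: nf_poly_scale nf_poly_monomial)
      have c: "(\<Sum>s\<in>tail. ncps_const (red_coeff s) * monomial (a @ s @ b)) \<in> carrier (nc_poly_ring :: ('i, 'k) ncps ring)"
        by (intro nc_poly_closed_sum nc_poly_closed)
      have "nf_poly (monomial (a @ w @ b) + - (\<Sum>s\<in>tail. ncps_const (red_coeff s) * monomial (a @ s @ b))) = 0"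
        by (subst nf_poly_add[OF nc_poly_closed(4) nc_poly_closed(3)[OF c]])
          (simp only: nf_poly_uminus[OF c] s nf_poly_monomial add.right_inverse)
      then show ?thesis unfolding rho_sandwich
        by (subst nf_poly_scale) auto
    qed
    then show ?thesis using rho_carrier by auto
  qed
  ultimately have "relator_ideal \<subseteq> ?Z" by (intro nc_poly.genideal_minimal) auto
  then have "nf_poly (monomial [] * f * monomial []) = 0" using assms by blast
  then show ?thesis by (simp add: monomial_Nil)
qed

lemma minus_nf_poly_in_ideal:
  assumes "f \<in> carrier nc_poly_ring"
  shows "f - nf_poly f \<in> relator_ideal"
proof -
  have fin: "finite (support f)" using assms by (simp add: nc_poly_carrier)
  have "f - nf_poly f = (\<Sum>z\<in>support f. ncps_const (ncps_nth f z) * (monomial z - nf z))"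
    unfolding nf_poly_def right_diff_distrib sum_subtractf
    using ncps_eq_sum_monomial[OF fin order_refl] by simp
  also have "\<dots> \<in> relator_ideal"
    by (intro nc_poly_ideal_closed_sum nc_poly_ideal_closed relator_ideal monomial_minus_nf_in_ideal) auto
  finally show ?thesis .
qed

section \<open>The quotient algebra and its basis of normal words\<close>

abbreviation quot_ring :: "('i, 'k) ncps set ring" where
  "quot_ring \<equiv> one_relator_algebra \<rho>"

lemma quot_ring: "ring quot_ring"
  unfolding one_relator_algebra_def by (rule ideal.quotient_is_ring[OF relator_ideal])

lemma proj_hom: "ring_hom_ring nc_poly_ring quot_ring (relator_proj \<rho>)"
proof -
  have "ring_hom_ring nc_poly_ring quot_ring ((+>\<^bsub>nc_poly_ring\<^esub>) relator_ideal)"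
    unfolding one_relator_algebra_def by (rule ideal.rcos_ring_hom_ring[OF relator_ideal])
  moreover have "(+>\<^bsub>nc_poly_ring\<^esub>) relator_ideal = relator_proj \<rho>"
    by (rule ext) (simp add: relator_proj_def)
  ultimately show ?thesis by simp
qed

lemma proj_eq_iff:
  assumes "f \<in> carrier nc_poly_ring" "g \<in> carrier nc_poly_ring"
  shows "relator_proj \<rho> f = relator_proj \<rho> g \<longleftrightarrow> f - g \<in> relator_ideal"
  using nc_poly.quotient_eq_iff_same_a_r_cos[OF relator_ideal assms] assms(2)
  by (simp add: relator_proj_def nc_poly_a_minus)

lemma proj_normal_inj:
  assumes "f \<in> carrier nc_poly_ring" "g \<in> carrier nc_poly_ring"
    and "\<And>z. z \<in> support f \<union> support g \<Longrightarrow> normal_word z"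
    and "relator_proj \<rho> f = relator_proj \<rho> g"
  shows "f = g"
proof -
  have "f - g \<in> relator_ideal" using assms proj_eq_iff by blast
  then have "nf_poly (f - g) = 0" by (rule nf_poly_ideal)
  moreover have "support (f - g) \<subseteq> support f \<union> support g" by (auto simp: support_def)
  then have "nf_poly (f - g) = f - g" by (intro nf_poly_normal) (use assms(1-3) in blast)+
  ultimately show ?thesis by simp
qed

abbreviation scalars :: "('i, 'k) ncps set set" where
  "scalars \<equiv> relator_proj \<rho> ` range ncps_const"

lemma scalars_subfield: "subfield scalars quot_ring"
proof (rule ring_hom_ring.img_is_subfield(2)[OF proj_hom constants_subfield])
  interpret H: ring_hom_ring nc_poly_ring quot_ring "relator_proj \<rho>" by (rule proj_hom)
  have one: "relator_proj \<rho> 1 = \<one>\<^bsub>quot_ring\<^esub>" and zero: "relator_proj \<rho> 0 = \<zero>\<^bsub>quot_ring\<^esub>"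
    using H.hom_one H.hom_zero by simp_all
  \<comment> \<open>The quotient is not the zero ring because the empty word is normal.\<close>
  have "relator_proj \<rho> 1 \<noteq> relator_proj \<rho> 0"
  proof
    assume "relator_proj \<rho> 1 = relator_proj \<rho> 0"
    then have "(1 :: ('i, 'k) ncps) = 0"
      by (rule proj_normal_inj[rotated 3])
        (use w_nonempty in \<open>auto simp: monomial_Nil[symmetric] normal_word_def\<close>)
    then show False by simp
  qed
  then show "\<one>\<^bsub>quot_ring\<^esub> \<noteq> \<zero>\<^bsub>quot_ring\<^esub>" using one zero by simp
qed

text \<open>Images of normal words are linearly independent by \<open>proj_normal_inj\<close>, so
  each further word is a proper extension by one dimension.\<close>

lemma dimension_normal_span:
  assumes "finite S" "\<And>z. z \<in> S \<Longrightarrow> normal_word z"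
  shows "ring.dimension quot_ring (card S) scalars (relator_proj \<rho> ` {f. support f \<subseteq> S})"
  using assms
proof (induction S rule: finite_induct)
  case empty
  interpret Q: ring quot_ring by (rule quot_ring)
  interpret H: ring_hom_ring nc_poly_ring quot_ring "relator_proj \<rho>" by (rule proj_hom)
  have "{f :: ('i, 'k) ncps. support f \<subseteq> {}} = {0}" by (auto simp: support_def ncps_eq_iff)
  moreover have "relator_proj \<rho> 0 = \<zero>\<^bsub>quot_ring\<^esub>"
    using H.hom_zero by simp
  ultimately show ?case using Q.zero_dim[of scalars] by simp
next
  case (insert z S)
  interpret Q: ring quot_ring by (rule quot_ring)
  interpret H: ring_hom_ring nc_poly_ring quot_ring "relator_proj \<rho>" by (rule proj_hom)
  have carr: "f \<in> carrier nc_poly_ring" if "support f \<subseteq> insert z S" for f :: "('i, 'k) ncps"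
    using finite_subset[OF that] insert.hyps(1) by (simp add: nc_poly_carrier)
  have "Q.dimension (Suc (card S)) scalars
     (Q.line_extension scalars (relator_proj \<rho> (monomial z)) (relator_proj \<rho> ` {f. support f \<subseteq> S}))"
  proof (rule Q.Suc_dim)
    show "relator_proj \<rho> (monomial z) \<in> carrier quot_ring" by (rule H.hom_closed) auto
    show "relator_proj \<rho> (monomial z) \<notin> relator_proj \<rho> ` {f. support f \<subseteq> S}"
    proof
      assume "relator_proj \<rho> (monomial z) \<in> relator_proj \<rho> ` {f. support f \<subseteq> S}"
      then obtain f where f: "relator_proj \<rho> (monomial z) = relator_proj \<rho> f" "support f \<subseteq> S" by auto
      have fc: "f \<in> carrier nc_poly_ring" using carr[of f] f(2) by blast
      have "normal_word y" if "y \<in> support (monomial z :: ('i, 'k) ncps) \<union> support f" for y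
        using that f(2) insert.prems by auto
      then have "monomial z = f" by (rule proj_normal_inj[OF nc_poly_closed(4) fc _ f(1)])
      then show False using f(2) insert.hyps(2) by auto
    qed
    show "Q.dimension (card S) scalars (relator_proj \<rho> ` {f. support f \<subseteq> S})"
      by (rule insert.IH) (use insert.prems in auto)
  qed
  moreover have "Q.line_extension scalars (relator_proj \<rho> (monomial z)) (relator_proj \<rho> ` {f. support f \<subseteq> S}) =
     relator_proj \<rho> ` {f. support f \<subseteq> insert z S}"
  proof (intro equalityI subsetI)
    fix u assume "u \<in> Q.line_extension scalars (relator_proj \<rho> (monomial z)) (relator_proj \<rho> ` {f. support f \<subseteq> S})"
    then obtain c f where cf: "support f \<subseteq> S"
      "u = relator_proj \<rho> (ncps_const c) \<otimes>\<^bsub>quot_ring\<^esub> relator_proj \<rho> (monomial z) \<oplus>\<^bsub>quot_ring\<^esub> relator_proj \<rho> f"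
      unfolding Q.line_extension_mem_iff by auto
    have "f \<in> carrier nc_poly_ring" using carr[of f] cf by auto
    then have "u = relator_proj \<rho> (ncps_const c * monomial z + f)"
      unfolding cf(2) using H.hom_mult[of "ncps_const c" "monomial z"] H.hom_add[of "ncps_const c * monomial z" f] by simp
    moreover have "support (ncps_const c * monomial z + f) \<subseteq> insert z S"
      using cf(1) by (auto simp: support_def ncps_nth_monomial split: if_splits)
    ultimately show "u \<in> relator_proj \<rho> ` {f. support f \<subseteq> insert z S}" by auto
  next
    fix u assume "u \<in> relator_proj \<rho> ` {f. support f \<subseteq> insert z S}"
    then obtain f where f: "support f \<subseteq> insert z S" "u = relator_proj \<rho> f" by auto
    let ?g = "f - ncps_const (ncps_nth f z) * monomial z"
    have g: "support ?g \<subseteq> S" using f(1) by (auto simp: support_def ncps_nth_monomial split: if_splits)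
    have gc: "?g \<in> carrier nc_poly_ring" using carr[of ?g] g by auto
    have "u = relator_proj \<rho> (ncps_const (ncps_nth f z) * monomial z + ?g)" using f(2) by simp
    also have "\<dots> = relator_proj \<rho> (ncps_const (ncps_nth f z)) \<otimes>\<^bsub>quot_ring\<^esub> relator_proj \<rho> (monomial z) \<oplus>\<^bsub>quot_ring\<^esub> relator_proj \<rho> ?g"
      using H.hom_mult[of "ncps_const (ncps_nth f z)" "monomial z"] H.hom_add[of "ncps_const (ncps_nth f z) * monomial z" ?g] gc
      by simp
    finally show "u \<in> Q.line_extension scalars (relator_proj \<rho> (monomial z)) (relator_proj \<rho> ` {f. support f \<subseteq> S})"
      unfolding Q.line_extension_mem_iff using g by blast
  qed
  ultimately show ?case using insert.hyps by simp
qed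

section \<open>Counting normal words by weight\<close>

definition normal_words :: "nat \<Rightarrow> 'i list set" where
  "normal_words m = {z. normal_word z \<and> weight \<tau> z = m}"

lemma finite_normal_words: "finite (normal_words m)"
  by (rule finite_subset[OF _ finite_weight[of m]]) (auto simp: normal_words_def)

text \<open>Passing to normal forms preserves both the class modulo the ideal and the weight, since
  rewriting stays within one weight.\<close>

lemma proj_homogeneous:
  "relator_proj \<rho> ` nc_poly_homogeneous \<tau> m = relator_proj \<rho> ` {f. support f \<subseteq> normal_words m}"
proof (intro equalityI subsetI)
  fix u assume "u \<in> relator_proj \<rho> ` nc_poly_homogeneous \<tau> m"
  then obtain f where f: "u = relator_proj \<rho> f" "f \<in> carrier nc_poly_ring" "\<And>z. z \<in> support f \<Longrightarrow> weight \<tau> z = m"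
    unfolding nc_poly_homogeneous_def support_def by auto
  have supp: "support (nf_poly f) \<subseteq> normal_words m"
  proof
    fix y assume "y \<in> support (nf_poly f)"
    then obtain z where "z \<in> support f" "y \<in> support (nf z)"
      unfolding nf_poly_def support_def
      by (auto simp: ncps_nth_sum) (metis (mono_tags, lifting) mem_Collect_eq mult_zero_right sum.neutral)
    then show "y \<in> normal_words m" using nf_support[of y z] f(3) by (simp add: normal_words_def)
  qed
  then have "nf_poly f \<in> carrier nc_poly_ring"
    using finite_subset[OF supp finite_normal_words] by (simp add: nc_poly_carrier)
  then have "u = relator_proj \<rho> (nf_poly f)"
    using f proj_eq_iff minus_nf_poly_in_ideal by blast
  then show "u \<in> relator_proj \<rho> ` {f. support f \<subseteq> normal_words m}" using supp by auto
next
  fix u assume "u \<in> relator_proj \<rho> ` {f. support f \<subseteq> normal_words m}"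
  then obtain f where f: "u = relator_proj \<rho> f" "support f \<subseteq> normal_words m" by auto
  then have "f \<in> nc_poly_homogeneous \<tau> m"
    using finite_subset[OF f(2) finite_normal_words]
    by (auto simp: nc_poly_homogeneous_def nc_poly_carrier) (auto simp: support_def normal_words_def)
  then show "u \<in> relator_proj \<rho> ` nc_poly_homogeneous \<tau> m" using f by auto
qed

lemma poincare_series_nth: "fps_nth (poincare_series \<tau> \<rho>) m = of_nat (card (normal_words m))"
proof -
  have "ring.dimension quot_ring (card (normal_words m)) scalars (relator_proj \<rho> ` nc_poly_homogeneous \<tau> m)"
    unfolding proj_homogeneous
    by (rule dimension_normal_span[OF finite_normal_words]) (simp add: normal_words_def)
  then have "ring.dim quot_ring scalars (relator_proj \<rho> ` nc_poly_homogeneous \<tau> m) = card (normal_words m)"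
    using ring.dimI[OF quot_ring scalars_subfield] unfolding over_def by blast
  then show ?thesis by (simp add: poincare_series_def)
qed

lemma n_eq: "n = weight \<tau> w"
  using weight_eq[OF lead_nonzero] by simp

lemma normal_word_Nil: "normal_word []"
  using w_nonempty by (auto simp: normal_word_def)

lemma normal_word_ConsD: "normal_word (i # z) \<Longrightarrow> normal_word z"
  unfolding normal_word_def by (metis append_Cons)

text \<open>Put a letter in front of a normal word. The result is normal, or it is \<open>w\<close>
  followed by a normal word; conversely, deleting the first letter of such a word gives a normal
  one, in the second case by \<open>nonoverlap\<close>. This is the identity behind the rational
  Poincare series, coefficient by coefficient.\<close>

lemma normal_word_count:
  "(\<Sum>i\<in>UNIV. if \<tau> i \<le> m then card (normal_words (m - \<tau> i)) else 0) + (if m = 0 then 1 else 0) =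
   card (normal_words m) + (if n \<le> m then card (normal_words (m - n)) else 0)"
proof -
  let ?A = "SIGMA i:{i. \<tau> i \<le> m}. normal_words (m - \<tau> i)"
  let ?B = "normal_words m - {[]}" and ?C = "if n \<le> m then (@) w ` normal_words (m - n) else {}"
  have image: "(\<lambda>(i, z). i # z) ` ?A = ?B \<union> ?C"
  proof (intro equalityI subsetI)
    fix y assume "y \<in> (\<lambda>(i, z). i # z) ` ?A"
    then obtain i z where y: "y = i # z" "normal_word z" "weight \<tau> y = m"
      by (auto simp: normal_words_def weight_def)
    show "y \<in> ?B \<union> ?C"
    proof (cases "normal_word y")
      case True
      then show ?thesis using y by (auto simp: normal_words_def)
    next
      case False
      then obtain a b where ab: "y = a @ w @ b" by (auto simp: normal_word_def)
      have "a = []"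
      proof (rule ccontr)
        assume "a \<noteq> []"
        then obtain a' where "z = a' @ w @ b" using ab y(1) by (cases a) auto
        then show False using y(2) by (auto simp: normal_word_def)
      qed
      have "normal_word b"
      proof (rule ccontr)
        assume "\<not> normal_word b"
        then obtain c d where "b = c @ w @ d" by (auto simp: normal_word_def)
        then have "z = (tl w @ c) @ w @ d" using ab \<open>a = []\<close> y(1) w_nonempty by (cases w) auto
        then show False using y(2) unfolding normal_word_def by blast
      qed
      then show ?thesis using y(3) ab \<open>a = []\<close> n_eq by (auto simp: normal_words_def weight_append)
    qed
  next
    fix y assume "y \<in> ?B \<union> ?C"
    then consider "y \<in> ?B" | z where "n \<le> m" "y = w @ z" "z \<in> normal_words (m - n)"
      by (auto split: if_splits)
    then obtain i z where "y = i # z" "normal_word z" "weight \<tau> y = m"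
    proof cases
      case 1
      then show ?thesis using that normal_word_ConsD by (cases y) (auto simp: normal_words_def)
    next
      case 2
      obtain i w0 where w: "w = i # w0" using w_nonempty by (cases w) auto
      have "normal_word (w0 @ z)"
      proof (rule ccontr)
        assume "\<not> normal_word (w0 @ z)"
        then obtain a b where "w0 @ z = a @ w @ b" by (auto simp: normal_word_def)
        then have "[] @ w @ z = (i # a) @ w @ b" using w by simp
        then obtain c where "z = c @ w @ b" by (rule nonoverlap) auto
        then show False using 2 by (auto simp: normal_words_def normal_word_def)
      qed
      moreover have "weight \<tau> y = m"
      proof -
        have "weight \<tau> z = m - n" using 2(3) by (simp add: normal_words_def)
        then show ?thesis unfolding 2(2) weight_append n_eq[symmetric] using 2(1) by linarith
      qed
      moreover have "y = i # (w0 @ z)" using 2(2) w by (metis append_Cons)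
      ultimately show ?thesis by (intro that[of i "w0 @ z"])
    qed
    then have "\<tau> i + weight \<tau> z = m" by (simp add: weight_def)
    then have "(i, z) \<in> ?A" using \<open>normal_word z\<close> unfolding normal_words_def by simp
    then show "y \<in> (\<lambda>(i, z). i # z) ` ?A"
      by (rule rev_image_eqI) (simp add: \<open>y = i # z\<close>)
  qed
  have card_img: "card ((\<lambda>(i, z). i # z) ` ?A) = card ?A"
    by (rule card_image) (auto simp: inj_on_def)
  have card_A: "card ?A = (\<Sum>i\<in>UNIV. if \<tau> i \<le> m then card (normal_words (m - \<tau> i)) else 0)"
    by (subst card_SigmaI) (auto simp: finite_normal_words sum.If_cases)
  have card_Un: "card (?B \<union> ?C) = card ?B + card ?C"
  proof (rule card_Un_disjoint)
    show "finite ?B" "finite ?C" by (simp_all add: finite_normal_words)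
    have "\<not> normal_word (w @ z)" for z unfolding normal_word_def by (metis append_Nil)
    then show "?B \<inter> ?C = {}" by (auto simp: normal_words_def)
  qed
  have card_C: "card ?C = (if n \<le> m then card (normal_words (m - n)) else 0)"
    by (simp add: card_image inj_on_def)
  have card_m: "card (normal_words m) = card ?B + (if m = 0 then 1 else 0)"
  proof (cases "m = 0")
    case True
    then have "[] \<in> normal_words m" using normal_word_Nil by (simp add: normal_words_def weight_def)
    then have "0 < card (normal_words m)" using finite_normal_words card_gt_0_iff by blast
    then show ?thesis using True \<open>[] \<in> normal_words m\<close> by simp
  next
    case False
    then have "[] \<notin> normal_words m" by (auto simp: normal_words_def weight_def)
    then show ?thesis using False by simp
  qed
  have "card ?A = card ?B + card ?C" using image card_img card_Un by metis
  then show ?thesis unfolding card_A[symmetric] card_C[symmetric] card_m by (simp only: ac_simps)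
qed

lemma strongly_free: "strongly_free \<tau> \<rho>"
proof -
  let ?P = "poincare_series \<tau> \<rho>" and ?D = "1 - (\<Sum>i\<in>UNIV. fps_X ^ \<tau> i) + fps_X ^ n :: rat fps"
  have n_pos: "0 < n" using n_eq length_le_weight[of w] w_nonempty by (cases w) auto
  have "?D * ?P = 1"
  proof (rule fps_ext)
    fix m
    have "fps_nth (?D * ?P) m = fps_nth ?P m - (\<Sum>i\<in>UNIV. fps_nth (fps_X ^ \<tau> i * ?P) m) + fps_nth (fps_X ^ n * ?P) m"
      by (simp add: algebra_simps sum_distrib_right sum_distrib_left fps_sum_nth)
    also have "\<dots> = rat_of_nat (card (normal_words m)) -
       (\<Sum>i\<in>UNIV. if \<tau> i \<le> m then rat_of_nat (card (normal_words (m - \<tau> i))) else 0) +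
       (if n \<le> m then rat_of_nat (card (normal_words (m - n))) else 0)"
      by (auto simp: fps_X_power_mult_nth poincare_series_nth not_less intro!: sum.cong)
    also have "\<dots> = rat_of_nat (card (normal_words m) + (if n \<le> m then card (normal_words (m - n)) else 0)) -
       rat_of_nat (\<Sum>i\<in>UNIV. if \<tau> i \<le> m then card (normal_words (m - \<tau> i)) else 0)"
      by (auto simp: of_nat_sum intro!: sum.cong)
    also have "\<dots> = (if m = 0 then 1 else 0)"
      unfolding normal_word_count[symmetric] by auto
    finally show "fps_nth (?D * ?P) m = fps_nth 1 m" by simp
  qed
  then have "inverse ?D = ?P" by (rule fps_inverse_unique)
  moreover have "fps_nth ?D 0 \<noteq> 0"
    using n_pos \<tau>_pos by (simp add: fps_sum_nth fps_X_power_iff less_imp_neq[symmetric])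
  ultimately have "?P = 1 / ?D" by (simp add: fps_divide_unit)
  moreover have "\<rho> \<in> nc_poly_homogeneous \<tau> n"
    using rho_carrier weight_eq by (simp add: nc_poly_homogeneous_def)
  moreover have "\<rho> \<noteq> 0" using lead_nonzero by auto
  ultimately show ?thesis unfolding strongly_free_def by blast
qed

end

section \<open>Infiltration products\<close>

text \<open>Pairs \<open>f\<close> with the infiltration product of Chen, Fox and Lyndon: shuffles
  in which equal letters of the two words may also be merged, which is the third summand.\<close>

fun infiltration_pairing :: "('a list \<Rightarrow> 'k::comm_monoid_add) \<Rightarrow> 'a list \<Rightarrow> 'a list \<Rightarrow> 'k" where
  "infiltration_pairing f [] v = f v"
| "infiltration_pairing f (a # u) [] = f (a # u)"
| "infiltration_pairing f (a # u) (b # v) =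
     infiltration_pairing (\<lambda>w. f (a # w)) u (b # v) + infiltration_pairing (\<lambda>w. f (b # w)) (a # u) v +
     (if a = b then infiltration_pairing (\<lambda>w. f (a # w)) u v else 0)"

lemma infiltration_pairing_Nil2 [simp]: "infiltration_pairing f u [] = f u"
  by (cases u) auto

lemma infiltration_pairing_add:
  "infiltration_pairing (\<lambda>w. f w + g w) u v = infiltration_pairing f u v + infiltration_pairing g u v"
proof (induction "length u + length v" arbitrary: u v f g rule: less_induct)
  case less
  show ?case
  proof (cases u; cases v)
    fix a u' b v' assume uv: "u = a # u'" "v = b # v'"
    note IH = less.hyps[of u' v "\<lambda>w. f (a # w)" "\<lambda>w. g (a # w)"]
      less.hyps[of u v' "\<lambda>w. f (b # w)" "\<lambda>w. g (b # w)"]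
      less.hyps[of u' v' "\<lambda>w. f (a # w)" "\<lambda>w. g (a # w)"]
    show ?thesis
    proof (cases "a = b")
      case True
      then show ?thesis using IH unfolding uv True by (simp add: ac_simps)
    next
      case False
      then show ?thesis using IH unfolding uv by (simp add: ac_simps)
    qed
  qed auto
qed

lemma infiltration_pairing_zero [simp]: "infiltration_pairing (\<lambda>w. 0) u v = 0"
proof (induction "length u + length v" arbitrary: u v rule: less_induct)
  case less
  then show ?case by (cases u; cases v) auto
qed

lemma infiltration_pairing_cong:
  assumes "\<And>w. length w \<le> length u + length v \<Longrightarrow> f w = g w"
  shows "infiltration_pairing f u v = infiltration_pairing g u v"
  using assms
proof (induction "length u + length v" arbitrary: u v f g rule: less_induct)
  case less
  show ?case
  proof (cases u; cases v)
    fix a u' b v' assume uv: "u = a # u'" "v = b # v'"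
    have "infiltration_pairing (\<lambda>w. f (a # w)) u' v = infiltration_pairing (\<lambda>w. g (a # w)) u' v"
      "infiltration_pairing (\<lambda>w. f (b # w)) u v' = infiltration_pairing (\<lambda>w. g (b # w)) u v'"
      "infiltration_pairing (\<lambda>w. f (a # w)) u' v' = infiltration_pairing (\<lambda>w. g (a # w)) u' v'"
      by (rule less.hyps; use less.prems uv in force)+
    then show ?thesis unfolding uv infiltration_pairing.simps by (simp only:)
  qed (use less.prems in auto)
qed

lemma infiltration_pairing_eq_0:
  assumes "\<And>w. weight \<tau> w \<le> weight \<tau> u + weight \<tau> v \<Longrightarrow> f w = 0"
  shows "infiltration_pairing f u v = 0"
  using assms
proof (induction "length u + length v" arbitrary: u v f rule: less_induct)
  case less
  show ?case
  proof (cases u; cases v)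
    fix a u' b v' assume uv: "u = a # u'" "v = b # v'"
    have "infiltration_pairing (\<lambda>w. f (a # w)) u' v = 0"
      "infiltration_pairing (\<lambda>w. f (b # w)) u v' = 0"
      "infiltration_pairing (\<lambda>w. f (a # w)) u' v' = 0"
      by (rule less.hyps; use less.prems uv in \<open>force simp: weight_def\<close>)+
    then show ?thesis unfolding uv infiltration_pairing.simps by (simp only: if_cancel add_0_left)
  qed (use less.prems in \<open>auto simp: weight_def\<close>)
qed

text \<open>The infiltration product consists of the shuffle product and words of smaller weight.\<close>

lemma infiltration_pairing_eq_shuffle_pairing:
  assumes "\<And>i. 0 < \<tau> i" "\<And>w. w \<noteq> [] \<Longrightarrow> weight \<tau> w < weight \<tau> u + weight \<tau> v \<Longrightarrow> f w = 0"
  shows "infiltration_pairing f u v = shuffle_pairing f u v"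
  using assms(2)
proof (induction "length u + length v" arbitrary: u v f rule: less_induct)
  case less
  show ?case
  proof (cases u; cases v)
    fix a u' b v' assume uv: "u = a # u'" "v = b # v'"
    have "infiltration_pairing (\<lambda>w. f (a # w)) u' v = shuffle_pairing (\<lambda>w. f (a # w)) u' v"
      "infiltration_pairing (\<lambda>w. f (b # w)) u v' = shuffle_pairing (\<lambda>w. f (b # w)) u v'"
      by (rule less.hyps; use less.prems uv in \<open>force simp: weight_def\<close>)+
    moreover have "infiltration_pairing (\<lambda>w. f (a # w)) u' v' = 0"
    proof (rule infiltration_pairing_eq_0)
      fix w assume "weight \<tau> w \<le> weight \<tau> u' + weight \<tau> v'"
      then show "f (a # w) = 0"
        using less.prems[of "a # w"] uv assms(1)[of b] by (simp add: weight_def)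
    qed
    ultimately show ?thesis unfolding uv infiltration_pairing.simps shuffle_pairing.simps
      by (simp only: if_cancel add_0_right)
  qed auto
qed

text \<open>The series \<open>1 + X\<^sub>i\<close> is group-like for the coproduct \<open>X \<mapsto> X \<otimes> 1 + 1 \<otimes> X + X \<otimes> X\<close>, whose dual
  product is the infiltration product; hence so is every element of the image of \<open>F\<close>.\<close>

definition group_like :: "('i, 'k::comm_ring_1) ncps \<Rightarrow> bool" where
  "group_like f \<longleftrightarrow> ncps_nth f [] = 1 \<and>
     (\<forall>u v. ncps_nth f u * ncps_nth f v = infiltration_pairing (ncps_nth f) u v)"

lemma ncps_nth_one_plus_X_mult:
  "ncps_nth ((1 + ncps_X i) * f) w =
    ncps_nth f w + (if w \<noteq> [] \<and> hd w = i then ncps_nth f (tl w) else 0)"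
  by (simp add: distrib_right ncps_nth_X_mult)

lemma group_like_one: "group_like (1 :: ('i, 'k::comm_ring_1) ncps)"
proof -
  have "ncps_nth (1 :: ('i, 'k) ncps) u * ncps_nth 1 v = infiltration_pairing (ncps_nth (1 :: ('i, 'k) ncps)) u v" for u v
    by (cases u; cases v) (auto simp: ncps_nth_one)
  then show ?thesis by (simp add: group_like_def ncps_nth_one)
qed

text \<open>With \<open>?d\<close> the coefficients of X_i times \<open>f\<close>, the three
  summands of the infiltration recursion for \<open>?d\<close> are exactly the three products other
  than \<open>?c u * ?c v\<close> in \<open>(?c u + ?d u) * (?c v + ?d v)\<close>.\<close>

lemma group_like_one_plus_X_mult:
  assumes "group_like f"
  shows "group_like ((1 + ncps_X i) * f)"
proof -
  let ?c = "ncps_nth f" and ?d = "\<lambda>w. if w \<noteq> [] \<and> hd w = i then ncps_nth f (tl w) else 0"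
  have c: "?c u * ?c v = infiltration_pairing ?c u v" "?c [] = 1" for u v
    using assms unfolding group_like_def by auto
  have "(?c u + ?d u) * (?c v + ?d v) = infiltration_pairing (\<lambda>w. ?c w + ?d w) u v" for u v
  proof (cases u; cases v)
    fix a u' b v' assume uv: "u = a # u'" "v = b # v'"
    have d: "(\<lambda>w. ?d (a # w)) = (if a = i then ?c else (\<lambda>_. 0))" for a by auto
    have "infiltration_pairing ?d u v = (if a = i then ?c u' * ?c v else 0) + (if b = i then ?c u * ?c v' else 0) +
       (if a = i \<and> b = i then ?c u' * ?c v' else 0)"
      unfolding uv infiltration_pairing.simps d by (auto simp: c)
    then show ?thesis unfolding infiltration_pairing_add c[symmetric] using uv
      by (auto simp: algebra_simps)
  qed (use c in auto)
  then show ?thesis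
    unfolding group_like_def ncps_nth_one_plus_X_mult using c(2) by (simp add: fun_eq_iff ncps_nth_one_plus_X_mult)
qed

section \<open>Series modulo long words\<close>

definition agree :: "nat \<Rightarrow> ('i, 'k) ncps \<Rightarrow> ('i, 'k) ncps \<Rightarrow> bool" where
  "agree M f g \<longleftrightarrow> (\<forall>w. length w \<le> M \<longrightarrow> ncps_nth f w = ncps_nth g w)"

lemma agree_refl [simp]: "agree M f f"
  by (simp add: agree_def)

lemma agree_trans: "agree M f g \<Longrightarrow> agree M g h \<Longrightarrow> agree M f h"
  by (simp add: agree_def)

lemma agree_mono: "agree M f g \<Longrightarrow> N \<le> M \<Longrightarrow> agree N f g"
  by (simp add: agree_def)

lemma agree_mult:
  fixes f :: "('i, 'k::ring_1) ncps"
  assumes "agree M f f'" "agree M g g'"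
  shows "agree M (f * g) (f' * g')"
  using assms by (auto simp: agree_def ncps_nth_mult intro!: sum.cong)

text \<open>Each defining identity involves only coefficients at words of bounded length.\<close>

lemma group_like_closed:
  assumes "\<And>M. \<exists>g. group_like g \<and> agree M g f"
  shows "group_like f"
proof -
  have "ncps_nth f [] = 1"
    using assms[of 0] unfolding group_like_def agree_def by (metis le_zero_eq list.size(3))
  moreover have "ncps_nth f u * ncps_nth f v = infiltration_pairing (ncps_nth f) u v" for u v
  proof -
    obtain g where g: "group_like g" "agree (length u + length v) g f" using assms by blast
    have "infiltration_pairing (ncps_nth g) u v = infiltration_pairing (ncps_nth f) u v"
      by (rule infiltration_pairing_cong) (use g(2) in \<open>simp add: agree_def\<close>)
    moreover have "ncps_nth f u = ncps_nth g u" "ncps_nth f v = ncps_nth g v"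
      using g(2) by (simp_all add: agree_def)
    ultimately show ?thesis using g(1) by (simp add: group_like_def)
  qed
  ultimately show ?thesis by (simp add: group_like_def)
qed

lemma power_minus_1_geometric:
  fixes a :: "'a::ring_1"
  shows "(a - 1) * (\<Sum>j<n. a ^ j) = a ^ n - 1"
  by (induction n) (simp_all add: algebra_simps)

lemma ncps_nth_mult_Nil: "ncps_nth (f * g) [] = ncps_nth f [] * ncps_nth (g :: ('i, 'k::ring_1) ncps) []"
  by (simp add: ncps_nth_mult)

lemma ncps_nth_power_Nil: "ncps_nth (f ^ n) [] = ncps_nth (f :: ('i, 'k::ring_1) ncps) [] ^ n"
  by (induction n) (simp_all add: ncps_nth_mult_Nil ncps_nth_one)

text \<open>Raising to the power \<open>p\<close> gains one degree: a^p - 1 is a - 1 times 1 + a +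
  ... + a^(p-1), and the second factor has constant term \<open>p\<close>, which is 0.\<close>

lemma power_char_agree_one:
  fixes f :: "('i, 'k::ring_1) ncps"
  assumes "(of_nat p :: 'k) = 0" "ncps_nth f [] = 1"
  shows "agree m (f ^ p ^ m) 1"
proof (induction m)
  case 0
  then show ?case using assms by (simp add: agree_def ncps_nth_one)
next
  case (Suc m)
  let ?a = "f ^ p ^ m"
  let ?S = "\<Sum>j<p. ?a ^ j"
  have S: "ncps_nth ?S [] = 0" using assms by (simp add: ncps_nth_sum ncps_nth_power_Nil)
  have a: "ncps_nth (?a - 1) w = 0" if "length w \<le> m" for w
    using Suc that by (simp add: agree_def)
  have "ncps_nth (f ^ p ^ Suc m - 1) w = 0" if w: "length w \<le> Suc m" for w
  proof -
    have "f ^ p ^ Suc m - 1 = (?a - 1) * ?S"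
      unfolding power_minus_1_geometric by (simp add: power_mult[symmetric] mult.commute)
    then have "ncps_nth (f ^ p ^ Suc m - 1) w =
        (\<Sum>k\<le>length w. ncps_nth (?a - 1) (take k w) * ncps_nth ?S (drop k w))"
      by (simp only: ncps_nth_mult)
    also have "\<dots> = 0"
    proof (rule sum.neutral, rule ballI)
      fix k assume k: "k \<in> {..length w}"
      show "ncps_nth (?a - 1) (take k w) * ncps_nth ?S (drop k w) = 0"
      proof (cases "length (take k w) \<le> m")
        case True
        then show ?thesis using a by simp
      next
        case False
        then have "drop k w = []" using w k by simp
        then show ?thesis using S by simp
      qed
    qed
    finally show ?thesis .
  qed
  then show ?case by (simp add: agree_def)
qed

section \<open>The Magnus embedding\<close>

lemma openin_agree: "openin ncps_topology {h :: ('i::finite, 'k) ncps. agree M h f}"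
proof -
  let ?P = "product_topology (\<lambda>_::'i list. discrete_topology (UNIV :: 'k set)) UNIV"
  have fin: "finite {w::'i list. length w \<le> M}"
    using finite_lists_length_le[of "UNIV :: 'i set" M] by simp
  have one: "openin ncps_topology {h :: ('i, 'k) ncps. ncps_nth h w = c}" for w c
  proof -
    have "openin ?P {\<phi> \<in> topspace ?P. \<phi> w \<in> {c}}"
      by (rule openin_continuous_map_preimage[OF continuous_map_product_projection]) auto
    then show ?thesis unfolding ncps_topology_def openin_pullback_topology
      by (intro exI[of _ "{\<phi> \<in> topspace ?P. \<phi> w \<in> {c}}"]) auto
  qed
  have "openin ncps_topology (\<Inter>w\<in>{w. length w \<le> M}. {h :: ('i, 'k) ncps. ncps_nth h w = ncps_nth f w})"
    by (rule openin_Inter) (use fin one in \<open>auto intro: exI[of _ "[]"]\<close>)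
  moreover have "(\<Inter>w\<in>{w. length w \<le> M}. {h. ncps_nth h w = ncps_nth f w}) = {h. agree M h f}"
    by (auto simp: agree_def)
  ultimately show ?thesis by simp
qed

lemma ncps_ring_monoid: "monoid (ncps_ring :: ('i, 'k::ring_1) ncps ring)"
  by (rule monoidI) (auto simp: ncps_ring_def mult.assoc)

locale magnus_embedding =
  fixes F :: "('a, 'b) monoid_scheme" and T :: "'a topology" and x :: "'i::finite \<Rightarrow> 'a"
    and \<psi> :: "'a \<Rightarrow> ('i, 'p::prime_card mod_ring) ncps"
  assumes pro_p: "pro_p_group CARD('p) F T"
    and x_closed: "range x \<subseteq> carrier F"
    and dense: "T closure_of (generate F (range x)) = carrier F"
    and magnus: "magnus_map F T x \<psi>"
begin

lemma profinite: "profinite_group F T"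
  using pro_p by (simp add: pro_p_group_def)

sublocale F: group F
  using profinite by (simp add: profinite_group_def topological_group_def)

lemma topspace_eq: "topspace T = carrier F"
  and mult_continuous: "continuous_map (prod_topology T T) T (\<lambda>(g, h). g \<otimes>\<^bsub>F\<^esub> h)"
  and inv_continuous: "continuous_map T T (\<lambda>g. inv\<^bsub>F\<^esub> g)"
  using profinite by (simp_all add: profinite_group_def topological_group_def)

lemma compact_T: "compact_space T" and Hausdorff_T: "Hausdorff_space T"
  using profinite by (simp_all add: profinite_group_def)

lemma psi_mult: "f \<in> carrier F \<Longrightarrow> g \<in> carrier F \<Longrightarrow> \<psi> (f \<otimes>\<^bsub>F\<^esub> g) = \<psi> f * \<psi> g"
  using magnus by (simp add: magnus_map_def hom_def units_of_def ncps_ring_def)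

lemma psi_one: "\<psi> \<one>\<^bsub>F\<^esub> = 1"
proof -
  have "group_hom F (units_of ncps_ring) \<psi>"
    using magnus monoid.units_group[OF ncps_ring_monoid]
    by (intro group_hom.intro group_hom_axioms.intro F.group_axioms) (auto simp: magnus_map_def)
  from group_hom.hom_one[OF this] show ?thesis by (simp add: units_of_def ncps_ring_def)
qed

lemma psi_x: "\<psi> (x i) = 1 + ncps_X i"
  and psi_continuous: "continuous_map T ncps_topology \<psi>"
  using magnus by (simp_all add: magnus_map_def)

lemma x_in [simp, intro]: "x i \<in> carrier F"
  using x_closed by auto

text \<open>Inverses are avoided because group-likeness, and later the evaluation
  \<open>\<Theta>\<close>, are only followed through left multiplication by 1 + X_i.\<close>

definition positive_word :: "'i list \<Rightarrow> 'a" where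
  "positive_word zs = foldr (\<lambda>i g. x i \<otimes>\<^bsub>F\<^esub> g) zs \<one>\<^bsub>F\<^esub>"

lemma positive_word_simps [simp]:
  "positive_word [] = \<one>\<^bsub>F\<^esub>" "positive_word (i # zs) = x i \<otimes>\<^bsub>F\<^esub> positive_word zs"
  by (simp_all add: positive_word_def)

lemma positive_word_closed [simp, intro]: "positive_word zs \<in> carrier F"
  by (induction zs) auto

lemma positive_word_append: "positive_word (zs @ zs') = positive_word zs \<otimes>\<^bsub>F\<^esub> positive_word zs'"
  by (induction zs) (auto simp: F.m_assoc)

lemma positive_word_replicate: "positive_word (replicate m i) = x i [^]\<^bsub>F\<^esub> m"
  by (induction m) (simp_all add: F.nat_pow_Suc2[symmetric] del: F.nat_pow_Suc)

lemma psi_pow: "f \<in> carrier F \<Longrightarrow> \<psi> (f [^]\<^bsub>F\<^esub> m) = \<psi> f ^ m" for m :: nat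
  by (induction m) (simp_all add: psi_one psi_mult power_commutes)

section \<open>Approximation of group elements by positive words\<close>

lemma openin_translate:
  assumes "openin T N" "f \<in> carrier F"
  shows "openin T {g \<in> carrier F. g \<otimes>\<^bsub>F\<^esub> f \<in> N}"
proof -
  have "continuous_map T T (\<lambda>g. g \<otimes>\<^bsub>F\<^esub> f)"
  proof -
    have "continuous_map T (prod_topology T T) (\<lambda>g. (g, f))"
      by (intro continuous_map_pairedI) (use assms(2) topspace_eq in auto)
    from continuous_map_compose[OF this mult_continuous] show ?thesis by (simp add: o_def)
  qed
  from openin_continuous_map_preimage[OF this assms(1)] show ?thesis by (simp add: topspace_eq)
qed

lemma open_normal_quotient:
  assumes "N \<lhd> F" "openin T N"
  obtains k where "order (F Mod N) = CARD('p) ^ k"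
  using pro_p assms unfolding pro_p_group_def by blast

text \<open>Inverses of generators may be replaced by large positive powers.\<close>

lemma generate_approx:
  assumes N: "N \<lhd> F" "openin T N" and e: "e \<in> generate F (range x)"
  shows "\<exists>zs. agree M (\<psi> (positive_word zs)) (\<psi> e) \<and> N #>\<^bsub>F\<^esub> positive_word zs = N #>\<^bsub>F\<^esub> e"
proof -
  interpret N: normal N F by (rule N(1))
  interpret Q: group "F Mod N" by (rule N.factorgroup_is_group)
  have gen: "generate F (range x) \<subseteq> carrier F" using F.generate_incl x_closed by blast
  have q_mult: "N #>\<^bsub>F\<^esub> (a \<otimes>\<^bsub>F\<^esub> b) = (N #>\<^bsub>F\<^esub> a) \<otimes>\<^bsub>F Mod N\<^esub> (N #>\<^bsub>F\<^esub> b)"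
    if "a \<in> carrier F" "b \<in> carrier F" for a b
    using N.rcos_sum that by (simp add: FactGroup_def)
  have q_hom: "group_hom F (F Mod N) (\<lambda>a. N #>\<^bsub>F\<^esub> a)"
    using N.r_coset_hom_Mod by (intro group_hom.intro group_hom_axioms.intro) (auto intro: F.group_axioms Q.group_axioms)
  interpret q: group_hom F "F Mod N" "\<lambda>a. N #>\<^bsub>F\<^esub> a" by (rule q_hom)
  obtain k where k: "order (F Mod N) = CARD('p) ^ k" using open_normal_quotient[OF N] by blast
  show ?thesis using e
  proof induction
    case one
    then show ?case by (intro exI[of _ "[]"]) simp
  next
    case (incl h)
    then obtain i where "h = x i" by auto
    then show ?case by (intro exI[of _ "[i]"]) simp
  next
    case (inv h)
    then obtain i where h: "h = x i" by auto
    \<comment> \<open>With \<open>P\<close> the \<open>K\<close>-th power of the prime, the power of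
      \<open>x i\<close> with exponent \<open>P - 1\<close> imitates the inverse twice: up to length
      \<open>M\<close> under \<open>\<psi>\<close>, and exactly in \<open>F Mod N\<close>, whose
      order divides \<open>P\<close>.\<close>
    define K where "K = max M k"
    define P where "P = CARD('p) ^ K"
    define P' where "P' = P - 1"
    have P: "P = Suc P'" by (simp add: P'_def P_def)
    let ?y = "x i [^]\<^bsub>F\<^esub> P'"
    have y: "?y \<in> carrier F" by (rule F.nat_pow_closed) (rule x_in)
    have yx: "?y \<otimes>\<^bsub>F\<^esub> x i = x i [^]\<^bsub>F\<^esub> P" unfolding P by (simp only: F.nat_pow_Suc)
    have y_eq: "?y = (x i [^]\<^bsub>F\<^esub> P) \<otimes>\<^bsub>F\<^esub> inv\<^bsub>F\<^esub> x i"
      unfolding yx[symmetric] using y by (simp add: F.m_assoc)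
    have "agree K (\<psi> (x i) ^ P) 1"
      unfolding P_def by (rule power_char_agree_one) (simp_all add: psi_x ncps_nth_one ncps_nth_X)
    then have "agree K (\<psi> (x i [^]\<^bsub>F\<^esub> P) * \<psi> (inv\<^bsub>F\<^esub> x i)) (1 * \<psi> (inv\<^bsub>F\<^esub> x i))"
      by (intro agree_mult) (simp_all add: psi_pow)
    then have "agree K (\<psi> ?y) (\<psi> (inv\<^bsub>F\<^esub> h))"
      unfolding y_eq h by (subst psi_mult) simp_all
    then have 1: "agree M (\<psi> ?y) (\<psi> (inv\<^bsub>F\<^esub> h))"
      by (rule agree_mono) (simp add: K_def)
    have qx: "N #>\<^bsub>F\<^esub> x i \<in> carrier (F Mod N)" by (rule q.hom_closed) (rule x_in)
    have P_eq: "P = order (F Mod N) * CARD('p) ^ (K - k)"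
      unfolding P_def k K_def by (simp add: power_add[symmetric])
    have "(N #>\<^bsub>F\<^esub> x i) [^]\<^bsub>F Mod N\<^esub> P = \<one>\<^bsub>F Mod N\<^esub>"
      unfolding P_eq Q.nat_pow_pow[OF qx, symmetric] Q.pow_order_eq_1[OF qx] by (rule Q.nat_pow_one)
    moreover have "N #>\<^bsub>F\<^esub> (x i [^]\<^bsub>F\<^esub> P) = (N #>\<^bsub>F\<^esub> x i) [^]\<^bsub>F Mod N\<^esub> P"
      by (rule q.hom_nat_pow) (rule x_in)
    ultimately have "N #>\<^bsub>F\<^esub> (x i [^]\<^bsub>F\<^esub> P) = \<one>\<^bsub>F Mod N\<^esub>" by (rule trans[rotated])
    moreover have "N #>\<^bsub>F\<^esub> inv\<^bsub>F\<^esub> x i \<in> carrier (F Mod N)"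
      by (rule q.hom_closed) (rule F.inv_closed, rule x_in)
    moreover have "N #>\<^bsub>F\<^esub> ?y = (N #>\<^bsub>F\<^esub> (x i [^]\<^bsub>F\<^esub> P)) \<otimes>\<^bsub>F Mod N\<^esub> (N #>\<^bsub>F\<^esub> inv\<^bsub>F\<^esub> x i)"
      unfolding y_eq by (rule q_mult) (rule F.nat_pow_closed F.inv_closed, rule x_in)+
    ultimately have "N #>\<^bsub>F\<^esub> ?y = N #>\<^bsub>F\<^esub> inv\<^bsub>F\<^esub> h" unfolding h by (simp only: Q.l_one)
    with 1 show ?case
      by (intro exI[of _ "replicate P' i"]) (simp only: positive_word_replicate)
  next
    case (eng h1 h2)
    then obtain zs1 zs2 where zs:
      "agree M (\<psi> (positive_word zs1)) (\<psi> h1)" "N #>\<^bsub>F\<^esub> positive_word zs1 = N #>\<^bsub>F\<^esub> h1"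
      "agree M (\<psi> (positive_word zs2)) (\<psi> h2)" "N #>\<^bsub>F\<^esub> positive_word zs2 = N #>\<^bsub>F\<^esub> h2" by blast
    have h: "h1 \<in> carrier F" "h2 \<in> carrier F" using eng gen by auto
    have "agree M (\<psi> (positive_word (zs1 @ zs2))) (\<psi> (h1 \<otimes>\<^bsub>F\<^esub> h2))"
      unfolding positive_word_append psi_mult[OF positive_word_closed positive_word_closed] psi_mult[OF h]
      by (rule agree_mult[OF zs(1,3)])
    moreover have "N #>\<^bsub>F\<^esub> positive_word (zs1 @ zs2) = N #>\<^bsub>F\<^esub> (h1 \<otimes>\<^bsub>F\<^esub> h2)"
      unfolding positive_word_append q_mult[OF positive_word_closed positive_word_closed] q_mult[OF h]
      unfolding zs(2,4) ..
    ultimately show ?case by blast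
  qed
qed

text \<open>Density yields an element of the abstract subgroup in the open set
  \<open>U \<inter> V\<close>, where series and coset are both controlled;
  \<open>generate_approx\<close> then removes the inverses.\<close>

lemma approx:
  assumes N: "N \<lhd> F" "openin T N" and f: "f \<in> carrier F"
  obtains zs where "agree M (\<psi> (positive_word zs)) (\<psi> f)" "N #>\<^bsub>F\<^esub> positive_word zs = N #>\<^bsub>F\<^esub> f"
proof -
  interpret N: normal N F by (rule N(1))
  define U where "U = {g \<in> topspace T. \<psi> g \<in> {h. agree M h (\<psi> f)}}"
  define V where "V = {g \<in> carrier F. g \<otimes>\<^bsub>F\<^esub> inv\<^bsub>F\<^esub> f \<in> N}"
  have "openin T U"
    unfolding U_def by (rule openin_continuous_map_preimage[OF psi_continuous openin_agree])
  moreover have "openin T V"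
    unfolding V_def by (rule openin_translate[OF N(2) F.inv_closed[OF f]])
  ultimately have "openin T (U \<inter> V)" by (rule openin_Int)
  moreover have "f \<in> U" unfolding U_def using f by (simp add: topspace_eq)
  moreover have "f \<in> V" unfolding V_def using f by (simp add: N.one_closed)
  moreover have "f \<in> T closure_of (generate F (range x))" using dense f by simp
  ultimately obtain e where e: "e \<in> generate F (range x)" "e \<in> U" "e \<in> V"
    unfolding in_closure_of by (metis IntE IntI)
  from generate_approx[OF N e(1), of M] obtain zs where
    zs: "agree M (\<psi> (positive_word zs)) (\<psi> e)" "N #>\<^bsub>F\<^esub> positive_word zs = N #>\<^bsub>F\<^esub> e" by blast
  have ef: "e \<in> carrier F" "e \<otimes>\<^bsub>F\<^esub> inv\<^bsub>F\<^esub> f \<in> N" using e(3) unfolding V_def by simp_all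
  have "e \<otimes>\<^bsub>F\<^esub> inv\<^bsub>F\<^esub> f \<otimes>\<^bsub>F\<^esub> f = e" using ef(1) f by (simp add: F.m_assoc)
  with F.rcosI[OF ef(2) N.subset f] have "e \<in> N #>\<^bsub>F\<^esub> f" by (simp only:)
  then have "N #>\<^bsub>F\<^esub> f = N #>\<^bsub>F\<^esub> e" by (rule F.repr_independence[OF _ f N.subgroup_axioms])
  with zs(2) have "N #>\<^bsub>F\<^esub> positive_word zs = N #>\<^bsub>F\<^esub> f" by (simp only:)
  moreover have "agree M (\<psi> e) (\<psi> f)" using e(2) unfolding U_def by simp
  with zs(1) have "agree M (\<psi> (positive_word zs)) (\<psi> f)" by (rule agree_trans)
  ultimately show thesis by (intro that)
qed

lemma psi_group_like:
  assumes "f \<in> carrier F"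
  shows "group_like (\<psi> f)"
proof (rule group_like_closed)
  fix M
  have pos: "group_like (\<psi> (positive_word zs))" for zs
    by (induction zs) (simp_all add: psi_one group_like_one psi_mult psi_x group_like_one_plus_X_mult)
  have "carrier F \<lhd> F" by (rule F.normal_self)
  moreover have "openin T (carrier F)" using openin_topspace[of T] by (simp add: topspace_eq)
  ultimately obtain zs where "agree M (\<psi> (positive_word zs)) (\<psi> f)" using approx assms by blast
  then show "\<exists>g. group_like g \<and> agree M g (\<psi> f)" using pos by blast
qed

text \<open>For nonempty \<open>u\<close> and \<open>v\<close> of total weight \<open>n\<close>,
  infiltration reduces to shuffling because \<psi>(r) has no nonconstant terms below weight
  \<open>n\<close>. The pairing equals the product of the coefficients at \<open>u\<close> and at
  \<open>v\<close>, and both weights are below \<open>n\<close>.\<close>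

lemma initial_form_primitive:
  assumes \<tau>: "\<And>i. 0 < \<tau> i" and n: "0 < n" and r: "r \<in> zassenhaus F \<psi> \<tau> n"
  shows "primitive (ncps_nth (homogeneous_part \<tau> n (\<psi> r - 1)))"
proof -
  let ?f = "homogeneous_part \<tau> n (\<psi> r - 1)"
  have f: "ncps_nth ?f w = (if weight \<tau> w = n then ncps_nth (\<psi> r - 1) w else 0)" for w
    by (simp add: homogeneous_part_def)
  have psi: "ncps_nth (\<psi> r) w = ncps_nth (\<psi> r - 1) w" if "w \<noteq> []" for w
    using that by (simp add: ncps_nth_one)
  have low: "ncps_nth (\<psi> r) w = 0" if "w \<noteq> []" "weight \<tau> w < n" for w
  proof (rule ccontr)
    assume "ncps_nth (\<psi> r) w \<noteq> 0"
    then have "n \<le> weight \<tau> w" using r unfolding psi[OF that(1)] zassenhaus_def by blast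
    then show False using that(2) by simp
  qed
  have pos: "0 < weight \<tau> w" if "w \<noteq> []" for w
    using that \<tau> by (cases w) (auto simp: weight_def)
  have wt: "weight \<tau> z = weight \<tau> u + weight \<tau> v" if "z \<in> shuffles u v" for z u v
    using that
  proof (induction z arbitrary: u v)
    case (Cons a z)
    then show ?case by (auto simp: Cons_in_shuffles_iff neq_Nil_conv weight_def)
  qed (auto simp: weight_def)
  have "shuffle_pairing (ncps_nth ?f) u v = 0" if uv: "u \<noteq> []" "v \<noteq> []" for u v
  proof (cases "weight \<tau> u + weight \<tau> v = n")
    case False
    then have "shuffle_pairing (ncps_nth ?f) u v = shuffle_pairing (\<lambda>_. 0) u v"
      by (intro shuffle_pairing_cong) (use wt f in auto)
    then show ?thesis by simp
  next
    case True
    have "shuffle_pairing (ncps_nth ?f) u v = shuffle_pairing (ncps_nth (\<psi> r)) u v"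
    proof (rule shuffle_pairing_cong)
      fix z assume "z \<in> shuffles u v"
      then have "weight \<tau> z = n" "z \<noteq> []" using wt True uv by auto
      then show "ncps_nth ?f z = ncps_nth (\<psi> r) z" using f psi by simp
    qed
    also have "\<dots> = infiltration_pairing (ncps_nth (\<psi> r)) u v"
      by (rule infiltration_pairing_eq_shuffle_pairing[symmetric, of \<tau>]) (use \<tau> low True in auto)
    also have "\<dots> = ncps_nth (\<psi> r) u * ncps_nth (\<psi> r) v"
      using psi_group_like[of r] r by (simp add: group_like_def zassenhaus_def)
    also have "\<dots> = 0" using low[OF uv(1)] pos[OF uv(2)] True by simp
    finally show ?thesis .
  qed
  moreover have "ncps_nth ?f [] = 0" using n f[of "[]"] by (simp add: weight_def)
  ultimately show ?thesis by (simp add: primitive_def)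
qed

text \<open>Take the normal core of an open subgroup missing \<open>f\<close>. It is open because
  its complement is the projection of a closed set along a compact factor, and such projections are
  closed.\<close>

lemma open_normal_avoiding:
  assumes f: "f \<in> carrier F" "f \<noteq> \<one>\<^bsub>F\<^esub>"
  obtains N where "N \<lhd> F" "openin T N" "f \<notin> N"
proof -
  have "closedin T {f}" using closedin_Hausdorff_singleton[OF Hausdorff_T] f topspace_eq by simp
  then have "openin T (topspace T - {f})" by (rule openin_diff[OF openin_topspace])
  moreover have "\<one>\<^bsub>F\<^esub> \<in> topspace T - {f}" using f topspace_eq by auto
  moreover have "\<exists>H. subgroup H F \<and> openin T H \<and> H \<subseteq> U" if "openin T U" "\<one>\<^bsub>F\<^esub> \<in> U" for U
    using profinite that unfolding profinite_group_def by blast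
  ultimately obtain H where H: "subgroup H F" "openin T H" "H \<subseteq> topspace T - {f}" by blast
  interpret H: subgroup H F by (rule H(1))
  define N where "N = {g \<in> carrier F. \<forall>y\<in>carrier F. y \<otimes>\<^bsub>F\<^esub> g \<otimes>\<^bsub>F\<^esub> inv\<^bsub>F\<^esub> y \<in> H}"
  have "N \<lhd> F"
  proof (rule F.normal_invI)
    show "subgroup N F"
    proof
      fix g h assume gh: "g \<in> N" "h \<in> N"
      have "y \<otimes>\<^bsub>F\<^esub> (g \<otimes>\<^bsub>F\<^esub> h) \<otimes>\<^bsub>F\<^esub> inv\<^bsub>F\<^esub> y \<in> H" if y: "y \<in> carrier F" for y
      proof -
        have g: "g \<in> carrier F" "h \<in> carrier F" using gh by (auto simp: N_def)
        have "y \<otimes>\<^bsub>F\<^esub> (g \<otimes>\<^bsub>F\<^esub> h) \<otimes>\<^bsub>F\<^esub> inv\<^bsub>F\<^esub> y =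
            (y \<otimes>\<^bsub>F\<^esub> g \<otimes>\<^bsub>F\<^esub> inv\<^bsub>F\<^esub> y) \<otimes>\<^bsub>F\<^esub> (y \<otimes>\<^bsub>F\<^esub> h \<otimes>\<^bsub>F\<^esub> inv\<^bsub>F\<^esub> y)"
        proof -
          have "inv\<^bsub>F\<^esub> y \<otimes>\<^bsub>F\<^esub> (y \<otimes>\<^bsub>F\<^esub> z) = z" if "z \<in> carrier F" for z
            using y that by (simp add: F.m_assoc[symmetric])
          then show ?thesis using g y by (simp add: F.m_assoc)
        qed
        moreover have "y \<otimes>\<^bsub>F\<^esub> g \<otimes>\<^bsub>F\<^esub> inv\<^bsub>F\<^esub> y \<in> H" "y \<otimes>\<^bsub>F\<^esub> h \<otimes>\<^bsub>F\<^esub> inv\<^bsub>F\<^esub> y \<in> H"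
          using gh y unfolding N_def by simp_all
        ultimately show ?thesis using H.m_closed by simp
      qed
      then show "g \<otimes>\<^bsub>F\<^esub> h \<in> N" using gh by (auto simp: N_def)
    next
      fix g assume g: "g \<in> N"
      have "y \<otimes>\<^bsub>F\<^esub> inv\<^bsub>F\<^esub> g \<otimes>\<^bsub>F\<^esub> inv\<^bsub>F\<^esub> y \<in> H" if y: "y \<in> carrier F" for y
      proof -
        have gc: "g \<in> carrier F" "y \<otimes>\<^bsub>F\<^esub> g \<otimes>\<^bsub>F\<^esub> inv\<^bsub>F\<^esub> y \<in> H" using g y by (auto simp: N_def)
        have "inv\<^bsub>F\<^esub> (y \<otimes>\<^bsub>F\<^esub> g \<otimes>\<^bsub>F\<^esub> inv\<^bsub>F\<^esub> y) = y \<otimes>\<^bsub>F\<^esub> inv\<^bsub>F\<^esub> g \<otimes>\<^bsub>F\<^esub> inv\<^bsub>F\<^esub> y"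
          using gc(1) y by (simp add: F.inv_mult_group F.m_assoc)
        with H.m_inv_closed[OF gc(2)] show ?thesis by (simp only:)
      qed
      then show "inv\<^bsub>F\<^esub> g \<in> N" using g by (auto simp: N_def)
    qed (auto simp: N_def)
  next
    fix z g assume z: "z \<in> carrier F" and g: "g \<in> N"
    have "y \<otimes>\<^bsub>F\<^esub> (z \<otimes>\<^bsub>F\<^esub> g \<otimes>\<^bsub>F\<^esub> inv\<^bsub>F\<^esub> z) \<otimes>\<^bsub>F\<^esub> inv\<^bsub>F\<^esub> y \<in> H" if y: "y \<in> carrier F" for y
    proof -
      have gc: "g \<in> carrier F" using g by (auto simp: N_def)
      have "y \<otimes>\<^bsub>F\<^esub> (z \<otimes>\<^bsub>F\<^esub> g \<otimes>\<^bsub>F\<^esub> inv\<^bsub>F\<^esub> z) \<otimes>\<^bsub>F\<^esub> inv\<^bsub>F\<^esub> y =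
          (y \<otimes>\<^bsub>F\<^esub> z) \<otimes>\<^bsub>F\<^esub> g \<otimes>\<^bsub>F\<^esub> inv\<^bsub>F\<^esub> (y \<otimes>\<^bsub>F\<^esub> z)"
        using gc y z by (simp add: F.inv_mult_group F.m_assoc)
      moreover have "(y \<otimes>\<^bsub>F\<^esub> z) \<otimes>\<^bsub>F\<^esub> g \<otimes>\<^bsub>F\<^esub> inv\<^bsub>F\<^esub> (y \<otimes>\<^bsub>F\<^esub> z) \<in> H"
        using g F.m_closed[OF y z] unfolding N_def by blast
      ultimately show ?thesis by (simp only:)
    qed
    then show "z \<otimes>\<^bsub>F\<^esub> g \<otimes>\<^bsub>F\<^esub> inv\<^bsub>F\<^esub> z \<in> N" using g z by (auto simp: N_def)
  qed
  moreover have "openin T N"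
  proof -
    let ?c = "\<lambda>(g, y). y \<otimes>\<^bsub>F\<^esub> g \<otimes>\<^bsub>F\<^esub> inv\<^bsub>F\<^esub> y"
    have mult: "continuous_map (prod_topology T T) T (\<lambda>z. s z \<otimes>\<^bsub>F\<^esub> t z)"
      if "continuous_map (prod_topology T T) T s" "continuous_map (prod_topology T T) T t" for s t
      using continuous_map_compose[OF continuous_map_pairedI[OF that] mult_continuous] by (simp add: o_def)
    have "continuous_map (prod_topology T T) T (\<lambda>z. snd z \<otimes>\<^bsub>F\<^esub> fst z \<otimes>\<^bsub>F\<^esub> inv\<^bsub>F\<^esub> (snd z))"
      by (intro mult continuous_map_fst continuous_map_snd
          continuous_map_compose[OF continuous_map_snd inv_continuous, unfolded o_def])
    then have "openin (prod_topology T T)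
        {z \<in> topspace (prod_topology T T). snd z \<otimes>\<^bsub>F\<^esub> fst z \<otimes>\<^bsub>F\<^esub> inv\<^bsub>F\<^esub> (snd z) \<in> H}"
      by (rule openin_continuous_map_preimage) (rule H(2))
    then have "closedin (prod_topology T T) (topspace (prod_topology T T) -
        {z \<in> topspace (prod_topology T T). snd z \<otimes>\<^bsub>F\<^esub> fst z \<otimes>\<^bsub>F\<^esub> inv\<^bsub>F\<^esub> (snd z) \<in> H})" (is "closedin _ ?B")
      by (rule closedin_diff[OF closedin_topspace])
    then have "closedin T (fst ` ?B)"
      using closed_map_fst[OF compact_T, of T] unfolding closed_map_def by blast
    moreover have "N = topspace T - fst ` ?B"
    proof (intro equalityI subsetI)
      fix g assume "g \<in> topspace T - fst ` ?B"
      then have g: "g \<in> carrier F" "g \<notin> fst ` ?B" by (simp_all add: topspace_eq)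
      have "y \<otimes>\<^bsub>F\<^esub> g \<otimes>\<^bsub>F\<^esub> inv\<^bsub>F\<^esub> y \<in> H" if "y \<in> carrier F" for y
      proof (rule ccontr)
        assume "y \<otimes>\<^bsub>F\<^esub> g \<otimes>\<^bsub>F\<^esub> inv\<^bsub>F\<^esub> y \<notin> H"
        then have "(g, y) \<in> ?B" using g(1) that by (simp add: topspace_eq)
        then have "g \<in> fst ` ?B" by (rule rev_image_eqI) simp
        then show False using g(2) by simp
      qed
      then show "g \<in> N" using g(1) by (simp add: N_def)
    qed (auto simp: N_def topspace_eq)
    ultimately show ?thesis by (simp add: openin_diff)
  qed
  moreover have "f \<notin> N"
  proof
    assume "f \<in> N"
    then have "\<one>\<^bsub>F\<^esub> \<otimes>\<^bsub>F\<^esub> f \<otimes>\<^bsub>F\<^esub> inv\<^bsub>F\<^esub> \<one>\<^bsub>F\<^esub> \<in> H"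
      unfolding N_def using F.one_closed by blast
    then have "f \<in> H" using f(1) by simp
    then show False using H(3) by blast
  qed
  ultimately show thesis by (rule that)
qed

text \<open>A non-trivial element survives in some finite \<open>p\<close>-group quotient \<open>Q\<close>, which acts
  unipotently on the functions \<open>Q \<Rightarrow> \<F>\<^sub>p\<close>, so that \<open>X\<^sub>i \<mapsto> x\<^sub>i - 1\<close> can be evaluated there.\<close>

lemma psi_eq_one_imp:
  assumes f: "f \<in> carrier F" "\<psi> f = 1"
  shows "f = \<one>\<^bsub>F\<^esub>"
proof (rule ccontr)
  assume "f \<noteq> \<one>\<^bsub>F\<^esub>"
  then obtain N where N: "N \<lhd> F" "openin T N" "f \<notin> N" using open_normal_avoiding f(1) by blast
  interpret N: normal N F by (rule N(1))
  let ?Q = "F Mod N" and ?q = "\<lambda>g. N #>\<^bsub>F\<^esub> g"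
  interpret Q: group ?Q by (rule N.factorgroup_is_group)
  interpret q: group_hom F ?Q ?q
    using N.r_coset_hom_Mod by (intro group_hom.intro group_hom_axioms.intro) (auto intro: F.group_axioms Q.group_axioms)
  obtain k where k: "order ?Q = CARD('p) ^ k" using open_normal_quotient[OF N(1,2)] by blast
  from translate_unipotent[OF Q.group_axioms k] obtain M where
    M: "\<And>gs (v :: 'a set \<Rightarrow> 'p mod_ring). set gs \<subseteq> carrier ?Q \<Longrightarrow> M \<le> length gs \<Longrightarrow>
      (\<And>y. y \<notin> carrier ?Q \<Longrightarrow> v y = 0) \<Longrightarrow> difference_word (translate ?Q) gs v = 0" by blast
  \<comment> \<open>The indicator of the identity has distinct translates, so its translate by the
    image of \<open>f\<close> detects whether that image is trivial.\<close>
  define v :: "'a set \<Rightarrow> 'p mod_ring" where "v y = (if y = \<one>\<^bsub>?Q\<^esub> then 1 else 0)" for y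
  have v0: "v y = 0" if "y \<notin> carrier ?Q" for y
    using that Q.one_closed unfolding v_def by metis
  define D where "D w = difference_word (translate ?Q) (map (\<lambda>i. ?q (x i)) w) v" for w
  have D_Nil: "D [] = v" and D_Cons: "D (i # w) y = translate ?Q (?q (x i)) (D w) y - D w y" for i w y
    by (simp_all add: D_def)
  have D_0: "D w = 0" if "M \<le> length w" for w
    unfolding D_def by (rule M) (use that v0 q.hom_closed in auto)
  define A where "A = {w :: 'i list. length w < M}"
  have finA: "finite A"
    by (rule finite_subset[OF _ finite_lists_length_le[of "UNIV :: 'i set" M]]) (auto simp: A_def)
  \<comment> \<open>The series \<open>g\<close>, with each X_i acting as translation by the image of
    \<open>x i\<close> minus 1, applied to \<open>v\<close>. By unipotence only the words in
    \<open>A\<close> contribute, so the sum is finite.\<close>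
  define \<Theta> where "\<Theta> g y = (\<Sum>w\<in>A. ncps_nth g w * D w y)" for g y
  have \<Theta>_step: "\<Theta> ((1 + ncps_X i) * g) y = translate ?Q (?q (x i)) (\<Theta> g) y" for g i y
  proof -
    let ?h = "\<lambda>w. if w \<noteq> [] \<and> hd w = i then ncps_nth g (tl w) * D w y else 0"
    \<comment> \<open>The two index sets differ in the empty word, where \<open>?h\<close> is 0, in
      words not starting with \<open>i\<close>, and in words of length \<open>M\<close>, where
      \<open>D\<close> is 0.\<close>
    have "(\<Sum>w\<in>A. ?h w) = (\<Sum>w\<in>(#) i ` A. ?h w)"
    proof (rule sum.mono_neutral_cong)
      show "?h w = 0" if "w \<in> A - (#) i ` A" for w
        using that by (cases w) (auto simp: A_def)
      show "?h w = 0" if "w \<in> (#) i ` A - A" for w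
        using that D_0[of w] by (auto simp: A_def)
    qed (use finA in auto)
    also have "\<dots> = (\<Sum>w\<in>A. ncps_nth g w * D (i # w) y)"
      by (subst sum.reindex) auto
    finally have h: "(\<Sum>w\<in>A. ?h w) = (\<Sum>w\<in>A. ncps_nth g w * D (i # w) y)" .
    have "\<Theta> ((1 + ncps_X i) * g) y = (\<Sum>w\<in>A. ncps_nth g w * D w y + ?h w)"
      unfolding \<Theta>_def ncps_nth_one_plus_X_mult by (intro sum.cong refl) (auto simp: distrib_right)
    also have "\<dots> = (\<Sum>w\<in>A. ncps_nth g w * D w y + ncps_nth g w * D (i # w) y)"
      unfolding sum.distrib h ..
    also have "\<dots> = (\<Sum>w\<in>A. ncps_nth g w * translate ?Q (?q (x i)) (D w) y)"
      by (intro sum.cong refl) (simp add: D_Cons algebra_simps)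
    also have "\<dots> = translate ?Q (?q (x i)) (\<Theta> g) y"
      by (simp add: translate_def \<Theta>_def)
    finally show ?thesis .
  qed
  have \<Theta>_word: "\<Theta> (\<psi> (positive_word zs)) y = translate ?Q (?q (positive_word zs)) (\<Theta> 1) y"
    if "y \<in> carrier ?Q" for zs y
    using that
  proof (induction zs arbitrary: y)
    case Nil
    then show ?case
      unfolding positive_word_simps psi_one q.hom_one translate_def by (simp only: if_True Q.r_one)
  next
    case (Cons i zs)
    have c: "y \<otimes>\<^bsub>?Q\<^esub> ?q (x i) \<in> carrier ?Q" using Cons.prems q.hom_closed by (intro Q.m_closed) auto
    have "\<Theta> (\<psi> (positive_word (i # zs))) y = \<Theta> (\<psi> (positive_word zs)) (y \<otimes>\<^bsub>?Q\<^esub> ?q (x i))"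
      using Cons.prems by (simp add: psi_mult psi_x \<Theta>_step translate_def)
    also have "\<dots> = \<Theta> 1 (y \<otimes>\<^bsub>?Q\<^esub> ?q (x i) \<otimes>\<^bsub>?Q\<^esub> ?q (positive_word zs))"
      using Cons.IH[OF c] c by (simp add: translate_def)
    also have "y \<otimes>\<^bsub>?Q\<^esub> ?q (x i) \<otimes>\<^bsub>?Q\<^esub> ?q (positive_word zs) = y \<otimes>\<^bsub>?Q\<^esub> ?q (positive_word (i # zs))"
      unfolding positive_word_simps q.hom_mult[OF x_in positive_word_closed]
      by (rule Q.m_assoc[OF Cons.prems q.hom_closed[OF x_in] q.hom_closed[OF positive_word_closed]])
    finally show ?case using Cons.prems by (simp add: translate_def)
  qed
  have \<Theta>_agree: "\<Theta> g = \<Theta> h" if "agree M g h" for g h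
    unfolding \<Theta>_def by (intro ext sum.cong refl) (use that in \<open>auto simp: agree_def A_def\<close>)
  have \<Theta>_1: "\<Theta> 1 = v"
  proof (rule ext)
    fix y
    show "\<Theta> 1 y = v y"
    proof (cases "M = 0")
      case True
      then show ?thesis using D_0[of "[]"] D_Nil by (simp add: \<Theta>_def A_def)
    next
      case False
      have "\<Theta> 1 y = (\<Sum>w\<in>A. if w = [] then D w y else 0)"
        unfolding \<Theta>_def by (rule sum.cong) (auto simp: ncps_nth_one)
      then show ?thesis using finA False D_Nil by (simp add: A_def)
    qed
  qed
  obtain zs where zs: "agree M (\<psi> (positive_word zs)) (\<psi> f)" "?q (positive_word zs) = ?q f"
    using approx[OF N(1,2) f(1)] by blast
  \<comment> \<open>At the identity the value is 1 since \<psi>(f) = 1, while translation turns it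
    into \<open>v (?q f)\<close>. Hence the image of \<open>f\<close> is trivial, contrary to the
    choice of \<open>N\<close>.\<close>
  have "v \<one>\<^bsub>?Q\<^esub> = \<Theta> (\<psi> (positive_word zs)) \<one>\<^bsub>?Q\<^esub>"
    using \<Theta>_agree[OF zs(1)] f(2) \<Theta>_1 by simp
  also have "\<dots> = v (?q f)"
    unfolding \<Theta>_word[OF Q.one_closed] zs(2) \<Theta>_1 translate_def
    using q.hom_closed[OF f(1)] by (simp only: Q.one_closed if_True Q.l_one)
  finally have "?q f = \<one>\<^bsub>?Q\<^esub>" by (auto simp: v_def split: if_splits)
  then have "?q f = N" by (simp add: FactGroup_def)
  then show False using N(3) F.rcos_self[OF f(1) N.subgroup_axioms] by simp
qed

end

lemma lie_homogeneous_strongly_free: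
  fixes f :: "('i::finite, 'p::prime_card mod_ring) ncps"
  assumes \<tau>: "\<And>i. 0 < \<tau> i" and hom: "\<And>w. ncps_nth f w \<noteq> 0 \<Longrightarrow> weight \<tau> w = n"
    and lie: "f \<in> free_lie_algebra" and "f \<noteq> 0"
  shows "strongly_free \<tau> f"
proof -
  obtain key :: "'i \<Rightarrow> nat" where key: "inj key"
    using finite_imp_inj_to_nat_seg[OF finite_class.finite_UNIV] by blast
  obtain w0 where w0: "ncps_nth f w0 \<noteq> 0" using \<open>f \<noteq> 0\<close> by (auto simp: ncps_eq_iff)
  \<comment> \<open>Shuffles preserve length, so the Lyndon criterion compares words of one length
    only. Choosing the least length in the support makes the word found there leading for the
    length-first order as well.\<close>
  define L where "L = (LEAST l. \<exists>w. ncps_nth f w \<noteq> 0 \<and> length w = l)"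
  have ex: "\<exists>l. \<exists>w. ncps_nth f w \<noteq> 0 \<and> length w = l" using w0 by blast
  have L: "\<exists>w. ncps_nth f w \<noteq> 0 \<and> length w = L" unfolding L_def by (rule LeastI_ex[OF ex])
  have L_le: "L \<le> length w" if "ncps_nth f w \<noteq> 0" for w
    unfolding L_def by (rule Least_le) (use that in blast)
  let ?S = "{w. ncps_nth f w \<noteq> 0 \<and> length w = L}"
  have finS: "finite ?S"
    by (rule finite_subset[OF _ finite_lists_length_eq[of "UNIV :: 'i set" L]]) auto
  have "Min (map key ` ?S) \<in> map key ` ?S" by (rule Min_in) (use finS L in auto)
  then obtain w where w: "w \<in> ?S" "Min (map key ` ?S) = map key w" by auto
  have least: "map key w \<le> map key y" if "y \<in> ?S" for y
    using Min_le[of "map key ` ?S" "map key y"] finS that w(2) by auto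
  have lyn: "lyndon (map key w)"
  proof (rule free_lie_least_word_lyndon[OF key lie])
    show "ncps_nth f y = 0" if "length y = length w" "map key y < map key w" for y
      using least[of y] that w(1) by force
  qed (use w in auto)
  interpret leading_word key \<tau> n f w
  proof
    show "length w < length s \<or> length w = length s \<and> map key w < map key s"
      if "ncps_nth f s \<noteq> 0" "s \<noteq> w" for s
    proof (cases "length s = L")
      case True
      then have "map key w \<le> map key s" using least that by simp
      moreover have "map key w \<noteq> map key s" using that(2) key by (simp add: inj_map_eq_map)
      ultimately show ?thesis using True w(1) by simp
    next
      case False
      then show ?thesis using L_le[OF that(1)] w(1) by simp
    qed
    show "b = w" if "w = b @ x" "w = y @ b" "b \<noteq> []" for b x y
    proof -
      have "map key b = map key w"
        by (rule lyndon_unbordered[OF lyn, of _ "map key x" "map key y"])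
          (use that in \<open>simp_all flip: map_append\<close>)
      then show ?thesis using key by (simp add: inj_map_eq_map)
    qed
    show "w \<noteq> []" using lyn by (auto simp: lyndon_def)
  qed (use key \<tau> hom w in auto)
  show ?thesis by (rule strongly_free)
qed

context magnus_embedding
begin

section \<open>Initial forms of group elements\<close>

lemma initial_degree_eq:
  assumes "r \<in> zassenhaus F \<psi> \<tau> n" "r \<notin> zassenhaus F \<psi> \<tau> (n + 1)"
  shows "initial_degree F \<psi> \<tau> r = n"
  unfolding initial_degree_def
proof (rule Greatest_equality)
  show "r \<in> zassenhaus F \<psi> \<tau> n" by (rule assms(1))
next
  fix m assume "r \<in> zassenhaus F \<psi> \<tau> m"
  then show "m \<le> n" using assms by (fastforce simp: zassenhaus_def not_less_eq_eq)
qed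

lemma initial_form_homogeneous:
  "ncps_nth (initial_form F \<psi> \<tau> r) w \<noteq> 0 \<Longrightarrow> weight \<tau> w = initial_degree F \<psi> \<tau> r"
  by (simp add: initial_form_def homogeneous_part_def split: if_splits)

text \<open>Injectivity of the Magnus map gives \<psi>(r) - 1 a nonzero coefficient, so the
  filtration steps containing \<open>r\<close> are bounded and the \<open>GREATEST\<close> in
  \<open>initial_degree\<close> is attained. For the identity it would have no meaning.\<close>

lemma initial_form_nonzero:
  assumes "r \<in> carrier F" "r \<noteq> \<one>\<^bsub>F\<^esub>"
  shows "initial_form F \<psi> \<tau> r \<noteq> 0"
proof -
  have "\<psi> r - 1 \<noteq> 0" using psi_eq_one_imp assms by auto
  then obtain w0 where w0: "ncps_nth (\<psi> r - 1) w0 \<noteq> 0" unfolding ncps_eq_iff by auto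
  define n where "n = (LEAST n. \<exists>w. ncps_nth (\<psi> r - 1) w \<noteq> 0 \<and> weight \<tau> w = n)"
  have ex: "\<exists>n. \<exists>w. ncps_nth (\<psi> r - 1) w \<noteq> 0 \<and> weight \<tau> w = n" using w0 by blast
  obtain w where w: "ncps_nth (\<psi> r - 1) w \<noteq> 0" "weight \<tau> w = n"
    using LeastI_ex[OF ex] unfolding n_def by blast
  have "n \<le> weight \<tau> w" if "ncps_nth (\<psi> r - 1) w \<noteq> 0" for w
    unfolding n_def by (rule Least_le) (use that in blast)
  then have "r \<in> zassenhaus F \<psi> \<tau> n" using assms(1) by (simp add: zassenhaus_def)
  moreover have "r \<notin> zassenhaus F \<psi> \<tau> (n + 1)" using w by (force simp: zassenhaus_def)
  ultimately have "initial_degree F \<psi> \<tau> r = n" by (rule initial_degree_eq)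
  then have "ncps_nth (initial_form F \<psi> \<tau> r) w \<noteq> 0"
    using w by (simp add: initial_form_def homogeneous_part_def)
  then show ?thesis by auto
qed

lemma initial_form_strongly_free:
  assumes "r \<in> carrier F" "r \<noteq> \<one>\<^bsub>F\<^esub>" "\<And>i. 0 < \<tau> i" "initial_form F \<psi> \<tau> r \<in> free_lie_algebra"
  shows "strongly_free \<tau> (initial_form F \<psi> \<tau> r)"
  by (rule lie_homogeneous_strongly_free[OF assms(3) initial_form_homogeneous assms(4) initial_form_nonzero[OF assms(1,2)]])

lemma initial_form_free_lie:
  assumes \<tau>: "\<And>i. 0 < \<tau> i" and n: "coprime n CARD('p)"
    and r: "r \<in> zassenhaus F \<psi> \<tau> n" "r \<notin> zassenhaus F \<psi> \<tau> (n + 1)"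
  shows "initial_form F \<psi> \<tau> r \<in> free_lie_algebra"
proof -
  have "\<not> CARD('p) dvd n"
    using n prime_card[where 'a = 'p] by (meson coprime_common_divisor dvd_refl not_prime_unit)
  then have n0: "(of_nat n :: 'p mod_ring) \<noteq> 0" using of_nat_0_mod_ring_dvd by blast
  \<comment> \<open>The degree 0 is excluded because its image in the prime field is 0.\<close>
  then have "0 < n" by (cases n) auto
  have form: "initial_form F \<psi> \<tau> r = homogeneous_part \<tau> n (\<psi> r - 1)"
    unfolding initial_form_def initial_degree_eq[OF r] ..
  have hom: "weight \<tau> w = n" if "ncps_nth (initial_form F \<psi> \<tau> r) w \<noteq> 0" for w
    using initial_form_homogeneous[OF that] initial_degree_eq[OF r] by simp
  have len: "length w \<le> weight \<tau> w" for w
  proof (induction w)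
    case (Cons i w)
    then show ?case using \<tau>[of i] by (simp add: weight_def)
  qed (simp add: weight_def)
  have fin: "finite {w. ncps_nth (initial_form F \<psi> \<tau> r) w \<noteq> 0}"
    by (rule finite_subset[OF _ finite_lists_length_le[of "UNIV :: 'i set" n]])
      (use hom len in fastforce)+
  show ?thesis
    by (rule primitive_homogeneous_free_lie[OF _ fin hom n0])
      (use initial_form_primitive[OF \<tau> \<open>0 < n\<close> r(1)] form in simp)
qed

end

theorem theorem5p9:
  fixes F :: "('a, 'b) monoid_scheme" and T :: "'a topology" and x :: "'i::finite \<Rightarrow> 'a"
    and \<psi> :: "'a \<Rightarrow> ('i, 'p::prime_card mod_ring) ncps"
  assumes "free_pro_p_group CARD('p) F T x"
    and "magnus_map F T x \<psi>"
  shows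
    "(\<forall>r \<tau>. r \<noteq> \<one>\<^bsub>F\<^esub> \<and> r \<in> zassenhaus F \<psi> (\<lambda>_. 1) 2 \<and> (\<forall>i. 0 < \<tau> i) \<and>
        initial_form F \<psi> \<tau> r \<in> free_lie_algebra \<longrightarrow>
        mild F T \<psi> \<tau> r (F Mod closed_normal_closure F T {r})) \<and>
     (\<forall>r \<tau> n. r \<in> zassenhaus F \<psi> (\<lambda>_. 1) 2 \<and> (\<forall>i. 0 < \<tau> i) \<and> coprime n CARD('p) \<and>
        r \<in> zassenhaus F \<psi> \<tau> n - zassenhaus F \<psi> \<tau> (n + 1) \<longrightarrow>
        mild F T \<psi> \<tau> r (F Mod closed_normal_closure F T {r}))"
proof -
  interpret magnus_embedding F T x \<psi>
    using assms by (intro magnus_embedding.intro) (simp_all add: free_pro_p_group_def)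
  have carr: "r \<in> carrier F" if "r \<in> zassenhaus F \<psi> \<tau> n" for r \<tau> n
    using that by (simp add: zassenhaus_def)
  \<comment> \<open>In (ii) nontriviality of \<open>r\<close> is a consequence: the identity lies in
    every step of the filtration.\<close>
  have ne: "r \<noteq> \<one>\<^bsub>F\<^esub>" if "r \<notin> zassenhaus F \<psi> \<tau> n" for r \<tau> n
    using that by (auto simp: zassenhaus_def psi_one)
  show ?thesis
    unfolding mild_def
    using initial_form_strongly_free initial_form_free_lie carr ne by (metis DiffE)
qed

end
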